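(* Let $R,T_0>0$, $\gamma>0$, and let $a=a(x,t)\in L^\infty(\mathbb R_x;C_{\rm c}^\infty(\mathbb R_t))$ with $\operatorname{supp} a\subset[-R,R]\times[-T_0,T_0]$. Put $$P:=D_x^2-\omega^2+A(x),\qquad A(x):=a(x,D_\omega)\,\frac{\omega}{\omega+i\gamma}.$$ Then there exist operators $T,R_+$, bounded as maps $$T,\,R_+:\ (\omega+i)^{-1}H_\alpha\to\omega^{-1}H_{\alpha+2R},\qquad \alpha\in\mathbb R,$$ such that for every $f\in(\omega+i)^{-1}H_{-R}$ there exists a unique solution $u=u(x,\omega)\in\omega^{-1}\mathscr H_{\infty,\rm loc}$ of $Pu=0$ satisfying $$u(x,\omega)=\begin{cases} f(\omega)e^{i\omega x}+(R_+f)(\omega)\,e^{-i\omega x},& x<-R,\\ (Tf)(\omega)\,e^{i\omega x},& x>R.\end{cases}$$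
   Context: All functions are complex valued. $\mathbb C_+=\{\omega\in\mathbb C:\operatorname{Im}\omega>0\}$, $\mathscr O(\mathbb C_+)$ denotes the holomorphic functions on $\mathbb C_+$, and $D_x=\frac1i\partial_x$. For $\alpha\in\mathbb R$, $$H_\alpha:=\Big\{f\in\mathscr O(\mathbb C_+):\ \sup_{\sigma>0}e^{-2\sigma\alpha}\int_{\mathbb R}|f(\lambda+i\sigma)|^2\,d\lambda<\infty\Big\},$$ a Hilbert space with norm squared given by the supremum. For $s\ge 0$, $\mathscr H^s_\alpha$ is the space of functions $f:\mathbb R\times\mathbb C_+\to\mathbb C$ with $f(x,\bullet)\in\mathscr O(\mathbb C_+)$ and $$\sup_{\sigma>0}e^{-2\sigma\alpha}\int_{\mathbb R}\|f(\cdot,\lambda+i\sigma)\|_{H^s(\mathbb R)}^2\,d\lambda<\infty .$$ Write $\mathscr H_\alpha=\mathscr H_\alpha^0$, $\mathscr H_\infty=\bigcup_\alpha\mathscr H_\alpha$, and let $\mathscr H_{\infty,\rm loc}$ be the space of $u$ with $u(x,\bullet)\in\mathscr O(\mathbb C_+)$ and $\chi(x)u(x,\omega)\in\mathscr H_\infty$ for every $\chi\in C_{\rm c}^\infty(\mathbb R)$. For a space $X$ of functions of $\omega$ (or of $(x,\omega)$) and a nonvanishing holomorphic $m(\omega)$ on $\mathbb C_+$, $m(\omega)X:=\{m g: g\in X\}$ with the norm transported from $X$; in particular $\omega^{-1}X$ and $(\omega+i)^{-1}X$. Fourier transform convention in time: $\widehat h(\omega)=\int_{\mathbb R}h(t)e^{i\omega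 t}\,dt$. The operator $a(x,D_\omega)$ acts on each line $\operatorname{Im}\omega=\sigma$ by $$[a(x,D_\omega)v](x,\omega+i\sigma):=\frac1{2\pi}\int_{\mathbb R}\widehat{a(x,\bullet)}(\omega-\lambda)\,v(x,\lambda+i\sigma)\,d\lambda,\qquad \omega\in\mathbb R,\ \sigma>0,$$ and $A(x)v$ means $a(x,D_\omega)$ applied to $\frac{\omega}{\omega+i\gamma}v$. *)

theory Defs
  imports "HOL-Complex_Analysis.Complex_Analysis"
begin

text \<open>
  A function on the upper half-plane \<open>\<complex>\<^sub>+\<close> is represented by a total function on \<^typ>\<open>complex\<close>;
  only its values on \<open>\<complex>\<^sub>+\<close> are ever used.  A function of \<open>(x, \<omega>)\<close> is represented as
  \<open>f x \<omega>\<close>; in the variable \<open>x\<close> functions matter up to Lebesgue-null sets only.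
\<close>

definition Cplus :: "complex set" where
  "Cplus = {\<omega>. 0 < Im \<omega>}"


subsection \<open>Smooth and test functions on the line\<close>

definition vderiv :: "(real \<Rightarrow> complex) \<Rightarrow> real \<Rightarrow> complex" where
  "vderiv f = (\<lambda>t. vector_derivative f (at t))"

definition D\<^sub>x :: "(real \<Rightarrow> complex) \<Rightarrow> real \<Rightarrow> complex" where
  "D\<^sub>x f = (\<lambda>x. vderiv f x / \<i>)"

definition smooth :: "(real \<Rightarrow> complex) \<Rightarrow> bool" where
  "smooth f \<longleftrightarrow> (\<forall>k t. (vderiv ^^ k) f differentiable (at t))"

definition test_function :: "(real \<Rightarrow> complex) \<Rightarrow> bool" where
  "test_function f \<longleftrightarrow> smooth f \<and> compact (closure {t. f t \<noteq> 0})"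


subsection \<open>The spaces \<open>H\<^sub>\<alpha>\<close>\<close>

definition H_normsq :: "real \<Rightarrow> (complex \<Rightarrow> complex) \<Rightarrow> ennreal" where
  "H_normsq \<alpha> f =
     (SUP \<sigma>\<in>{0<..}. ennreal (exp (- 2 * \<sigma> * \<alpha>)) *
        (\<integral>\<^sup>+l. ennreal ((cmod (f (Complex l \<sigma>)))\<^sup>2) \<partial>lborel))"

definition H_space :: "real \<Rightarrow> (complex \<Rightarrow> complex) set" where
  "H_space \<alpha> = {f. f holomorphic_on Cplus \<and> H_normsq \<alpha> f < \<infinity>}"

definition H_norm :: "real \<Rightarrow> (complex \<Rightarrow> complex) \<Rightarrow> real" where
  "H_norm \<alpha> f = sqrt (enn2real (H_normsq \<alpha> f))"

text \<open>The space \<open>m(\<omega>)H\<^sub>\<alpha>\<close>, for \<open>m\<close> holomorphic without zeros on \<open>\<complex>\<^sub>+\<close>, with the transported norm.\<close>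

definition mult_H :: "(complex \<Rightarrow> complex) \<Rightarrow> real \<Rightarrow> (complex \<Rightarrow> complex) set" where
  "mult_H m \<alpha> = {f. \<exists>g\<in>H_space \<alpha>. \<forall>\<omega>\<in>Cplus. f \<omega> = m \<omega> * g \<omega>}"

definition mult_H_norm :: "(complex \<Rightarrow> complex) \<Rightarrow> real \<Rightarrow> (complex \<Rightarrow> complex) \<Rightarrow> real" where
  "mult_H_norm m \<alpha> f = H_norm \<alpha> (\<lambda>\<omega>. f \<omega> / m \<omega>)"

text \<open>
  Bounded linear operators \<open>m(\<omega>)H\<^sub>\<alpha> \<rightarrow> n(\<omega>)H\<^sub>\<beta>\<close>.  Linearity and the norm bound together imply that
  the restriction of \<open>L f\<close> to \<open>\<complex>\<^sub>+\<close> depends only on the restriction of \<open>f\<close> to \<open>\<complex>\<^sub>+\<close>.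
\<close>

definition bounded_H_operator ::
    "(complex \<Rightarrow> complex) \<Rightarrow> real \<Rightarrow> (complex \<Rightarrow> complex) \<Rightarrow> real
       \<Rightarrow> ((complex \<Rightarrow> complex) \<Rightarrow> complex \<Rightarrow> complex) \<Rightarrow> bool" where
  "bounded_H_operator m \<alpha> n \<beta> L \<longleftrightarrow>
     (\<forall>f\<in>mult_H m \<alpha>. L f \<in> mult_H n \<beta>) \<and>
     (\<forall>f\<in>mult_H m \<alpha>. \<forall>g\<in>mult_H m \<alpha>. \<forall>c d. \<forall>\<omega>\<in>Cplus.
        L (\<lambda>z. c * f z + d * g z) \<omega> = c * L f \<omega> + d * L g \<omega>) \<and>
     (\<exists>C. \<forall>f\<in>mult_H m \<alpha>. mult_H_norm n \<beta> (L f) \<le> C * mult_H_norm m \<alpha> f)"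


subsection \<open>The spaces of functions of \<open>(x, \<omega>)\<close>\<close>

text \<open>
  Measurability in \<open>x\<close> is part of \<open>f(\<cdot>, \<omega>) \<in> L\<^sup>2(\<real>)\<close>; it has to be stated, since the nonnegative
  integral is also defined for non-measurable functions.
\<close>

definition scriptH_space :: "real \<Rightarrow> (real \<Rightarrow> complex \<Rightarrow> complex) set" where
  "scriptH_space \<alpha> = {f.
     (\<forall>x. f x holomorphic_on Cplus) \<and>
     (\<forall>\<omega>\<in>Cplus. (\<lambda>x. f x \<omega>) \<in> borel_measurable lebesgue) \<and>
     (SUP \<sigma>\<in>{0<..}. ennreal (exp (- 2 * \<sigma> * \<alpha>)) *
        (\<integral>\<^sup>+l. (\<integral>\<^sup>+x. ennreal ((cmod (f x (Complex l \<sigma>)))\<^sup>2) \<partial>lebesgue) \<partial>lborel)) < \<infinity>}"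

definition scriptH_infty :: "(real \<Rightarrow> complex \<Rightarrow> complex) set" where
  "scriptH_infty = (\<Union>\<alpha>. scriptH_space \<alpha>)"

definition scriptH_infty_loc :: "(real \<Rightarrow> complex \<Rightarrow> complex) set" where
  "scriptH_infty_loc = {u.
     (\<forall>x. u x holomorphic_on Cplus) \<and>
     (\<forall>\<psi>. test_function \<psi> \<longrightarrow> (\<lambda>x \<omega>. \<psi> x * u x \<omega>) \<in> scriptH_infty)}"

definition mult_scriptH_infty_loc :: "(complex \<Rightarrow> complex) \<Rightarrow> (real \<Rightarrow> complex \<Rightarrow> complex) set" where
  "mult_scriptH_infty_loc m =
     {u. \<exists>g\<in>scriptH_infty_loc. \<forall>x. \<forall>\<omega>\<in>Cplus. u x \<omega> = m \<omega> * g x \<omega>}"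


subsection \<open>The coefficient and the operator \<open>P\<close>\<close>

text \<open>
  Membership in \<open>L\<^sup>\<infinity>(\<real>\<^sub>x; C\<^sub>c\<^sup>\<infinity>(\<real>\<^sub>t))\<close> with support in \<open>[-R,R] \<times> [-T\<^sub>0,T\<^sub>0]\<close>: measurability of
  \<open>x \<mapsto> a(x,\<cdot>)\<close> is measurability of all point evaluations, and boundedness is essential
  boundedness in \<open>x\<close> of each seminorm \<open>sup\<^sub>t |\<partial>\<^sub>t\<^sup>k a(x,t)|\<close>.
\<close>

definition Linfty_Cc_coefficient :: "real \<Rightarrow> real \<Rightarrow> (real \<Rightarrow> real \<Rightarrow> complex) \<Rightarrow> bool" where
  "Linfty_Cc_coefficient R T\<^sub>0 a \<longleftrightarrow>
     (\<forall>t. (\<lambda>x. a x t) \<in> borel_measurable lebesgue) \<and>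
     (AE x in lebesgue. smooth (a x)) \<and>
     (\<forall>k. \<exists>C. AE x in lebesgue. \<forall>t. cmod ((vderiv ^^ k) (a x) t) \<le> C) \<and>
     (AE x in lebesgue. \<forall>t. (x, t) \<notin> {-R..R} \<times> {-T\<^sub>0..T\<^sub>0} \<longrightarrow> a x t = 0)"

definition fourier :: "(real \<Rightarrow> complex) \<Rightarrow> real \<Rightarrow> complex" where
  "fourier h \<omega> = (LINT t|lborel. h t * exp (\<i> * of_real (\<omega> * t)))"

definition a_D :: "(real \<Rightarrow> real \<Rightarrow> complex) \<Rightarrow> (real \<Rightarrow> complex \<Rightarrow> complex)
    \<Rightarrow> real \<Rightarrow> complex \<Rightarrow> complex" where
  "a_D a v x z =
     1 / (2 * of_real pi) *
       (LINT l|lborel. fourier (a x) (Re z - l) * v x (Complex l (Im z)))"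

definition A_op :: "(real \<Rightarrow> real \<Rightarrow> complex) \<Rightarrow> real \<Rightarrow> (real \<Rightarrow> complex \<Rightarrow> complex)
    \<Rightarrow> real \<Rightarrow> complex \<Rightarrow> complex" where
  "A_op a \<gamma> v = a_D a (\<lambda>x \<omega>. \<omega> / (\<omega> + \<i> * of_real \<gamma>) * v x \<omega>)"

text \<open>
  \<open>Pu = 0\<close> for \<open>P = D\<^sub>x\<^sup>2 - \<omega>\<^sup>2 + A(x)\<close>, in the sense of distributions in \<open>x\<close>, for every
  \<open>\<omega> \<in> \<complex>\<^sub>+\<close>.  The transpose of \<open>D\<^sub>x\<close> is \<open>-D\<^sub>x\<close>, so \<open>D\<^sub>x\<^sup>2\<close> is its own transpose.
\<close>

definition P_null :: "(real \<Rightarrow> real \<Rightarrow> complex) \<Rightarrow> real \<Rightarrow> (real \<Rightarrow> complex \<Rightarrow> complex) \<Rightarrow> bool" where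
  "P_null a \<gamma> u \<longleftrightarrow>
     (\<forall>\<phi>. test_function \<phi> \<longrightarrow> (\<forall>\<omega>\<in>Cplus.
        has_bochner_integral lebesgue
          (\<lambda>x. u x \<omega> * D\<^sub>x (D\<^sub>x \<phi>) x + (A_op a \<gamma> u x \<omega> - \<omega>\<^sup>2 * u x \<omega>) * \<phi> x) 0))"

text \<open>
  Scattering solution with incident coefficient \<open>f\<close>, reflected coefficient \<open>r\<close> and
  transmitted coefficient \<open>s\<close>.
\<close>

definition scattering_solution ::
    "real \<Rightarrow> real \<Rightarrow> (real \<Rightarrow> real \<Rightarrow> complex) \<Rightarrow> (complex \<Rightarrow> complex) \<Rightarrow> (complex \<Rightarrow> complex)
       \<Rightarrow> (complex \<Rightarrow> complex) \<Rightarrow> (real \<Rightarrow> complex \<Rightarrow> complex) \<Rightarrow> bool" where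
  "scattering_solution R \<gamma> a f r s u \<longleftrightarrow>
     u \<in> mult_scriptH_infty_loc (\<lambda>\<omega>. inverse \<omega>) \<and>
     P_null a \<gamma> u \<and>
     (\<forall>x \<omega>. \<omega> \<in> Cplus \<longrightarrow>
        (x < -R \<longrightarrow>
           u x \<omega> = f \<omega> * exp (\<i> * \<omega> * of_real x) + r \<omega> * exp (- \<i> * \<omega> * of_real x)) \<and>
        (x > R \<longrightarrow> u x \<omega> = s \<omega> * exp (\<i> * \<omega> * of_real x)))"

end

theory Submission
  imports Defs "HOL-Probability.Sinc_Integral"
begin

text \<open>
  High up in the half-plane the scattering problem is a contraction.  Convolution along a horizontal
  line with the transform of \<open>a(y, \<cdot>)\<close> is bounded by a constant \<open>B\<close> that depends neither on \<open>y\<close> nor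
  on the height, and the outgoing inverse of \<open>D\<^sub>x\<^sup>2 - \<omega>\<^sup>2\<close>, with kernel
  \<open>(\<i> / 2\<omega>) exp (\<i>\<omega>\<bar>x - y\<bar>)\<close>, gains \<open>R / \<bar>\<omega>\<bar>\<close> on \<open>[-R, R]\<close>.  Hence on a line of large height the
  equation \<open>u = f(\<omega>) exp (\<i>\<omega>x) - Green (A u)\<close> has exactly one solution.

  The difficulty is that \<open>A\<close> couples all frequencies of a line, whereas a solution on the whole
  half-plane is wanted, with bounds up to the real axis.  Two facts remove it.  Since \<open>a(y, \<cdot>)\<close> has
  compact support, its transform is entire, so the source \<open>A u\<close>, computed from \<open>u\<close> on the single line
  \<open>Im \<omega> = s\<^sub>0\<close>, extends to an entire function of \<open>\<omega>\<close>; inserting it into the Green formula defines \<open>u\<close>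
  for all \<open>\<omega>\<close> in the half-plane (\<open>sol\<close>).  And an integral over a horizontal line does not change when
  the line is moved (\<open>horizontal_integral_constant\<close>), so the same source is obtained from \<open>u\<close> on every
  other line (\<open>scatter_source_any_line\<close>), that is, \<open>P u = 0\<close> throughout.

  All estimates are made in the supremum norm with weight \<open>\<bar>\<omega> + \<i>\<bar>\<close>.  Functions in \<open>H\<^sub>\<alpha>\<close> are bounded on
  horizontal lines (\<open>H_space_pointwise_bound\<close>), so this norm controls the data in \<open>(\<omega> + \<i>)\<^sup>-\<^sup>1 H\<^sub>\<alpha>\<close>; the
  convolution respects the weight because the transform of \<open>a\<close> decays; and \<open>1 / \<bar>\<omega> + \<i>\<bar>\<close> is square
  integrable on each line, so a weighted bound leads back to the norm of \<open>H\<^sub>\<beta>\<close>.  Below height \<open>s\<^sub>0\<close> the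
  bound on the source comes from its definition as an entire function, above it from the contraction
  on each line.  The incident wave costs a factor \<open>exp (\<sigma>R)\<close> on \<open>[-R, R]\<close>, the pairing of the source
  with \<open>exp (\<plusminus>\<i>\<omega>y)\<close> a second one: this is the shift from \<open>\<alpha>\<close> to \<open>\<alpha> + 2R\<close>.

  For uniqueness, the difference \<open>w\<close> of two solutions vanishes outside \<open>[-R, R]\<close>, and therefore equals
  \<open>-Green (A w)\<close> (\<open>compactly_supported_solution_eq_Green\<close>).  It is only square integrable to begin
  with, but this makes \<open>Green (A w)\<close>, hence \<open>w\<close>, bounded on the line \<open>Im \<omega> = s\<^sub>0\<close>.  The contraction
  halves every bound, so \<open>w\<close> vanishes on that line and, being holomorphic in \<open>\<omega>\<close>, everywhere.

  The hypotheses on \<open>a\<close> hold for almost every \<open>x\<close> only; \<open>coefficient_representative\<close> modifies \<open>a\<close> on a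
  null set so that they hold for every \<open>x\<close>, and the equation does not see the modification.
\<close>

section \<open>Integrals depending holomorphically on a parameter\<close>

lemma integrable_inverse_1_plus_square_real: "integrable lborel (\<lambda>x::real. 1 / (1 + x\<^sup>2))"
  using integrable_inverse_1_plus_square by (simp add: set_integrable_def inverse_eq_divide)

text \<open>
  Cauchy's inequality on discs of radius \<open>r / 2\<close> bounds the derivative, and the mean value inequality
  turns this into a bound that serves as the dominating function for difference quotients under an
  integral.
\<close>

lemma norm_difference_quotient_le:
  fixes f :: "complex \<Rightarrow> complex"
  assumes r: "r > 0" and hol: "f holomorphic_on S" and S: "open S" "cball z r \<subseteq> S"
    and bd: "\<And>w. w \<in> cball z r \<Longrightarrow> norm (f w) \<le> C" and h: "norm h < r / 2" "h \<noteq> 0"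
  shows "norm ((f (z + h) - f z) / h) \<le> 2 * C / r"
proof -
  have "norm (deriv f w) \<le> 2 * C / r" if w: "w \<in> ball z (r / 2)" for w
  proof -
    have sub: "cball w (r / 2) \<subseteq> cball z r"
      using w by (subst cball_subset_cball_iff) (auto simp: dist_commute)
    have "norm ((deriv ^^ 1) f w) \<le> fact 1 * C / (r / 2) ^ 1"
    proof (rule Cauchy_inequality)
      show "f holomorphic_on ball w (r / 2)"
        using sub S(2) ball_subset_cball holomorphic_on_subset[OF hol] by (metis subset_trans)
      show "continuous_on (cball w (r / 2)) f"
        using sub S(2) holomorphic_on_imp_continuous_on[OF hol] by (meson continuous_on_subset)
      show "\<And>x. norm (w - x) = r / 2 \<Longrightarrow> norm (f x) \<le> C"
        using sub by (intro bd) (auto simp: dist_norm)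
    qed (use r in auto)
    then show ?thesis by (simp add: field_simps)
  qed
  moreover have "(f has_field_derivative deriv f w) (at w within ball z (r / 2))" if "w \<in> ball z (r / 2)" for w
  proof -
    have "w \<in> S" using that S(2) r by (auto simp: subset_iff)
    then show ?thesis using hol S(1) by (meson has_field_derivative_at_within holomorphic_derivI)
  qed
  ultimately have "norm (f (z + h) - f z) \<le> 2 * C / r * norm (z + h - z)"
    using h r by (intro field_differentiable_bound[of "ball z (r / 2)"]) (auto simp: dist_norm)
  then show ?thesis using h by (simp add: norm_divide divide_le_eq)
qed

lemma holomorphic_on_integral:
  fixes F :: "complex \<Rightarrow> 'a \<Rightarrow> complex"
  assumes S: "open S"
    and meas: "\<And>z. z \<in> S \<Longrightarrow> F z \<in> borel_measurable M"
    and hol: "\<And>t. t \<in> space M \<Longrightarrow> (\<lambda>z. F z t) holomorphic_on S"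
    and dom: "\<And>z. z \<in> S \<Longrightarrow> \<exists>r>0. \<exists>g. cball z r \<subseteq> S \<and> integrable M g \<and>
                 (\<forall>w\<in>cball z r. \<forall>t\<in>space M. norm (F w t) \<le> g t)"
  shows "(\<lambda>z. \<integral>t. F z t \<partial>M) holomorphic_on S"
proof -
  have int: "integrable M (F z)" if z: "z \<in> S" for z
  proof -
    obtain r g where "r > 0" "integrable M g" "\<forall>w\<in>cball z r. \<forall>t\<in>space M. norm (F w t) \<le> g t"
      using dom[OF z] by blast
    then show ?thesis using meas[OF z]
      by (intro Bochner_Integration.integrable_bound[of M g "F z"]) (auto intro!: AE_I2 order_trans[OF _ abs_ge_self])
  qed
  have "\<exists>D. ((\<lambda>z. \<integral>t. F z t \<partial>M) has_field_derivative D) (at z)" if z: "z \<in> S" for z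
  proof -
    obtain r g where r: "r > 0" and sub: "cball z r \<subseteq> S" and g: "integrable M g"
      and bd: "\<forall>w\<in>cball z r. \<forall>t\<in>space M. norm (F w t) \<le> g t"
      using dom[OF z] by blast
    define D where "D = (\<integral>t. deriv (\<lambda>z. F z t) z \<partial>M)"
    have der: "((\<lambda>w. F w t) has_field_derivative deriv (\<lambda>z. F z t) z) (at z)" if "t \<in> space M" for t
      using hol[OF that] S z by (meson holomorphic_derivI)
    have quot: "(\<lambda>n. (F (z + X n) t - F z t) / X n) \<longlonglongrightarrow> deriv (\<lambda>z. F z t) z"
      if "\<And>n. X n \<noteq> 0" "X \<longlonglongrightarrow> 0" "t \<in> space M" for X t
      using der[OF that(3)] that(1,2) unfolding DERIV_def LIMSEQ_SEQ_conv[symmetric] by blast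
    have seq: "(\<lambda>n. (\<integral>t. (F (z + X n) t - F z t) / X n \<partial>M)) \<longlonglongrightarrow> D"
      if X: "\<And>n. X n \<noteq> 0" "X \<longlonglongrightarrow> 0" "\<And>n. norm (X n) < r / 2" for X
    proof -
      have inS: "z + X n \<in> S" for n
        using X(3)[of n] r sub by (intro subsetD[OF sub]) (auto simp: dist_norm)
      have meas_n: "(\<lambda>t. (F (z + X n) t - F z t) / X n) \<in> borel_measurable M" for n
        using meas[OF inS[of n]] meas[OF z] by measurable
      show ?thesis unfolding D_def
      proof (rule integral_dominated_convergence[where w = "\<lambda>t. 2 * g t / r"])
        show "(\<lambda>t. deriv (\<lambda>z. F z t) z) \<in> borel_measurable M"
          by (rule borel_measurable_LIMSEQ_metric[OF meas_n]) (rule quot[OF X(1,2)])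
        show "integrable M (\<lambda>t. 2 * g t / r)" using g by simp
        show "AE t in M. (\<lambda>n. (F (z + X n) t - F z t) / X n) \<longlonglongrightarrow> deriv (\<lambda>z. F z t) z"
          by (rule AE_I2) (rule quot[OF X(1,2)])
        show "AE t in M. norm ((F (z + X n) t - F z t) / X n) \<le> 2 * g t / r" for n
        proof (rule AE_I2)
          fix t assume t: "t \<in> space M"
          show "norm ((F (z + X n) t - F z t) / X n) \<le> 2 * g t / r"
            using norm_difference_quotient_le[OF r hol[OF t] S sub, of "g t" "X n"] bd t X(1,3) by blast
        qed
      qed (rule meas_n)
    qed
    have "(\<lambda>h. ((\<integral>t. F (z + h) t \<partial>M) - (\<integral>t. F z t \<partial>M)) / h) \<midarrow>0\<rightarrow> D"
      unfolding LIMSEQ_SEQ_conv[symmetric]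
    proof (intro allI impI, elim conjE)
      fix X :: "nat \<Rightarrow> complex"
      assume X0: "\<forall>n. X n \<noteq> 0" and X: "X \<longlonglongrightarrow> 0"
      have "\<forall>\<^sub>F n in sequentially. norm (X n) < r / 2"
        using tendstoD[OF X, of "r / 2"] r by (simp add: dist_norm)
      then obtain N where N: "\<And>n. n \<ge> N \<Longrightarrow> norm (X n) < r / 2"
        unfolding eventually_sequentially by blast
      have lim: "(\<lambda>n. (\<integral>t. (F (z + X (n + N)) t - F z t) / X (n + N) \<partial>M)) \<longlonglongrightarrow> D"
        using X0 N LIMSEQ_ignore_initial_segment[OF X, of N] by (intro seq) auto
      have eq: "(\<integral>t. (F (z + X (n + N)) t - F z t) / X (n + N) \<partial>M)
          = ((\<integral>t. F (z + X (n + N)) t \<partial>M) - (\<integral>t. F z t \<partial>M)) / X (n + N)" for n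
      proof -
        have "z + X (n + N) \<in> S"
          using N[of "n + N"] r by (intro subsetD[OF sub]) (auto simp: dist_norm)
        then show ?thesis using int z by (simp add: Bochner_Integration.integral_diff)
      qed
      show "(\<lambda>n. ((\<integral>t. F (z + X n) t \<partial>M) - (\<integral>t. F z t \<partial>M)) / X n) \<longlonglongrightarrow> D"
        using lim unfolding eq by (rule LIMSEQ_offset)
    qed
    then show ?thesis unfolding DERIV_def by blast
  qed
  then show ?thesis
    unfolding holomorphic_on_def field_differentiable_def by (meson has_field_derivative_at_within)
qed

lemma open_Cplus: "open Cplus"
  unfolding Cplus_def by (simp add: open_halfspace_Im_gt)

lemma convex_Cplus: "convex Cplus"
  unfolding Cplus_def by (simp add: convex_halfspace_Im_gt)

text \<open>
  Peetre's inequality: translation changes the weight \<open>1 + t\<^sup>2\<close> by at most the factor \<open>2(1 + s\<^sup>2)\<close>.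
\<close>

lemma one_plus_square_shift_le:
  fixes s t :: real
  shows "1 + t\<^sup>2 \<le> 2 * (1 + s\<^sup>2) * (1 + (s + t)\<^sup>2)"
proof -
  have "t\<^sup>2 \<le> 2 * (s + t)\<^sup>2 + 2 * s\<^sup>2"
    using sum_squares_bound[of "s + t" "-s"] by (simp add: power2_eq_square algebra_simps)
  moreover have "0 \<le> s\<^sup>2 * (s + t)\<^sup>2" by simp
  moreover have "2 * (1 + s\<^sup>2) * (1 + (s + t)\<^sup>2) = 2 + 2 * s\<^sup>2 + 2 * (s + t)\<^sup>2 + 2 * (s\<^sup>2 * (s + t)\<^sup>2)"
    by (simp add: algebra_simps)
  ultimately show ?thesis using zero_le_power2[of s] zero_le_power2[of "s + t"] by linarith
qed

lemma inverse_one_plus_square_shift_le: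
  fixes s t :: real
  shows "1 / (1 + (s + t)\<^sup>2) \<le> 2 * (1 + s\<^sup>2) / (1 + t\<^sup>2)"
proof -
  have "0 < 1 + t\<^sup>2" "0 < 1 + (s + t)\<^sup>2" by (simp_all add: add_pos_nonneg)
  then show ?thesis
    using one_plus_square_shift_le[of t s] by (simp add: divide_simps)
qed

text \<open>
  The integral over the line through \<open>w\<close> is a holomorphic function of \<open>w\<close>, and it is invariant under
  real translations of \<open>w\<close>.  Its complex derivative is therefore zero.
\<close>

lemma horizontal_integral_constant:
  assumes hol: "H holomorphic_on Cplus"
    and bd: "\<And>\<sigma> \<tau>. 0 < \<sigma> \<Longrightarrow> \<exists>C. \<forall>z. \<sigma> \<le> Im z \<and> Im z \<le> \<tau> \<longrightarrow> norm (H z) \<le> C / (1 + (Re z)\<^sup>2)"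
    and \<sigma>: "0 < \<sigma>" and \<tau>: "0 < \<tau>"
  shows "(\<integral>l. H (Complex l \<sigma>) \<partial>lborel) = (\<integral>l. H (Complex l \<tau>) \<partial>lborel)"
proof -
  define J where "J w = (\<integral>l. H (w + of_real l) \<partial>lborel)" for w
  have J: "J holomorphic_on Cplus"
    unfolding J_def
  proof (rule holomorphic_on_integral[OF open_Cplus])
    fix z assume z: "z \<in> Cplus"
    have "continuous_on UNIV (\<lambda>l::real. H (z + of_real l))"
      using z by (intro continuous_on_compose2[OF holomorphic_on_imp_continuous_on[OF hol]] continuous_intros)
                 (auto simp: Cplus_def)
    then show "(\<lambda>l. H (z + of_real l)) \<in> borel_measurable lborel"
      using borel_measurable_continuous_onI by auto
    define r where "r = Im z / 2"
    have r: "r > 0" "r < Im z" using z by (auto simp: r_def Cplus_def)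
    obtain C where C: "\<And>w. Im z - r \<le> Im w \<Longrightarrow> Im w \<le> Im z + r \<Longrightarrow> norm (H w) \<le> C / (1 + (Re w)\<^sup>2)"
      using bd[of "Im z - r" "Im z + r"] r by auto
    have im: "Im z - r \<le> Im w \<and> Im w \<le> Im z + r" if "w \<in> cball z r" for w
      using that abs_Im_le_cmod[of "z - w"] by (auto simp: dist_norm)
    have re: "\<bar>Re w\<bar> \<le> \<bar>Re z\<bar> + r" if "w \<in> cball z r" for w
      using that abs_Re_le_cmod[of "z - w"] by (auto simp: dist_norm)
    have "0 \<le> C / (1 + (Re z)\<^sup>2)" using order_trans[OF norm_ge_zero C[of z]] r by simp
    moreover have "0 < 1 + (Re z)\<^sup>2" by (simp add: add_pos_nonneg)
    ultimately have C0: "C \<ge> 0" by (simp add: zero_le_divide_iff)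
    have "norm (H (w + of_real l)) \<le> C * (2 * (1 + (\<bar>Re z\<bar> + r)\<^sup>2)) * (1 / (1 + l\<^sup>2))"
      if w: "w \<in> cball z r" for w l
    proof -
      have "norm (H (w + of_real l)) \<le> C * (1 / (1 + (Re w + l)\<^sup>2))"
        using C[of "w + of_real l"] im[OF w] by simp
      also have "\<dots> \<le> C * (2 * (1 + (Re w)\<^sup>2) / (1 + l\<^sup>2))"
        using C0 inverse_one_plus_square_shift_le by (intro mult_left_mono) auto
      also have "\<dots> \<le> C * (2 * (1 + (\<bar>Re z\<bar> + r)\<^sup>2) / (1 + l\<^sup>2))"
        using C0 power_mono[OF re[OF w], of 2] r by (intro mult_left_mono divide_right_mono add_left_mono) auto
      finally show ?thesis by simp
    qed
    moreover have "cball z r \<subseteq> Cplus" using im r by (fastforce simp: Cplus_def)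
    moreover have "integrable lborel (\<lambda>l. C * (2 * (1 + (\<bar>Re z\<bar> + r)\<^sup>2)) * (1 / (1 + l\<^sup>2)))"
      using integrable_inverse_1_plus_square_real by (rule integrable_mult_right)
    ultimately show "\<exists>r>0. \<exists>g. cball z r \<subseteq> Cplus \<and> integrable lborel g \<and>
        (\<forall>w\<in>cball z r. \<forall>t\<in>space lborel. norm (H (w + of_real t)) \<le> g t)"
      using r by blast
  next
    fix l :: real
    show "(\<lambda>w. H (w + of_real l)) holomorphic_on Cplus"
      by (rule holomorphic_on_compose_gen[OF _ hol, of "\<lambda>w. w + of_real l", unfolded o_def])
         (auto intro!: holomorphic_intros simp: Cplus_def)
  qed
  have shift: "J (w + of_real s) = J w" for w s
  proof -
    have "J w = (\<integral>l. H (w + of_real (s + 1 * l)) \<partial>lborel)"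
      unfolding J_def by (subst lborel_integral_real_affine[of 1 _ s]) auto
    also have "\<dots> = J (w + of_real s)"
      unfolding J_def by (simp only: of_real_add add.assoc mult_1)
    finally show ?thesis by (rule sym)
  qed
  have "(J has_field_derivative 0) (at w)" if w: "w \<in> Cplus" for w
  proof -
    obtain D where D: "(J has_field_derivative D) (at w)"
      using J w open_Cplus by (meson holomorphic_derivI)
    have "(\<lambda>n. (J (w + of_real (inverse (Suc n))) - J w) / of_real (inverse (Suc n))) \<longlonglongrightarrow> D"
    proof -
      have "(\<lambda>n. of_real (inverse (real (Suc n))) :: complex) \<longlonglongrightarrow> 0"
        using tendsto_of_real[OF LIMSEQ_inverse_real_of_nat, where 'a = complex] by simp
      then show ?thesis
        using D unfolding DERIV_def LIMSEQ_SEQ_conv[symmetric] by (auto simp del: of_nat_Suc)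
    qed
    \<comment> \<open>The derivative is computed along real increments, where the difference quotients vanish.\<close>
    then have "(\<lambda>n::nat. 0) \<longlonglongrightarrow> D" unfolding shift by simp
    then have "D = 0" using LIMSEQ_const_iff by metis
    then show ?thesis using D by simp
  qed
  then obtain c where "\<And>w. w \<in> Cplus \<Longrightarrow> J w = c"
    using has_field_derivative_zero_constant[OF convex_Cplus] by (metis has_field_derivative_at_within)
  moreover have "(\<integral>l. H (Complex l s) \<partial>lborel) = J (Complex 0 s)" for s
    unfolding J_def by (intro Bochner_Integration.integral_cong refl arg_cong[of _ _ H]) (simp add: complex_eq_iff)
  ultimately show ?thesis using \<sigma> \<tau> by (simp add: Cplus_def)
qed

section \<open>Pointwise bounds in the spaces \<open>H\<^sub>\<alpha>\<close>\<close>

text \<open>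
  This is the Cauchy--Schwarz inequality on an interval of length one, in the form
  \<open>2\<bar>g\<bar> \<le> \<epsilon> + \<bar>g\<bar>\<^sup>2 / \<epsilon>\<close> with \<open>\<epsilon>\<close> tending to \<open>L\<close>; the case \<open>L = 0\<close> is included in this way.
\<close>

lemma segment_integral_le_line_norm:
  assumes cont: "continuous_on UNIV (\<lambda>l. g (Complex l \<sigma>))" and L: "L \<ge> 0"
    and line: "(\<integral>\<^sup>+l. ennreal ((cmod (g (Complex l \<sigma>)))\<^sup>2) \<partial>lborel) \<le> ennreal (L\<^sup>2)"
  shows "integral {a..a + 1} (\<lambda>l. cmod (g (Complex l \<sigma>))) \<le> L"
proof -
  have cont': "continuous_on {a..a + 1} (\<lambda>l. g (Complex l \<sigma>))"
    using cont by (rule continuous_on_subset) simp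
  let ?I = "integral {a..a + 1} (\<lambda>l. (cmod (g (Complex l \<sigma>)))\<^sup>2)"
  have int2: "((\<lambda>l. (cmod (g (Complex l \<sigma>)))\<^sup>2) has_integral ?I) {a..a + 1}"
    using cont' by (intro integrable_integral integrable_continuous_interval continuous_intros)
  have "ennreal ?I = (\<integral>\<^sup>+l\<in>{a..a + 1}. ennreal ((cmod (g (Complex l \<sigma>)))\<^sup>2) \<partial>lborel)"
    using int2 cont' by (intro nn_integral_has_integral_lebesgue'[symmetric])
      (auto intro!: borel_measurable_continuous_on_indicator continuous_intros cont')
  also have "\<dots> \<le> (\<integral>\<^sup>+l. ennreal ((cmod (g (Complex l \<sigma>)))\<^sup>2) \<partial>lborel)"
    by (intro nn_integral_mono) (auto simp: indicator_def)
  finally have I: "?I \<le> L\<^sup>2" using line by (meson order_trans ennreal_le_iff zero_le_power2)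
  have "integral {a..a + 1} (\<lambda>l. cmod (g (Complex l \<sigma>))) \<le> \<epsilon>" if \<epsilon>: "\<epsilon> > L" for \<epsilon>
  proof -
    have \<epsilon>0: "\<epsilon> > 0" using \<epsilon> L by simp
    have "integral {a..a + 1} (\<lambda>l. cmod (g (Complex l \<sigma>)))
        \<le> integral {a..a + 1} (\<lambda>l. \<epsilon> / 2 + (cmod (g (Complex l \<sigma>)))\<^sup>2 / (2 * \<epsilon>))"
    proof (rule integral_le)
      show "cmod (g (Complex x \<sigma>)) \<le> \<epsilon> / 2 + (cmod (g (Complex x \<sigma>)))\<^sup>2 / (2 * \<epsilon>)" for x
        using sum_squares_bound[of \<epsilon> "cmod (g (Complex x \<sigma>))"] \<epsilon>0
        by (simp add: field_simps power2_eq_square)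
    qed (use cont' in \<open>auto intro!: integrable_continuous_interval continuous_intros simp: \<epsilon>0[THEN less_imp_neq, symmetric]\<close>)
    also have "\<dots> = \<epsilon> / 2 + ?I / (2 * \<epsilon>)"
    proof -
      have "((\<lambda>l. \<epsilon> / 2 + (cmod (g (Complex l \<sigma>)))\<^sup>2 / (2 * \<epsilon>)) has_integral (\<epsilon> / 2 + ?I / (2 * \<epsilon>))) {a..a + 1}"
        using has_integral_add[OF has_integral_const_real[of "\<epsilon> / 2" a "a + 1"] has_integral_divide[OF int2, of "2 * \<epsilon>"]] by simp
      then show ?thesis by (rule integral_unique)
    qed
    also have "\<dots> \<le> \<epsilon> / 2 + \<epsilon>\<^sup>2 / (2 * \<epsilon>)"
      using order_trans[OF I power_mono[of L \<epsilon> 2]] \<epsilon> L by (intro add_left_mono divide_right_mono) auto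
    also have "\<dots> = \<epsilon>" using \<epsilon>0 by (simp add: field_simps power2_eq_square)
    finally show ?thesis .
  qed
  then show ?thesis by (rule dense_ge)
qed

lemma H_norm_line_le:
  assumes g: "g \<in> H_space \<alpha>" and \<sigma>: "\<sigma> > 0"
  shows "(\<integral>\<^sup>+l. ennreal ((cmod (g (Complex l \<sigma>)))\<^sup>2) \<partial>lborel) \<le> ennreal ((exp (\<sigma> * \<alpha>) * H_norm \<alpha> g)\<^sup>2)"
proof -
  have fin: "H_normsq \<alpha> g < top" using g by (simp add: H_space_def)
  let ?X = "\<integral>\<^sup>+l. ennreal ((cmod (g (Complex l \<sigma>)))\<^sup>2) \<partial>lborel"
  have "ennreal (exp (- 2 * \<sigma> * \<alpha>)) * ?X \<le> H_normsq \<alpha> g"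
    unfolding H_normsq_def using \<sigma> by (intro SUP_upper) auto
  also have "\<dots> = ennreal ((H_norm \<alpha> g)\<^sup>2)"
    using fin by (simp add: H_norm_def)
  finally have "ennreal (exp (2 * \<sigma> * \<alpha>)) * (ennreal (exp (- 2 * \<sigma> * \<alpha>)) * ?X)
      \<le> ennreal (exp (2 * \<sigma> * \<alpha>)) * ennreal ((H_norm \<alpha> g)\<^sup>2)"
    by (rule mult_left_mono) simp
  moreover have "ennreal (exp (2 * \<sigma> * \<alpha>)) * (ennreal (exp (- 2 * \<sigma> * \<alpha>)) * ?X) = ?X"
    by (simp add: mult.assoc[symmetric] ennreal_mult[symmetric] exp_add[symmetric])
  moreover have "exp (2 * \<sigma> * \<alpha>) * (H_norm \<alpha> g)\<^sup>2 = (exp (\<sigma> * \<alpha>) * H_norm \<alpha> g)\<^sup>2"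
    by (simp add: power_mult_distrib exp_double[symmetric] mult.assoc)
  ultimately show ?thesis by (metis ennreal_mult exp_ge_zero zero_le_power2)
qed

lemma H_norm_nonneg: "H_norm \<alpha> g \<ge> 0"
  by (simp add: H_norm_def)

text \<open>
  Let \<open>A\<close> be a primitive of \<open>g\<close>.  For \<open>0 \<le> h \<le> 1\<close> the function \<open>A(w + h) - A(w)\<close>, an integral of \<open>g\<close>
  over a horizontal segment, is bounded by the norm of \<open>g\<close>; Cauchy's inequality then bounds its
  derivative \<open>g(w + h) - g(w)\<close>.  So the difference between \<open>g(z)\<close> and the average of \<open>g\<close> over a
  horizontal segment is bounded, and the average is as well.  The term \<open>r\<bar>\<alpha>\<bar>\<close> in the exponent accounts for the variation of
  \<open>exp (\<sigma>\<alpha>)\<close> over the disc used in Cauchy's inequality.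
\<close>

lemma H_space_pointwise_bound:
  assumes g: "g \<in> H_space \<alpha>" and r: "0 < r" "r < Im z"
  shows "cmod (g z) \<le> (1 + 1 / r) * exp (Im z * \<alpha> + r * \<bar>\<alpha>\<bar>) * H_norm \<alpha> g"
proof -
  define N where "N = exp (Im z * \<alpha> + r * \<bar>\<alpha>\<bar>) * H_norm \<alpha> g"
  have hol: "g holomorphic_on Cplus" using g by (simp add: H_space_def)
  obtain A where A: "\<And>w. w \<in> Cplus \<Longrightarrow> (A has_field_derivative g w) (at w)"
    using holomorphic_convex_primitive'[OF convex_Cplus open_Cplus hol] open_Cplus
    by (metis at_within_open)
  have cont: "continuous_on UNIV (\<lambda>l. g (Complex l \<sigma>))" if "\<sigma> > 0" for \<sigma>
    using that by (intro continuous_on_compose2[OF holomorphic_on_imp_continuous_on[OF hol]])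
      (auto simp: Cplus_def Complex_eq intro!: continuous_intros)
  have seg: "cmod (A (w + of_real h) - A w) \<le> N"
    if w: "\<bar>Im w - Im z\<bar> \<le> r" and h: "0 \<le> h" "h \<le> 1" for w h
  proof -
    define \<sigma> where "\<sigma> = Im w"
    have \<sigma>: "\<sigma> > 0" using w r by (simp add: \<sigma>_def)
    have cplus: "Complex l \<sigma> \<in> Cplus" for l using \<sigma> by (simp add: Cplus_def)
    have "((\<lambda>l. A (Complex l \<sigma>)) has_vector_derivative g (Complex l \<sigma>)) (at l within T)" for l T
    proof -
      have "((\<lambda>l. Complex l \<sigma>) has_vector_derivative 1) (at l within T)"
        by (auto simp: Complex_eq intro!: derivative_eq_intros)
      from field_vector_diff_chain_within[OF this has_field_derivative_at_within[OF A[OF cplus]]]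
      show ?thesis by (simp add: o_def)
    qed
    then have "((\<lambda>l. g (Complex l \<sigma>)) has_integral (A (Complex (Re w + h) \<sigma>) - A (Complex (Re w) \<sigma>))) {Re w..Re w + h}"
      using h by (intro fundamental_theorem_of_calculus) auto
    moreover have "Complex (Re w + h) \<sigma> = w + of_real h" "Complex (Re w) \<sigma> = w"
      by (simp_all add: \<sigma>_def complex_eq_iff)
    ultimately have int: "((\<lambda>l. g (Complex l \<sigma>)) has_integral (A (w + of_real h) - A w)) {Re w..Re w + h}"
      by simp
    have "cmod (A (w + of_real h) - A w) = cmod (integral {Re w..Re w + h} (\<lambda>l. g (Complex l \<sigma>)))"
      using int by (simp add: integral_unique)
    also have "\<dots> \<le> integral {Re w..Re w + h} (\<lambda>l. cmod (g (Complex l \<sigma>)))"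
      using continuous_on_subset[OF cont[OF \<sigma>]]
      by (intro integral_norm_bound_integral integrable_continuous_interval continuous_intros) auto
    also have "\<dots> \<le> integral {Re w..Re w + 1} (\<lambda>l. cmod (g (Complex l \<sigma>)))"
      using h continuous_on_subset[OF cont[OF \<sigma>]]
      by (intro integral_subset_le integrable_continuous_interval continuous_intros) auto
    also have "\<dots> \<le> exp (\<sigma> * \<alpha>) * H_norm \<alpha> g"
      using H_norm_line_le[OF g \<sigma>]
      by (intro segment_integral_le_line_norm cont \<sigma>) (auto simp: H_norm_nonneg)
    also have "\<sigma> * \<alpha> \<le> Im z * \<alpha> + r * \<bar>\<alpha>\<bar>"
    proof -
      have "(\<sigma> - Im z) * \<alpha> \<le> \<bar>\<sigma> - Im z\<bar> * \<bar>\<alpha>\<bar>" by (metis abs_ge_self abs_mult)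
      also have "\<dots> \<le> r * \<bar>\<alpha>\<bar>" using w by (intro mult_right_mono) (auto simp: \<sigma>_def)
      finally show ?thesis by (simp add: algebra_simps)
    qed
    finally show ?thesis by (simp add: N_def H_norm_nonneg mult_right_mono)
  qed
  have zC: "z \<in> Cplus" using r by (simp add: Cplus_def)
  have shiftC: "w + of_real h \<in> Cplus" if "w \<in> Cplus" for w h using that by (simp add: Cplus_def)
  have diff: "cmod (g (z + of_real h) - g z) \<le> N / r" if h: "0 \<le> h" "h \<le> 1" for h
  proof -
    have sub: "cball z r \<subseteq> Cplus"
    proof
      fix w assume "w \<in> cball z r"
      then have "\<bar>Im (z - w)\<bar> \<le> r" using abs_Im_le_cmod[of "z - w"] by (simp add: dist_norm)
      then show "w \<in> Cplus" using r by (simp add: Cplus_def)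
    qed
    have d: "((\<lambda>w. A (w + of_real h) - A w) has_field_derivative g (w + of_real h) - g w) (at w)" if "w \<in> Cplus" for w
      using A[OF that] A[OF shiftC[OF that]]
      by (intro DERIV_diff) (simp_all add: DERIV_shift)
    have "cmod ((deriv ^^ 1) (\<lambda>w. A (w + of_real h) - A w) z) \<le> fact 1 * N / r ^ 1"
    proof (rule Cauchy_inequality)
      show "(\<lambda>w. A (w + of_real h) - A w) holomorphic_on ball z r"
        using d sub ball_subset_cball[of z r] unfolding holomorphic_on_def field_differentiable_def
        by (meson has_field_derivative_at_within subsetD)
      show "continuous_on (cball z r) (\<lambda>w. A (w + of_real h) - A w)"
        using d sub by (meson DERIV_isCont continuous_at_imp_continuous_on subsetD)
      show "cmod (A (w + of_real h) - A w) \<le> N" if "cmod (z - w) = r" for w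
        using that h abs_Im_le_cmod[of "z - w"] by (intro seg) auto
    qed (use r in auto)
    then show ?thesis using DERIV_imp_deriv[OF d[OF zC]] by simp
  qed
  have int1: "((\<lambda>h. g (z + of_real h)) has_integral (A (z + of_real 1) - A (z + of_real 0))) {0..1}"
  proof (rule fundamental_theorem_of_calculus)
    fix h :: real
    have "((\<lambda>h. z + of_real h) has_vector_derivative 1) (at h within {0..1})"
      by (auto intro!: derivative_eq_intros)
    from field_vector_diff_chain_within[OF this has_field_derivative_at_within[OF A[OF shiftC[OF zC]]]]
    show "((\<lambda>h. A (z + of_real h)) has_vector_derivative g (z + of_real h)) (at h within {0..1})"
      by (simp add: o_def)
  qed simp
  have diff_int: "((\<lambda>h. g (z + of_real h) - g z) has_integral ((A (z + 1) - A z) - g z)) {0..1}"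
    using has_integral_diff[OF int1 has_integral_const_real[of "g z" 0 1]] by simp
  have "cmod ((A (z + 1) - A z) - g z) \<le> N / r * measure lborel {0..1::real}"
  proof (rule has_integral_bound_real[where S = "{}", OF _ _ diff_int])
    show "0 \<le> N / r" using r by (simp add: N_def H_norm_nonneg)
  qed (use diff in auto)
  then have "cmod ((A (z + 1) - A z) - g z) \<le> N / r" by simp
  moreover have "cmod (A (z + 1) - A z) \<le> N" using seg[of z 1] r by simp
  moreover have "cmod (g z) \<le> cmod (A (z + 1) - A z) + cmod ((A (z + 1) - A z) - g z)"
    using norm_triangle_ineq4[of "A (z + 1) - A z" "(A (z + 1) - A z) - g z"] by simp
  ultimately show ?thesis by (simp add: N_def algebra_simps)
qed

section \<open>Smooth functions and test functions\<close>

lemma vderiv_eqI: "(\<And>t. (f has_vector_derivative f' t) (at t)) \<Longrightarrow> vderiv f = f'"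
  by (auto simp: vderiv_def fun_eq_iff vector_derivative_at)

text \<open>
  A set of functions that is closed under differentiation consists of smooth functions; each closure
  property of \<open>smooth\<close> below comes from a suitable such set.
\<close>

lemma smooth_coinduct:
  assumes "f \<in> F" and step: "\<And>g. g \<in> F \<Longrightarrow> \<exists>g'\<in>F. \<forall>t. (g has_vector_derivative g' t) (at t)"
  shows "smooth f"
proof -
  have step': "vderiv g \<in> F \<and> (\<forall>t. g differentiable (at t))" if "g \<in> F" for g
    using step[OF that] vderiv_eqI by (metis differentiableI_vector)
  then have "(vderiv ^^ k) f \<in> F" for k
    by (induction k) (auto simp: assms(1))
  then show ?thesis using step' unfolding smooth_def by blast
qed

lemma smooth_has_vderiv: "smooth f \<Longrightarrow> (f has_vector_derivative vderiv f t) (at t)"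
  unfolding smooth_def vderiv_def by (metis funpow_0 vector_derivative_works)

lemma smooth_vderiv: "smooth f \<Longrightarrow> smooth (vderiv f)"
  unfolding smooth_def by (metis funpow_Suc_right o_apply)

lemma smooth_continuous: "smooth f \<Longrightarrow> continuous_on T f"
  using smooth_has_vderiv by (meson continuous_at_imp_continuous_on has_vector_derivative_continuous)

lemma smoothI_antiderivative:
  assumes f: "smooth f" and F: "\<And>t. (F has_vector_derivative f t) (at t)"
  shows "smooth F"
proof (rule smooth_coinduct[of F "insert F {g. smooth g}"])
  fix g assume "g \<in> insert F {g. smooth g}"
  then show "\<exists>g'\<in>insert F {g. smooth g}. \<forall>t. (g has_vector_derivative g' t) (at t)"
    using f F smooth_has_vderiv smooth_vderiv by blast
qed simp

text \<open>
  The algebra generated by the smooth functions.  By the sum and product rules it is closed under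
  differentiation, which gives closure of \<open>smooth\<close> under sums and products at once.
\<close>

inductive_set smooth_hull :: "(real \<Rightarrow> complex) set" where
  base: "smooth f \<Longrightarrow> f \<in> smooth_hull"
| add: "f \<in> smooth_hull \<Longrightarrow> g \<in> smooth_hull \<Longrightarrow> (\<lambda>x. f x + g x) \<in> smooth_hull"
| mult: "f \<in> smooth_hull \<Longrightarrow> g \<in> smooth_hull \<Longrightarrow> (\<lambda>x. f x * g x) \<in> smooth_hull"

lemma smooth_hull_smooth: "f \<in> smooth_hull \<Longrightarrow> smooth f"
proof (erule smooth_coinduct)
  fix g assume "g \<in> smooth_hull"
  then show "\<exists>g'\<in>smooth_hull. \<forall>t. (g has_vector_derivative g' t) (at t)"
  proof induction
    case (base f)
    then show ?case using smooth_has_vderiv smooth_vderiv smooth_hull.base by blast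
  next
    case (add f g)
    from add.IH obtain f' g' where *: "f' \<in> smooth_hull" "g' \<in> smooth_hull"
      "\<forall>t. (f has_vector_derivative f' t) (at t)" "\<forall>t. (g has_vector_derivative g' t) (at t)" by blast
    have "\<forall>t. ((\<lambda>x. f x + g x) has_vector_derivative f' t + g' t) (at t)"
      using *(3,4) by (simp add: has_vector_derivative_add)
    with smooth_hull.add[OF *(1,2)] show ?case by (intro bexI[of _ "\<lambda>t. f' t + g' t"])
  next
    case (mult f g)
    from mult.IH obtain f' g' where *: "f' \<in> smooth_hull" "g' \<in> smooth_hull"
      "\<forall>t. (f has_vector_derivative f' t) (at t)" "\<forall>t. (g has_vector_derivative g' t) (at t)" by blast
    have "\<forall>t. ((\<lambda>x. f x * g x) has_vector_derivative f t * g' t + f' t * g t) (at t)"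
      using *(3,4) by (simp add: has_vector_derivative_mult)
    with smooth_hull.add[OF smooth_hull.mult[OF mult.hyps(1) *(2)] smooth_hull.mult[OF *(1) mult.hyps(2)]]
    show ?case by (intro bexI[of _ "\<lambda>t. f t * g' t + f' t * g t"])
  qed
qed

lemma smooth_add: "smooth f \<Longrightarrow> smooth g \<Longrightarrow> smooth (\<lambda>x. f x + g x)"
  using smooth_hull_smooth[OF smooth_hull.add[OF smooth_hull.base smooth_hull.base]] .

lemma smooth_mult: "smooth f \<Longrightarrow> smooth g \<Longrightarrow> smooth (\<lambda>x. f x * g x)"
  using smooth_hull_smooth[OF smooth_hull.mult[OF smooth_hull.base smooth_hull.base]] .

lemma smooth_const: "smooth (\<lambda>x. c)"
proof (rule smooth_coinduct[of _ "range (\<lambda>c x. c)"])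
  fix g :: "real \<Rightarrow> complex" assume "g \<in> range (\<lambda>c x. c)"
  then show "\<exists>g'\<in>range (\<lambda>c x. c). \<forall>t. (g has_vector_derivative g' t) (at t)"
    by (intro bexI[of _ "\<lambda>x. 0"]) auto
qed simp

lemma smooth_diff: "smooth f \<Longrightarrow> smooth g \<Longrightarrow> smooth (\<lambda>x. f x - g x)"
  using smooth_add[of f "\<lambda>x. (- 1) * g x"] smooth_mult[OF smooth_const[of "- 1"], of g] by simp

lemma has_vector_derivative_exp_of_real:
  fixes c :: complex
  shows "((\<lambda>x. exp (c * of_real x)) has_vector_derivative c * exp (c * of_real x)) (at x within S)"
proof -
  have "((\<lambda>z. exp (c * z)) has_field_derivative c * exp (c * of_real x)) (at (of_real x))"
    by (auto intro!: derivative_eq_intros)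
  from has_vector_derivative_real_field[OF this] show ?thesis
    by (meson has_vector_derivative_at_within)
qed

lemma smooth_exp:
  fixes c :: complex
  shows "smooth (\<lambda>x. exp (c * of_real x))"
proof (rule smooth_coinduct[of _ "range (\<lambda>d x. d * exp (c * of_real x))"])
  show "(\<lambda>x. exp (c * of_real x)) \<in> range (\<lambda>d (x::real). d * exp (c * of_real x))"
    by (rule image_eqI[of _ _ 1]) auto
  fix g :: "real \<Rightarrow> complex" assume "g \<in> range (\<lambda>d x. d * exp (c * of_real x))"
  then obtain d where "g = (\<lambda>x. d * exp (c * of_real x))" by blast
  then show "\<exists>g'\<in>range (\<lambda>d x. d * exp (c * of_real x)). \<forall>t. (g has_vector_derivative g' t) (at t)"
    using has_vector_derivative_mult_right[OF has_vector_derivative_exp_of_real, of d c]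
    by (intro bexI[of _ "\<lambda>x. (d * c) * exp (c * of_real x)"]) (simp_all add: mult.assoc[symmetric])
qed

lemma smooth_affine:
  assumes "smooth f" shows "smooth (\<lambda>x. f (c * x + d))"
proof (rule smooth_coinduct[of _ "{(\<lambda>x. e * g (c * x + d)) |e g. smooth g}"])
  show "(\<lambda>x. f (c * x + d)) \<in> {(\<lambda>x. e * g (c * x + d)) |e g. smooth g}"
    using assms by (intro CollectI exI[of _ 1] exI[of _ f]) auto
  fix h assume "h \<in> {(\<lambda>x. e * g (c * x + d)) |e g. smooth g}"
  then obtain e g where h: "h = (\<lambda>x. e * g (c * x + d))" and g: "smooth g" by blast
  have "((\<lambda>x. c * x + d) has_vector_derivative c) (at x)" for x
    by (auto intro!: derivative_eq_intros)
  from vector_diff_chain_at[OF this smooth_has_vderiv[OF g]]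
  have "((\<lambda>x. g (c * x + d)) has_vector_derivative c *\<^sub>R vderiv g (c * x + d)) (at x)" for x
    by (simp add: o_def)
  from has_vector_derivative_mult_right[OF this]
  have "(h has_vector_derivative (e * of_real c) * vderiv g (c * x + d)) (at x)" for x
    by (simp add: h scaleR_conv_of_real mult.assoc)
  then show "\<exists>g'\<in>{(\<lambda>x. e * g (c * x + d)) |e g. smooth g}. \<forall>t. (h has_vector_derivative g' t) (at t)"
    using smooth_vderiv[OF g]
    by (intro bexI[of _ "\<lambda>x. (e * of_real c) * vderiv g (c * x + d)"]) blast+
qed

lemma continuous_has_antiderivative:
  fixes f :: "real \<Rightarrow> complex"
  assumes cont: "continuous_on UNIV f"
  shows "\<exists>F. \<forall>t. (F has_vector_derivative f t) (at t)"
proof -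
  define F where "F x = integral {0..x} f - integral {x..0} f" for x
  have int: "f integrable_on {a..b}" for a b
    using cont by (meson continuous_on_subset integrable_continuous_interval subset_UNIV)
  have F: "F x = integral {-N..x} f - integral {-N..0} f" if "x \<in> {-N..N}" for N x
  proof (cases "0 \<le> x")
    case True
    then show ?thesis
      using Henstock_Kurzweil_Integration.integral_combine[OF _ _ int, of "-N" 0 x] that
      by (cases "x = 0") (auto simp: F_def algebra_simps)
  next
    case False
    then show ?thesis
      using Henstock_Kurzweil_Integration.integral_combine[OF _ _ int, of "-N" x 0] that
      by (auto simp: F_def algebra_simps)
  qed
  have "(F has_vector_derivative f t) (at t)" for t
  proof -
    define N where "N = \<bar>t\<bar> + 1"
    have "((\<lambda>x. integral {-N..x} f - integral {-N..0} f) has_vector_derivative f t) (at t within {-N..N})"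
    proof -
      have "t \<in> {-N..N}" by (simp add: N_def) linarith
      from has_vector_derivative_diff[OF integral_has_vector_derivative[OF continuous_on_subset[OF cont subset_UNIV] this]
          has_vector_derivative_const]
      show ?thesis by simp
    qed
    then have "((\<lambda>x. integral {-N..x} f - integral {-N..0} f) has_vector_derivative f t) (at t)"
      by (subst (asm) at_within_interior) (auto simp: N_def interior_atLeastAtMost_real)
    then show ?thesis
      by (rule has_vector_derivative_transform_within_open[of _ _ _ "{-N<..<N}"])
         (use F[of _ N] in \<open>auto simp: N_def\<close>)
  qed
  then show ?thesis by blast
qed

text \<open>
  The functions \<open>p(1/x) exp (-1/x)\<close>, extended by zero to \<open>x \<le> 0\<close>.  The polynomial \<open>p\<close> is a parameter
  because the family is closed under differentiation: \<open>p\<close> becomes \<open>X\<^sup>2 (p - p')\<close>.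
\<close>

definition flat_step :: "real poly \<Rightarrow> real \<Rightarrow> real" where
  "flat_step p x = (if x > 0 then poly p (1 / x) * exp (- (1 / x)) else 0)"

lemma power_poly_over_exp_tendsto_0: "((\<lambda>y::real. y ^ k * poly p y * exp (- y)) \<longlongrightarrow> 0) at_top"
proof (induction p arbitrary: k)
  case 0 show ?case by simp
next
  case (pCons a p)
  have "((\<lambda>y::real. a * (y ^ k / exp y) + y ^ Suc k * poly p y * exp (- y)) \<longlongrightarrow> a * 0 + 0) at_top"
    by (intro tendsto_intros tendsto_power_div_exp_0 pCons.IH)
  then show ?case by (simp add: algebra_simps exp_minus divide_inverse)
qed

lemma flat_step_has_derivative:
  "(flat_step p has_real_derivative flat_step (pCons 0 (pCons 0 (p - pderiv p))) x) (at x)"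
proof (cases x "0::real" rule: linorder_cases)
  case less
  have "(flat_step p has_real_derivative 0) (at x)"
    by (rule has_field_derivative_transform_within_open[of "\<lambda>_. 0" _ _ "{..<0}"])
       (use less in \<open>auto simp: flat_step_def\<close>)
  then show ?thesis using less by (simp add: flat_step_def)
next
  case equal
  have "((\<lambda>h. flat_step (pCons 0 p) h) \<longlongrightarrow> 0) (at 0)"
  proof (rule filterlim_split_at_real)
    show "(flat_step (pCons 0 p) \<longlongrightarrow> 0) (at_left 0)"
      by (rule tendsto_eventually) (auto simp: eventually_at_filter flat_step_def)
    have "((\<lambda>h::real. (inverse h) ^ 0 * poly (pCons 0 p) (inverse h) * exp (- inverse h)) \<longlongrightarrow> 0) (at_right 0)"
      by (rule filterlim_compose[OF power_poly_over_exp_tendsto_0 filterlim_inverse_at_top_right])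
    then show "(flat_step (pCons 0 p) \<longlongrightarrow> 0) (at_right 0)"
      by (rule Lim_transform_eventually) (auto simp: eventually_at_filter flat_step_def inverse_eq_divide)
  qed
  then have "((\<lambda>h. (flat_step p (0 + h) - flat_step p 0) / h) \<longlongrightarrow> 0) (at 0)"
    by (rule Lim_transform_eventually) (auto simp: eventually_at_filter flat_step_def)
  then show ?thesis using equal by (simp add: DERIV_def flat_step_def)
next
  case greater
  have "((\<lambda>x. poly p (1 / x) * exp (- (1 / x))) has_real_derivative
      poly p (1 / x) * (exp (- (1 / x)) * (1 / x\<^sup>2)) + poly (pderiv p) (1 / x) * (- (1 / x\<^sup>2)) * exp (- (1 / x))) (at x)"
  proof -
    have 1: "((\<lambda>x::real. 1 / x) has_real_derivative - (1 / x\<^sup>2)) (at x)"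
      using greater by (auto intro!: derivative_eq_intros simp: power2_eq_square)
    have "((\<lambda>x. poly p (1 / x)) has_real_derivative poly (pderiv p) (1 / x) * (- (1 / x\<^sup>2))) (at x)"
      by (rule DERIV_chain2[OF poly_DERIV 1])
    moreover have "((\<lambda>x. exp (- (1 / x))) has_real_derivative exp (- (1 / x)) * (1 / x\<^sup>2)) (at x)"
      using DERIV_chain2[OF DERIV_exp DERIV_minus[OF 1]] by simp
    ultimately show ?thesis
      by (rule DERIV_cong[OF DERIV_mult]) (simp add: algebra_simps)
  qed
  then have "(flat_step p has_real_derivative
      poly p (1 / x) * (exp (- (1 / x)) * (1 / x\<^sup>2)) + poly (pderiv p) (1 / x) * (- (1 / x\<^sup>2)) * exp (- (1 / x))) (at x)"
    by (rule has_field_derivative_transform_within_open[of _ _ _ "{0<..}"])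
       (use greater in \<open>auto simp: flat_step_def\<close>)
  then show ?thesis using greater
    by (simp add: flat_step_def algebra_simps power2_eq_square)
qed

lemma smooth_flat_step: "smooth (\<lambda>x. of_real (flat_step p x))"
proof (rule smooth_coinduct[of _ "range (\<lambda>p x. of_real (flat_step p x))"])
  fix g :: "real \<Rightarrow> complex" assume "g \<in> range (\<lambda>p x. of_real (flat_step p x))"
  then obtain p where "g = (\<lambda>x. of_real (flat_step p x))" by blast
  then have "(g has_vector_derivative of_real (flat_step (pCons 0 (pCons 0 (p - pderiv p))) t)) (at t)" for t
    using has_vector_derivative_of_real[OF flat_step_has_derivative] by simp
  then show "\<exists>g'\<in>range (\<lambda>p x. complex_of_real (flat_step p x)). \<forall>t. (g has_vector_derivative g' t) (at t)"
    by (intro bexI[of _ "\<lambda>x. of_real (flat_step (pCons 0 (pCons 0 (p - pderiv p))) x)"]) blast+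
qed simp

definition bump :: "real \<Rightarrow> real" where
  "bump x = flat_step 1 (1 + x) * flat_step 1 (1 - x)"

lemma flat_step_1: "flat_step 1 x = (if x > 0 then exp (- (1 / x)) else 0)"
  by (simp add: flat_step_def)

lemma smooth_bump: "smooth (\<lambda>x. of_real (bump x))"
proof -
  have "smooth (\<lambda>x. of_real (flat_step 1 (1 * x + 1)) * of_real (flat_step 1 ((- 1) * x + 1)))"
    by (intro smooth_mult smooth_affine smooth_flat_step)
  then show ?thesis by (simp add: bump_def add.commute)
qed

lemma test_functionI:
  assumes "smooth f" "\<And>t. \<bar>t\<bar> > K \<Longrightarrow> f t = 0"
  shows "test_function f"
proof -
  have "{t. f t \<noteq> 0} \<subseteq> {-K..K}" using assms(2) by (auto simp: not_less[symmetric])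
  then have "bounded {t. f t \<noteq> 0}" using bounded_closed_interval bounded_subset by blast
  then show ?thesis using assms(1) unfolding test_function_def
    by (simp add: compact_eq_bounded_closed bounded_closure)
qed

lemma test_functionE:
  assumes "test_function f"
  obtains K where "K > 0" "\<And>t. \<bar>t\<bar> \<ge> K \<Longrightarrow> f t = 0"
proof -
  have "bounded {t. f t \<noteq> 0}"
    using assms unfolding test_function_def
    by (meson bounded_subset closure_subset compact_imp_bounded)
  then obtain K where "\<And>t. f t \<noteq> 0 \<Longrightarrow> \<bar>t\<bar> \<le> K" unfolding bounded_iff by auto
  then show thesis by (intro that[of "\<bar>K\<bar> + 1"]) force+
qed

text \<open>
  With \<open>Q\<close> a primitive of a bump supported in \<open>[-1, 1]\<close>, the difference of two translates of \<open>Q\<close> is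
  constant between the supports of the translated bumps, and zero outside of both.
\<close>

lemma plateau_exists:
  assumes "L > 0"
  obtains \<psi> where "test_function \<psi>" "\<And>x. \<bar>x\<bar> \<le> L \<Longrightarrow> \<psi> x = 1"
proof -
  obtain Q where Q: "\<And>t. (Q has_vector_derivative complex_of_real (bump t)) (at t)"
    using continuous_has_antiderivative[OF smooth_continuous[OF smooth_bump]] by auto
  have smQ: "smooth Q" using smoothI_antiderivative[OF smooth_bump Q] .
  have bump0: "bump x = 0" if "\<bar>x\<bar> \<ge> 1" for x using that by (auto simp: bump_def flat_step_1)
  have const: "Q a = Q b" if "\<And>x. x \<in> {min a b..max a b} \<Longrightarrow> \<bar>x\<bar> \<ge> 1" for a b
  proof -
    have "(Q has_vector_derivative 0) (at x within {min a b..max a b})" if "x \<in> {min a b..max a b}" for x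
      using has_vector_derivative_at_within[OF Q[of x]] bump0[OF \<open>\<And>x. x \<in> {min a b..max a b} \<Longrightarrow> \<bar>x\<bar> \<ge> 1\<close>[OF that]] by simp
    then obtain c where "\<And>x. x \<in> {min a b..max a b} \<Longrightarrow> Q x = c"
      using has_vector_derivative_zero_constant[of "{min a b..max a b}" Q] by auto
    then show ?thesis by force
  qed
  have right: "Q x = Q 1" if "x \<ge> 1" for x using that by (intro const) auto
  have left: "Q x = Q (- 1)" if "x \<le> - 1" for x using that by (intro const) auto
  have ne: "Q 1 - Q (- 1) \<noteq> 0"
  proof
    assume 0: "Q 1 - Q (- 1) = 0"
    have "((\<lambda>x. of_real (bump x)) has_integral (Q 1 - Q (- 1))) {-1..1}"
      using Q by (intro fundamental_theorem_of_calculus) (auto intro: has_vector_derivative_at_within)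
    then have "((\<lambda>x. Re (of_real (bump x))) has_integral Re 0) {-1..1}"
      unfolding 0 by (rule has_integral_Re)
    then have hi: "(bump has_integral 0) (cbox (-1) 1)" by simp
    have "continuous_on (cbox (-1) 1) (\<lambda>x. Re (of_real (bump x)))"
      by (intro continuous_intros smooth_continuous[OF smooth_bump])
    then have "continuous_on (cbox (-1) 1) bump" by simp
    from has_integral_0_cbox_imp_0[OF this _ hi, of 0]
    show False by (auto simp: bump_def flat_step_1)
  qed
  define \<psi> where "\<psi> x = inverse (Q 1 - Q (- 1)) * (Q (1 * x + (L + 1)) - Q (1 * x + (- L - 1)))" for x
  have "smooth \<psi>"
    unfolding \<psi>_def by (intro smooth_mult smooth_const smooth_diff smooth_affine smQ)
  then have "test_function \<psi>"
  proof (rule test_functionI)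
    show "\<psi> t = 0" if "\<bar>t\<bar> > L + 2" for t
      using that right[of "t + (L + 1)"] right[of "t + (- L - 1)"] left[of "t + (L + 1)"] left[of "t + (- L - 1)"] assms
      by (cases "t > 0") (auto simp: \<psi>_def)
  qed
  moreover have "\<psi> x = 1" if "\<bar>x\<bar> \<le> L" for x
    using that right[of "x + (L + 1)"] left[of "x + (- L - 1)"] ne by (auto simp: \<psi>_def)
  ultimately show thesis by (rule that)
qed

text \<open>
  Variation of constants, with primitives \<open>I\<close> and \<open>J\<close> of \<open>exp (-\<i>\<omega>x) \<phi>\<close> and \<open>exp (\<i>\<omega>x) \<phi>\<close>.
\<close>

lemma Helmholtz_smooth_solution:
  assumes \<phi>: "smooth \<phi>" and \<omega>: "\<omega> \<noteq> 0"
  obtains \<Phi> where "smooth \<Phi>" "\<And>x. - vderiv (vderiv \<Phi>) x - \<omega>\<^sup>2 * \<Phi> x = \<phi> x"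
proof -
  define ep em where "ep x = exp (\<i> * \<omega> * of_real x)" and "em x = exp ((- \<i> * \<omega>) * of_real x)" for x :: real
  have sm: "smooth ep" "smooth em" unfolding ep_def em_def by (rule smooth_exp)+
  have dep: "(ep has_vector_derivative \<i> * \<omega> * ep x) (at x)" "(em has_vector_derivative (- \<i> * \<omega>) * em x) (at x)" for x
    unfolding ep_def em_def by (rule has_vector_derivative_exp_of_real)+
  have epm: "ep x * em x = 1" for x by (simp add: ep_def em_def exp_add[symmetric])
  obtain I where I: "\<And>x. (I has_vector_derivative em x * \<phi> x) (at x)"
    using continuous_has_antiderivative[OF smooth_continuous[OF smooth_mult[OF sm(2) \<phi>]]] by auto
  obtain J where J: "\<And>x. (J has_vector_derivative ep x * \<phi> x) (at x)"
    using continuous_has_antiderivative[OF smooth_continuous[OF smooth_mult[OF sm(1) \<phi>]]] by auto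
  have smI: "smooth I" "smooth J"
    using smoothI_antiderivative[OF smooth_mult I] smoothI_antiderivative[OF smooth_mult J] sm \<phi> by auto
  have dI: "((\<lambda>x. ep x * I x) has_vector_derivative \<i> * \<omega> * (ep x * I x) + \<phi> x) (at x)" for x
  proof -
    have "ep x * (em x * \<phi> x) = \<phi> x" using epm[of x] by (simp add: mult.assoc[symmetric])
    with has_vector_derivative_mult[OF dep(1) I, of x] show ?thesis
      by (simp only: add.commute mult.assoc)
  qed
  have dJ: "((\<lambda>x. em x * J x) has_vector_derivative (- \<i> * \<omega>) * (em x * J x) + \<phi> x) (at x)" for x
  proof -
    have "em x * (ep x * \<phi> x) = \<phi> x" using epm[of x] by (simp add: mult.assoc[symmetric] mult.commute[of "em x"])
    with has_vector_derivative_mult[OF dep(2) J, of x] show ?thesis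
      by (simp only: add.commute mult.assoc)
  qed
  define \<Phi> where "\<Phi> x = \<i> / (2 * \<omega>) * (ep x * I x - em x * J x)" for x
  have d1: "vderiv \<Phi> = (\<lambda>x. (- 1 / 2) * (ep x * I x + em x * J x))"
  proof (rule vderiv_eqI)
    fix x
    have "(\<Phi> has_vector_derivative \<i> / (2 * \<omega>) * ((\<i> * \<omega> * (ep x * I x) + \<phi> x) - ((- \<i> * \<omega>) * (em x * J x) + \<phi> x))) (at x)"
      unfolding \<Phi>_def by (intro has_vector_derivative_mult_right has_vector_derivative_diff dI dJ)
    moreover have "\<i> / (2 * \<omega>) * ((\<i> * \<omega> * (ep x * I x) + \<phi> x) - ((- \<i> * \<omega>) * (em x * J x) + \<phi> x))
        = (- 1 / 2) * (ep x * I x + em x * J x)"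
      using \<omega> by (simp add: field_simps)
    ultimately show "(\<Phi> has_vector_derivative (- 1 / 2) * (ep x * I x + em x * J x)) (at x)" by simp
  qed
  have d2: "vderiv (vderiv \<Phi>) = (\<lambda>x. (- 1 / 2) * (\<i> * \<omega> * (ep x * I x - em x * J x) + 2 * \<phi> x))"
    unfolding d1
  proof (rule vderiv_eqI)
    fix x
    have "((\<lambda>x. (- 1 / 2) * (ep x * I x + em x * J x)) has_vector_derivative
        (- 1 / 2) * ((\<i> * \<omega> * (ep x * I x) + \<phi> x) + ((- \<i> * \<omega>) * (em x * J x) + \<phi> x))) (at x)"
      by (intro has_vector_derivative_mult_right has_vector_derivative_add dI dJ)
    moreover have "(\<i> * \<omega> * (ep x * I x) + \<phi> x) + ((- \<i> * \<omega>) * (em x * J x) + \<phi> x)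
        = \<i> * \<omega> * (ep x * I x - em x * J x) + 2 * \<phi> x"
      by (simp add: algebra_simps)
    ultimately show "((\<lambda>x. (- 1 / 2) * (ep x * I x + em x * J x)) has_vector_derivative
        (- 1 / 2) * (\<i> * \<omega> * (ep x * I x - em x * J x) + 2 * \<phi> x)) (at x)" by (simp only:)
  qed
  have "smooth \<Phi>" unfolding \<Phi>_def by (intro smooth_mult smooth_const smooth_diff sm smI)
  moreover have "- vderiv (vderiv \<Phi>) x - \<omega>\<^sup>2 * \<Phi> x = \<phi> x" for x
    using \<omega> unfolding d2 by (simp add: \<Phi>_def field_simps power2_eq_square)
  ultimately show thesis by (rule that)
qed

section \<open>Integrable functions orthogonal to all smooth functions\<close>

lemma sigma_finite_lebesgue: "sigma_finite_measure (lebesgue :: real measure)"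
proof
  obtain A :: "real set set" where A: "countable A" "A \<subseteq> sets lborel" "\<Union>A = space lborel" "\<forall>a\<in>A. emeasure lborel a \<noteq> \<infinity>"
    using lborel.sigma_finite_countable by blast
  then show "\<exists>A::real set set. countable A \<and> A \<subseteq> sets lebesgue \<and> \<Union>A = space lebesgue \<and> (\<forall>a\<in>A. emeasure lebesgue a \<noteq> \<infinity>)"
    by (intro exI[of _ A]) auto
qed

text \<open>
  The rays form an intersection-stable generator of the Borel sets, so the integral of \<open>W\<close> vanishes
  over every Borel set, and then over every Lebesgue set, which agrees with a Borel set almost
  everywhere.
\<close>

lemma integrals_right_rays_zero_imp_AE_zero:
  fixes W :: "real \<Rightarrow> complex"
  assumes W: "integrable lebesgue W" and ray: "\<And>c. (\<integral>x. indicator {c<..} x *\<^sub>R W x \<partial>lebesgue) = 0"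
  shows "AE x in lebesgue. W x = 0"
proof (rule sigma_finite_measure.density_zero[OF sigma_finite_lebesgue W])
  have int: "integrable lebesgue (\<lambda>x. indicator A x *\<^sub>R W x)" if "A \<in> sets borel" for A :: "real set"
    using that by (intro integrable_mult_indicator W) auto
  have lim: "(\<lambda>n. \<integral>x. indicator (A n) x *\<^sub>R W x \<partial>lebesgue) \<longlonglongrightarrow> (\<integral>x. indicator A' x *\<^sub>R W x \<partial>lebesgue)"
    if A: "\<And>n. A n \<in> sets borel" "A' \<in> sets borel" and "\<And>x. (\<lambda>n. indicator (A n) x :: real) \<longlonglongrightarrow> indicator A' x"
    for A :: "nat \<Rightarrow> real set" and A'
  proof (rule integral_dominated_convergence[where w = "\<lambda>x. norm (W x)"])
    show "AE x in lebesgue. (\<lambda>n. indicator (A n) x *\<^sub>R W x) \<longlonglongrightarrow> indicator A' x *\<^sub>R W x"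
      using that(3) by (intro AE_I2 tendsto_intros)
    show "AE x in lebesgue. norm (indicator (A n) x *\<^sub>R W x) \<le> norm (W x)" for n
      by (auto simp: indicator_def)
  qed (use int[OF A(1)] int[OF A(2)] W in auto)
  have univ: "(\<integral>x. W x \<partial>lebesgue) = 0"
  proof -
    have "(\<lambda>n. \<integral>x. indicator {- real n<..} x *\<^sub>R W x \<partial>lebesgue) \<longlonglongrightarrow> (\<integral>x. indicator UNIV x *\<^sub>R W x \<partial>lebesgue)"
    proof (rule lim)
      fix x :: real
      obtain N where "- x < real N" using reals_Archimedean2 by blast
      then have "\<forall>\<^sub>F n in sequentially. (indicator {- real n<..} x :: real) = indicator UNIV x"
        unfolding eventually_sequentially by (intro exI[of _ N]) (auto simp: indicator_def)
      then show "(\<lambda>n. indicator {- real n<..} x :: real) \<longlonglongrightarrow> indicator UNIV x" by (rule tendsto_eventually)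
    qed auto
    then have "(\<lambda>n::nat. 0) \<longlonglongrightarrow> (\<integral>x. W x \<partial>lebesgue)" unfolding ray by simp
    then show ?thesis using LIMSEQ_const_iff by metis
  qed
  have borel: "(\<integral>x. indicator A x *\<^sub>R W x \<partial>lebesgue) = 0" if "A \<in> sets borel" for A :: "real set"
  proof -
    have gen: "sets borel = sigma_sets UNIV (range (\<lambda>a::real. {a<..}))"
      unfolding borel_Ioi by simp
    have "{a<..} \<inter> {b<..} = {max a b<..}" for a b :: real by auto
    then have "Int_stable (range (\<lambda>a::real. {a<..}))" by (auto simp: Int_stable_def)
    moreover have "range (\<lambda>a::real. {a<..}) \<subseteq> Pow UNIV" by simp
    moreover have "A \<in> sigma_sets UNIV (range (\<lambda>a::real. {a<..}))" using that gen by simp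
    ultimately show ?thesis
    proof (induction rule: sigma_sets_induct_disjoint)
      case (basic A) then show ?case using ray by auto
    next
      case empty show ?case by simp
    next
      case (compl A)
      then have A: "A \<in> sets borel" using gen by simp
      have "(\<lambda>x. indicator (UNIV - A) x *\<^sub>R W x) = (\<lambda>x. W x - indicator A x *\<^sub>R W x)"
        by (auto simp: indicator_def)
      then show ?case using compl univ W int[OF A] by simp
    next
      case (union A)
      then have A: "\<And>i. A i \<in> sets borel" using gen by auto
      have fin: "(\<integral>x. indicator (\<Union>i<n. A i) x *\<^sub>R W x \<partial>lebesgue) = 0" for n
      proof -
        have "(indicator (\<Union>i<n. A i) x :: real) = (\<Sum>i<n. indicator (A i) x)" for x
          using union(1) by (intro indicator_UN_disjoint) (auto simp: disjoint_family_on_def)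
        then have "(\<integral>x. indicator (\<Union>i<n. A i) x *\<^sub>R W x \<partial>lebesgue)
            = (\<integral>x. (\<Sum>i<n. indicator (A i) x *\<^sub>R W x) \<partial>lebesgue)"
          by (simp only: scaleR_sum_left)
        also have "\<dots> = 0" using union(3) int[OF A] by (subst Bochner_Integration.integral_sum) auto
        finally show ?thesis .
      qed
      have "(\<lambda>n. \<integral>x. indicator (\<Union>i<n. A i) x *\<^sub>R W x \<partial>lebesgue) \<longlonglongrightarrow> (\<integral>x. indicator (\<Union>i. A i) x *\<^sub>R W x \<partial>lebesgue)"
        using A by (intro lim LIMSEQ_indicator_UN) auto
      then show ?case unfolding fin using LIMSEQ_const_iff by metis
    qed
  qed
  fix A :: "real set" assume A: "A \<in> sets lebesgue"
  have A': "main_part lborel A \<in> sets borel" using main_part_sets[OF A] by simp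
  have "AE x in lborel. (x \<in> main_part lborel A) = (x \<in> A)" using A by (rule AE_in_main_part)
  then have "AE x in lebesgue. indicator A x *\<^sub>R W x = indicator (main_part lborel A) x *\<^sub>R W x"
    by (intro AE_completion) (auto simp: indicator_def elim: AE_mp)
  then have "(\<integral>x. indicator A x *\<^sub>R W x \<partial>lebesgue) = (\<integral>x. indicator (main_part lborel A) x *\<^sub>R W x \<partial>lebesgue)"
    using A A' W integrable_mult_indicator[OF A W] int[OF A'] by (intro integral_cong_AE) auto
  then show "set_lebesgue_integral lebesgue A W = 0"
    unfolding set_lebesgue_integral_def using borel[OF A'] by simp
qed

text \<open>
  The smooth functions \<open>exp (-1 / (n (x - c)))\<close>, extended by zero to \<open>x \<le> c\<close>, are bounded by one and
  converge to the indicator of the ray \<open>x > c\<close>.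
\<close>

lemma orthogonal_smooth_imp_AE_zero:
  fixes W :: "real \<Rightarrow> complex"
  assumes W: "integrable lebesgue W" and orth: "\<And>\<phi>. smooth \<phi> \<Longrightarrow> (\<integral>x. W x * \<phi> x \<partial>lebesgue) = 0"
  shows "AE x in lebesgue. W x = 0"
proof (rule integrals_right_rays_zero_imp_AE_zero[OF W])
  fix c :: real
  define \<phi> where "\<phi> n x = complex_of_real (flat_step 1 (real (Suc n) * x + - (real (Suc n) * c)))" for n x
  have sm: "smooth (\<phi> n)" for n unfolding \<phi>_def by (rule smooth_affine[OF smooth_flat_step])
  have "(\<lambda>n. \<integral>x. W x * \<phi> n x \<partial>lebesgue) \<longlonglongrightarrow> (\<integral>x. indicator {c<..} x *\<^sub>R W x \<partial>lebesgue)"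
  proof (rule integral_dominated_convergence[where w = "\<lambda>x. norm (W x)"])
    show "(\<lambda>x. W x * \<phi> n x) \<in> borel_measurable lebesgue" for n
      using W smooth_continuous[OF sm]
      by (intro borel_measurable_times borel_measurable_integrable[of lebesgue W] measurable_completion[of "\<phi> n"])
        (auto intro!: borel_measurable_continuous_onI)
    show "AE x in lebesgue. norm (W x * \<phi> n x) \<le> norm (W x)" for n
      by (intro AE_I2) (auto simp: \<phi>_def flat_step_1 norm_mult intro!: mult_left_le)
    show "AE x in lebesgue. (\<lambda>n. W x * \<phi> n x) \<longlonglongrightarrow> indicator {c<..} x *\<^sub>R W x"
    proof (rule AE_I2)
      fix x :: real
      show "(\<lambda>n. W x * \<phi> n x) \<longlonglongrightarrow> indicator {c<..} x *\<^sub>R W x"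
      proof (cases "x > c")
        case True
        have "(\<lambda>n. - (inverse (x - c) * inverse (real (Suc n)))) \<longlonglongrightarrow> - (inverse (x - c) * 0)"
          by (intro tendsto_intros LIMSEQ_inverse_real_of_nat)
        then have "(\<lambda>n. W x * of_real (exp (- (inverse (x - c) * inverse (real (Suc n)))))) \<longlonglongrightarrow> W x * of_real (exp (- (inverse (x - c) * 0)))"
          by (intro tendsto_mult tendsto_of_real tendsto_exp tendsto_const)
        moreover have "\<phi> n x = of_real (exp (- (inverse (x - c) * inverse (real (Suc n)))))" for n
        proof -
          have "real (Suc n) * x + - (real (Suc n) * c) = real (Suc n) * (x - c)" by (simp add: algebra_simps)
          then show ?thesis unfolding \<phi>_def flat_step_1 using True
            by (simp del: of_nat_Suc add: divide_inverse mult.commute)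
        qed
        ultimately show ?thesis using True by simp
      next
        case False
        then have "\<phi> n x = 0" for n unfolding \<phi>_def flat_step_1
          using mult_left_mono[of x c "real (Suc n)"] by (simp del: of_nat_Suc)
        then show ?thesis using False by simp
      qed
    qed
  qed (use W in \<open>auto intro!: borel_measurable_integrable[OF integrable_mult_indicator]\<close>)
  then have "(\<lambda>n::nat. 0) \<longlonglongrightarrow> (\<integral>x. indicator {c<..} x *\<^sub>R W x \<partial>lebesgue)"
    unfolding orth[OF sm] .
  then show "(\<integral>x. indicator {c<..} x *\<^sub>R W x \<partial>lebesgue) = 0" using LIMSEQ_const_iff by metis
qed

section \<open>The Fourier--Laplace transform\<close>

text \<open>
  Rounding \<open>t\<close> down to a multiple of \<open>1/n\<close> gives jointly measurable functions, which converge to \<open>F\<close>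
  by continuity.
\<close>

lemma Caratheodory_measurable:
  fixes F :: "'a \<Rightarrow> real \<Rightarrow> complex"
  assumes meas: "\<And>t. (\<lambda>x. F x t) \<in> borel_measurable M"
    and cont: "\<And>x. x \<in> space M \<Longrightarrow> continuous_on UNIV (F x)"
  shows "(\<lambda>(x, t). F x t) \<in> borel_measurable (M \<Otimes>\<^sub>M lborel)"
proof (rule borel_measurable_LIMSEQ_metric)
  fix n :: nat
  show "(\<lambda>p. F (fst p) (of_int \<lfloor>real (Suc n) * snd p\<rfloor> / real (Suc n))) \<in> borel_measurable (M \<Otimes>\<^sub>M lborel)"
  proof (rule measurable_compose_countable[where f = "\<lambda>i p. F (fst p) (of_int i / real (Suc n))" and g = "\<lambda>p. \<lfloor>real (Suc n) * snd p\<rfloor>"])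
    show "(\<lambda>p. F (fst p) (of_int i / real (Suc n))) \<in> borel_measurable (M \<Otimes>\<^sub>M lborel)" for i
      by (rule measurable_compose[OF measurable_fst meas])
    show "(\<lambda>p. \<lfloor>real (Suc n) * snd p\<rfloor>) \<in> measurable (M \<Otimes>\<^sub>M lborel) (count_space UNIV)"
      by measurable
  qed
next
  fix p :: "'a \<times> real" assume "p \<in> space (M \<Otimes>\<^sub>M lborel)"
  then obtain x and t :: real where p: "p = (x, t)" and x: "x \<in> space M" by (auto simp: space_pair_measure)
  have "(\<lambda>n. of_int \<lfloor>real (Suc n) * t\<rfloor> / real (Suc n)) \<longlonglongrightarrow> t"
  proof (rule tendsto_sandwich[of "\<lambda>n. t - inverse (real (Suc n))" _ _ "\<lambda>n. t"])
    have *: "real (Suc n) * t - 1 \<le> of_int \<lfloor>real (Suc n) * t\<rfloor>" "of_int \<lfloor>real (Suc n) * t\<rfloor> \<le> real (Suc n) * t" for n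
      by linarith+
    show "\<forall>\<^sub>F n in sequentially. t - inverse (real (Suc n)) \<le> of_int \<lfloor>real (Suc n) * t\<rfloor> / real (Suc n)"
    proof (rule always_eventually, rule allI)
      fix n show "t - inverse (real (Suc n)) \<le> of_int \<lfloor>real (Suc n) * t\<rfloor> / real (Suc n)"
        using divide_right_mono[OF *(1)[of n], of "real (Suc n)"]
        by (simp add: diff_divide_distrib inverse_eq_divide del: of_nat_Suc)
    qed
    show "\<forall>\<^sub>F n in sequentially. of_int \<lfloor>real (Suc n) * t\<rfloor> / real (Suc n) \<le> t"
    proof (rule always_eventually, rule allI)
      fix n show "of_int \<lfloor>real (Suc n) * t\<rfloor> / real (Suc n) \<le> t"
        using divide_right_mono[OF *(2)[of n], of "real (Suc n)"] by (simp del: of_nat_Suc)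
    qed
    have "(\<lambda>n. t - inverse (real (Suc n))) \<longlonglongrightarrow> t - 0"
      by (intro tendsto_diff tendsto_const LIMSEQ_inverse_real_of_nat)
    then show "(\<lambda>n. t - inverse (real (Suc n))) \<longlonglongrightarrow> t" by simp
  qed simp
  then have "(\<lambda>n. F x (of_int \<lfloor>real (Suc n) * t\<rfloor> / real (Suc n))) \<longlonglongrightarrow> F x t"
    using cont[OF x] by (intro continuous_on_tendsto_compose[of UNIV "F x"]) auto
  then show "(\<lambda>n. F (fst p) (of_int \<lfloor>real (Suc n) * snd p\<rfloor> / real (Suc n))) \<longlonglongrightarrow> (case p of (x, t) \<Rightarrow> F x t)"
    by (simp add: p)
qed

definition decay :: "real \<Rightarrow> real" where
  "decay s = 1 / (1 + s\<^sup>2)"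

definition decay_mass :: real where
  "decay_mass = (\<integral>s. decay s \<partial>lborel)"

lemma decay_pos: "decay s > 0"
  by (simp add: decay_def add_pos_nonneg)

lemma decay_le_1: "decay s \<le> 1"
  by (simp add: decay_def divide_le_eq_1 add_pos_nonneg)

lemma continuous_decay: "continuous_on S decay"
  unfolding decay_def by (intro continuous_intros) (simp add: add_pos_nonneg less_imp_neq[symmetric])

lemma borel_measurable_decay [measurable]: "decay \<in> borel_measurable borel"
  by (intro borel_measurable_continuous_onI continuous_decay)

lemma integrable_decay: "integrable lborel decay"
  using integrable_inverse_1_plus_square_real by (simp add: decay_def[abs_def])

lemma integrable_decay_reflect: "integrable lborel (\<lambda>l. decay (x - l))"
  using lborel_integrable_real_affine[OF integrable_decay, of "-1" x] by simp

lemma integral_decay_reflect: "(\<integral>l. decay (x - l) \<partial>lborel) = decay_mass"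
  using lborel_integral_real_affine[of "-1" decay x] by (simp add: decay_mass_def)

lemma decay_mass_nonneg: "decay_mass \<ge> 0"
  unfolding decay_mass_def by (intro integral_nonneg_AE AE_I2 less_imp_le[OF decay_pos])

lemma decay_square_le: "(decay s)\<^sup>2 \<le> decay s"
  using decay_le_1[of s] decay_pos[of s] by (simp add: power2_eq_square mult_left_le)

text \<open>
  Half of the decay of \<open>decay\<^sup>2\<close> pays for the weight, the other half remains integrable.
\<close>

lemma decay_square_weight_le: "(1 + \<bar>s\<bar>) * (decay s)\<^sup>2 \<le> 2 * decay s"
proof -
  have "\<bar>s\<bar> \<le> 1 + s\<^sup>2" using sum_squares_bound[of 1 "\<bar>s\<bar>"] zero_le_power2[of s] by simp
  then have "1 + \<bar>s\<bar> \<le> 2 * (1 + s\<^sup>2)" using zero_le_power2[of s] unfolding distrib_left by linarith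
  then have "(1 + \<bar>s\<bar>) * decay s \<le> 2"
    by (simp add: decay_def divide_le_eq add_pos_nonneg)
  then have "((1 + \<bar>s\<bar>) * decay s) * decay s \<le> 2 * decay s"
    using decay_pos[of s] by (intro mult_right_mono) auto
  then show ?thesis by (simp add: power2_eq_square mult.assoc)
qed

lemma decay_shift_le: "decay (s + t) \<le> 2 * (1 + s\<^sup>2) * decay t"
  using inverse_one_plus_square_shift_le[of s t] by (simp add: decay_def)

definition fourier_laplace :: "(real \<Rightarrow> complex) \<Rightarrow> complex \<Rightarrow> complex" where
  "fourier_laplace h z = (\<integral>t. h t * exp (\<i> * z * of_real t) \<partial>lborel)"

lemma fourier_eq_fourier_laplace: "fourier h \<omega> = fourier_laplace h (of_real \<omega>)"
  unfolding fourier_def fourier_laplace_def by (simp add: mult.assoc)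

lemma integrable_continuous_compact_support:
  fixes f :: "real \<Rightarrow> complex"
  assumes "continuous_on UNIV f" and "\<And>t. \<bar>t\<bar> > T \<Longrightarrow> f t = 0"
  shows "integrable lborel f"
proof -
  have "integrable lborel (\<lambda>x. indicator {-T..T} x *\<^sub>R f x)"
    using assms(1) by (intro borel_integrable_compact) (auto intro: continuous_on_subset)
  moreover have "(\<lambda>x. indicator {-T..T} x *\<^sub>R f x) = f"
  proof
    fix x show "indicator {-T..T} x *\<^sub>R f x = f x"
    proof (cases "\<bar>x\<bar> \<le> T")
      case True
      then have "x \<in> {-T..T}" by (simp add: abs_le_iff)
      then show ?thesis by simp
    next
      case False
      then have "f x = 0" using assms(2)[of x] by simp
      then show ?thesis by simp
    qed
  qed
  ultimately show ?thesis by simp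
qed

lemma vderiv_support:
  assumes "smooth h" and h: "\<And>t. \<bar>t\<bar> > T \<Longrightarrow> h t = 0" and t: "\<bar>t\<bar> > T"
  shows "vderiv h t = 0"
proof -
  have "(h has_vector_derivative 0) (at t)"
  proof (rule has_vector_derivative_transform_within_open[of "\<lambda>_. 0" _ _ "{t. \<bar>t\<bar> > T}"])
    show "open {t. \<bar>t\<bar> > T}" by (intro open_Collect_less continuous_intros)
  qed (use h t in auto)
  then show ?thesis by (simp add: vderiv_def vector_derivative_at)
qed

lemma integral_vderiv_compact_support:
  assumes sm: "smooth h" and h: "\<And>t. \<bar>t\<bar> > T \<Longrightarrow> h t = 0"
  shows "(\<integral>t. vderiv h t \<partial>lborel) = 0"
proof -
  let ?S = "{- \<bar>T\<bar> - 1..\<bar>T\<bar> + 1}"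
  have int: "integrable lborel (vderiv h)"
    using smooth_continuous[OF smooth_vderiv[OF sm]] vderiv_support[OF sm h]
    by (rule integrable_continuous_compact_support)
  have "(vderiv h has_integral (h (\<bar>T\<bar> + 1) - h (- \<bar>T\<bar> - 1))) ?S"
    by (rule fundamental_theorem_of_calculus[OF _ has_vector_derivative_at_within[OF smooth_has_vderiv[OF sm]]]) simp
  then have "(vderiv h has_integral 0) ?S" using h by simp
  then have "(vderiv h has_integral 0) UNIV"
    by (rule has_integral_on_superset) (auto intro!: vderiv_support[OF sm h])
  moreover have "(vderiv h has_integral (\<integral>t. vderiv h t \<partial>lborel)) UNIV"
    using int by (rule has_integral_integral_lborel)
  ultimately show ?thesis by (rule has_integral_unique[symmetric])
qed

text \<open>
  Integration by parts, read off from the vanishing integral of \<open>(h(t) exp (\<i>zt))'\<close>.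
\<close>

lemma fourier_laplace_vderiv:
  assumes sm: "smooth h" and h: "\<And>t. \<bar>t\<bar> > T \<Longrightarrow> h t = 0"
  shows "fourier_laplace (vderiv h) z = - (\<i> * z) * fourier_laplace h z"
proof -
  define e where "e t = exp ((\<i> * z) * of_real t)" for t :: real
  have sme: "smooth e" unfolding e_def by (rule smooth_exp)
  have de: "(e has_vector_derivative (\<i> * z) * e t) (at t)" for t
    unfolding e_def by (rule has_vector_derivative_exp_of_real)
  have v: "vderiv (\<lambda>t. h t * e t) = (\<lambda>t. h t * ((\<i> * z) * e t) + vderiv h t * e t)"
    by (intro vderiv_eqI has_vector_derivative_mult smooth_has_vderiv sm de)
  have int: "integrable lborel (\<lambda>t. h t * e t)" "integrable lborel (\<lambda>t. vderiv h t * e t)"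
    by (rule integrable_continuous_compact_support[of _ T];
        auto intro!: smooth_continuous smooth_mult smooth_vderiv sm sme simp: h vderiv_support[OF sm h])+
  have "0 = (\<integral>t. h t * ((\<i> * z) * e t) + vderiv h t * e t \<partial>lborel)"
    unfolding v[symmetric] using h
    by (intro integral_vderiv_compact_support[symmetric, of _ T] smooth_mult sm sme) auto
  also have "\<dots> = (\<integral>t. (\<i> * z) * (h t * e t) + vderiv h t * e t \<partial>lborel)"
    by (simp only: mult.left_commute)
  also have "\<dots> = (\<i> * z) * (\<integral>t. h t * e t \<partial>lborel) + (\<integral>t. vderiv h t * e t \<partial>lborel)"
    using int by (subst Bochner_Integration.integral_add) auto
  finally show ?thesis
    unfolding fourier_laplace_def e_def by (simp add: eq_neg_iff_add_eq_0 add.commute)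
qed

lemma norm_exp_ii_times: "cmod (exp (\<i> * z * of_real t)) = exp (- Im z * t)"
  by (simp add: norm_exp_eq_Re)

lemma fourier_laplace_bound:
  assumes cont: "continuous_on UNIV h" and h: "\<And>t. \<bar>t\<bar> > T \<Longrightarrow> h t = 0"
    and bd: "\<And>t. cmod (h t) \<le> M" and T: "T \<ge> 0"
  shows "cmod (fourier_laplace h z) \<le> 2 * T * M * exp (T * \<bar>Im z\<bar>)"
proof -
  have "cmod (fourier_laplace h z) \<le> (\<integral>t. (M * exp (T * \<bar>Im z\<bar>)) * indicator {-T..T} t \<partial>lborel)"
    unfolding fourier_laplace_def
  proof (rule Bochner_Integration.integral_norm_bound_integral)
    show "integrable lborel (\<lambda>t. h t * exp (\<i> * z * of_real t))"
      by (rule integrable_continuous_compact_support[of _ T]) (auto intro!: continuous_intros cont simp: h)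
    show "cmod (h t * exp (\<i> * z * of_real t)) \<le> (M * exp (T * \<bar>Im z\<bar>)) * indicator {-T..T} t" for t
    proof (cases "\<bar>t\<bar> \<le> T")
      case True
      have "- Im z * t \<le> \<bar>Im z\<bar> * \<bar>t\<bar>" by (metis abs_ge_self abs_minus_cancel abs_mult)
      also have "\<dots> \<le> \<bar>Im z\<bar> * T" using True by (intro mult_left_mono) auto
      finally have "exp (- Im z * t) \<le> exp (T * \<bar>Im z\<bar>)" by (simp add: mult.commute)
      then have "cmod (h t) * exp (- Im z * t) \<le> M * exp (T * \<bar>Im z\<bar>)"
        using bd[of t] by (intro mult_mono order_trans[OF norm_ge_zero bd]) auto
      moreover have "t \<in> {-T..T}" using True by auto
      ultimately show ?thesis by (simp add: norm_mult norm_exp_ii_times)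
    qed (use h[of t] order_trans[OF norm_ge_zero bd] in \<open>auto simp: indicator_def\<close>)
  qed (use T in \<open>auto intro!: integrable_mult_right integrable_real_indicator\<close>)
  also have "\<dots> = (M * exp (T * \<bar>Im z\<bar>)) * (2 * T)" using T by simp
  finally show ?thesis by (simp add: mult_ac)
qed

text \<open>
  Four integrations by parts bound \<open>\<bar>z\<bar>\<^sup>4\<close> times the transform.  Fourth order decay leaves room for
  the weight \<open>\<bar>\<omega> + \<i>\<bar>\<close> in convolutions: multiplied by \<open>1 + \<bar>s\<bar>\<close>, it is still integrable.
\<close>

lemma fourier_laplace_decay:
  assumes sm: "smooth h" and h: "\<And>t. \<bar>t\<bar> > T \<Longrightarrow> h t = 0"
    and bd: "\<And>t. cmod (h t) \<le> M" "\<And>t. cmod ((vderiv ^^ 4) h t) \<le> M" and T: "T \<ge> 0"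
  shows "cmod (fourier_laplace h z) \<le> 8 * T * M * exp (T * \<bar>Im z\<bar>) * (decay (Re z))\<^sup>2"
proof -
  have k: "smooth ((vderiv ^^ k) h) \<and> (\<forall>t. \<bar>t\<bar> > T \<longrightarrow> (vderiv ^^ k) h t = 0) \<and>
      fourier_laplace ((vderiv ^^ k) h) z = (- (\<i> * z)) ^ k * fourier_laplace h z" for k
  proof (induction k)
    case (Suc k)
    then show ?case
      using smooth_vderiv vderiv_support[of "(vderiv ^^ k) h" T] fourier_laplace_vderiv[of "(vderiv ^^ k) h" T z]
      by simp
  qed (use sm h in auto)
  define E where "E = 2 * T * M * exp (T * \<bar>Im z\<bar>)"
  have 0: "cmod (fourier_laplace h z) \<le> E"
    unfolding E_def by (rule fourier_laplace_bound[OF smooth_continuous[OF sm] h bd(1) T])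
  have "cmod (fourier_laplace ((vderiv ^^ 4) h) z) \<le> E"
    unfolding E_def using k[of 4] smooth_continuous bd(2) T by (intro fourier_laplace_bound) auto
  then have 4: "cmod z ^ 4 * cmod (fourier_laplace h z) \<le> E"
    using k[of 4] by (simp add: norm_mult norm_power)
  have "(1 + (Re z)\<^sup>2)\<^sup>2 \<le> 2 * (1 + (Re z) ^ 4)"
    using sum_squares_bound[of 1 "(Re z)\<^sup>2"] by (simp add: power2_sum power_mult[symmetric])
  also have "(Re z) ^ 4 \<le> cmod z ^ 4"
  proof -
    have "\<bar>Re z\<bar> ^ 4 \<le> cmod z ^ 4" by (intro power_mono abs_Re_le_cmod) auto
    then show ?thesis by simp
  qed
  finally have "(1 + (Re z)\<^sup>2)\<^sup>2 \<le> 2 * (1 + cmod z ^ 4)" by simp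
  then have "(1 + (Re z)\<^sup>2)\<^sup>2 * cmod (fourier_laplace h z) \<le> 2 * (1 + cmod z ^ 4) * cmod (fourier_laplace h z)"
    by (intro mult_right_mono) auto
  also have "\<dots> \<le> 4 * E" using 0 4 by (simp add: algebra_simps)
  finally have "cmod (fourier_laplace h z) \<le> 4 * E / (1 + (Re z)\<^sup>2)\<^sup>2"
    using add_pos_nonneg[OF zero_less_one zero_le_power2, of "Re z"]
    by (subst pos_le_divide_eq) (simp_all add: mult.commute)
  then show ?thesis by (simp add: decay_def E_def power_divide)
qed

lemma fourier_laplace_holomorphic:
  assumes cont: "continuous_on UNIV h" and h: "\<And>t. \<bar>t\<bar> > T \<Longrightarrow> h t = 0"
  shows "fourier_laplace h holomorphic_on UNIV"
  unfolding fourier_laplace_def[abs_def]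
proof (rule holomorphic_on_integral)
  show "(\<lambda>t. h t * exp (\<i> * z * of_real t)) \<in> borel_measurable lborel" for z
    using cont by (auto intro!: borel_measurable_continuous_onI continuous_intros)
  show "(\<lambda>z. h t * exp (\<i> * z * of_real t)) holomorphic_on UNIV" for t
    by (intro holomorphic_intros)
  fix z :: complex
  have "cmod (h t * exp (\<i> * w * of_real t)) \<le> cmod (h t * exp (of_real (T * (\<bar>Im z\<bar> + 1))))" if w: "w \<in> cball z 1" for w t
  proof (cases "\<bar>t\<bar> \<le> T")
    case True
    have "\<bar>Im w\<bar> \<le> \<bar>Im z\<bar> + 1" using w abs_Im_le_cmod[of "z - w"] by (simp add: dist_norm)
    moreover have "- Im w * t \<le> \<bar>Im w\<bar> * \<bar>t\<bar>" by (metis abs_ge_self abs_minus_cancel abs_mult)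
    ultimately have "- Im w * t \<le> (\<bar>Im z\<bar> + 1) * T" using True
      by (meson abs_ge_zero mult_mono order_trans)
    then have "exp (- Im w * t) \<le> exp (T * (\<bar>Im z\<bar> + 1))" by (simp add: mult.commute)
    then show ?thesis by (simp only: norm_mult norm_exp_ii_times norm_exp_eq_Re Re_complex_of_real) (intro mult_left_mono; simp)
  qed (use h[of t] in auto)
  moreover have "integrable lborel (\<lambda>t. cmod (h t * exp (of_real (T * (\<bar>Im z\<bar> + 1)))))"
    using integrable_continuous_compact_support[OF cont h] by (intro integrable_norm integrable_mult_left)
  ultimately show "\<exists>r>0. \<exists>g. cball z r \<subseteq> UNIV \<and> integrable lborel g \<and>
      (\<forall>w\<in>cball z r. \<forall>t\<in>space lborel. cmod (h t * exp (\<i> * w * of_real t)) \<le> g t)"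
    by (intro exI[of _ 1] conjI exI[of _ "\<lambda>t. cmod (h t * exp (of_real (T * (\<bar>Im z\<bar> + 1))))"]) auto
qed auto

section \<open>Convolution with the coefficient along horizontal lines\<close>

text \<open>
  A coefficient for which the assumptions hold at every \<open>x\<close>; the bound \<open>M\<close> is shared by \<open>a\<close> and its
  fourth derivative in time, the two seminorms that enter the decay of the transform.
\<close>

locale coefficient =
  fixes R T \<gamma> M :: real and a :: "real \<Rightarrow> real \<Rightarrow> complex"
  assumes R: "R > 0" and T: "T > 0" and \<gamma>: "\<gamma> > 0" and M: "M \<ge> 0"
    and a_measurable: "\<And>t. (\<lambda>x. a x t) \<in> borel_measurable lebesgue"
    and a_smooth: "\<And>x. smooth (a x)"
    and a_support: "\<And>x t. (x, t) \<notin> {-R..R} \<times> {-T..T} \<Longrightarrow> a x t = 0"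
    and a_bound: "\<And>x t. cmod (a x t) \<le> M"
    and a_bound4: "\<And>x t. cmod ((vderiv ^^ 4) (a x) t) \<le> M"
begin

definition ahat :: "real \<Rightarrow> complex \<Rightarrow> complex" where
  "ahat x = fourier_laplace (a x)"

text \<open>
  A bound, uniform in \<open>x\<close> and in the height of the
  line, for the operator \<open>a(x, D\<^sub>\<omega>)\<close> in the weighted and
  in the plain supremum norm.
\<close>

definition B :: real where
  "B = 8 * T * M * decay_mass"

lemma B_nonneg: "B \<ge> 0"
  using T M decay_mass_nonneg by (simp add: B_def)

lemma a_support_t: "\<bar>t\<bar> > T \<Longrightarrow> a x t = 0"
  by (rule a_support) auto

lemma ahat_outside: "\<bar>x\<bar> > R \<Longrightarrow> ahat x z = 0"
  proof -
  assume "\<bar>x\<bar> > R"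
  then have "a x t = 0" for t by (intro a_support) auto
  then show ?thesis by (simp add: ahat_def fourier_laplace_def)
qed

lemma ahat_bound: "cmod (ahat x z) \<le> 8 * T * M * exp (T * \<bar>Im z\<bar>) * (decay (Re z))\<^sup>2"
  unfolding ahat_def
  by (rule fourier_laplace_decay[OF a_smooth a_support_t a_bound a_bound4]) (use T in auto)

text \<open>
  The form of the decay estimate that provides dominating functions in the integration variable
  \<open>\<zeta>\<close>, locally uniformly in \<open>z\<close>.
\<close>

lemma ahat_shift_bound:
  assumes "\<bar>Im z - Im \<zeta>\<bar> \<le> d"
  shows "cmod (ahat y (z - \<zeta>)) \<le> 16 * T * M * exp (T * d) * (1 + (Re z)\<^sup>2) * decay (Re \<zeta>)"
proof -
  have "(decay (Re z - Re \<zeta>))\<^sup>2 \<le> decay (Re z + (- Re \<zeta>))" using decay_square_le by simp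
  also have "\<dots> \<le> 2 * (1 + (Re z)\<^sup>2) * decay (- Re \<zeta>)" by (rule decay_shift_le)
  finally have "(decay (Re z - Re \<zeta>))\<^sup>2 \<le> 2 * (1 + (Re z)\<^sup>2) * decay (Re \<zeta>)" by (simp add: decay_def)
  then have "8 * T * M * exp (T * \<bar>Im z - Im \<zeta>\<bar>) * (decay (Re z - Re \<zeta>))\<^sup>2
      \<le> 8 * T * M * exp (T * d) * (2 * (1 + (Re z)\<^sup>2) * decay (Re \<zeta>))"
    using assms T M by (intro mult_mono mult_left_mono) auto
  then show ?thesis using ahat_bound[of y "z - \<zeta>"] by (simp add: mult_ac)
qed

lemma ahat_holomorphic: "ahat x holomorphic_on S"
  unfolding ahat_def
  by (rule holomorphic_on_subset[OF _ subset_UNIV])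
     (rule fourier_laplace_holomorphic[OF smooth_continuous[OF a_smooth] a_support_t])

lemma ahat_continuous: "continuous_on S (ahat x)"
  by (intro holomorphic_on_imp_continuous_on ahat_holomorphic)

lemma ahat_measurable: "(\<lambda>x. ahat x z) \<in> borel_measurable lebesgue"
proof -
  have "(\<lambda>(x, t). a x t * exp (\<i> * z * of_real t)) \<in> borel_measurable (lebesgue \<Otimes>\<^sub>M lborel)"
  proof (rule Caratheodory_measurable)
    show "(\<lambda>x. a x t * exp (\<i> * z * of_real t)) \<in> borel_measurable lebesgue" for t
      by (intro borel_measurable_times a_measurable borel_measurable_const)
    show "continuous_on UNIV (\<lambda>t. a x t * exp (\<i> * z * of_real t))" for x
      by (intro continuous_intros smooth_continuous a_smooth)
  qed
  then show ?thesis unfolding ahat_def fourier_laplace_def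
    by (rule lborel.borel_measurable_lebesgue_integral)
qed

text \<open>
  The convolution defining \<open>a(x, D\<^sub>\<omega>)\<close>, with the values of \<open>v\<close> taken on the line of height \<open>\<sigma>\<close> but
  evaluated at an arbitrary complex point \<open>z\<close>.  For \<open>Im z = \<sigma>\<close> it is the operator itself, for other \<open>z\<close>
  its entire extension.
\<close>

definition line_conv :: "real \<Rightarrow> (real \<Rightarrow> complex) \<Rightarrow> real \<Rightarrow> complex \<Rightarrow> complex" where
  "line_conv \<sigma> v y z = 1 / (2 * of_real pi) * (\<integral>l. ahat y (z - Complex l \<sigma>) * v l \<partial>lborel)"

lemma a_D_eq_line_conv: "a_D a v x z = line_conv (Im z) (\<lambda>l. v x (Complex l (Im z))) x z"
proof -
  have "z - Complex l (Im z) = of_real (Re z - l)" for l by (simp add: complex_eq_iff)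
  then show ?thesis
    unfolding a_D_def line_conv_def fourier_eq_fourier_laplace ahat_def by simp
qed

lemma line_conv_outside: "\<bar>y\<bar> > R \<Longrightarrow> line_conv \<sigma> v y z = 0"
  by (simp add: line_conv_def ahat_outside)

lemma ahat_line_measurable: "(\<lambda>l. ahat y (z - Complex l \<sigma>)) \<in> borel_measurable borel"
  by (intro borel_measurable_continuous_onI continuous_on_compose2[OF ahat_continuous[of UNIV]])
     (auto simp: Complex_eq intro!: continuous_intros)

lemma line_conv_pointwise:
  assumes bd: "cmod c \<le> (1 + \<bar>Re z - l\<bar>) * Q"
  shows "cmod (ahat y (z - Complex l \<sigma>) * c) \<le> (16 * T * M * exp (T * \<bar>Im z - \<sigma>\<bar>) * Q) * decay (Re z - l)"
proof -
  define s where "s = Re z - l"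
  have Q: "Q \<ge> 0" using order_trans[OF norm_ge_zero bd] zero_le_mult_iff[of "1 + \<bar>Re z - l\<bar>" Q] by linarith
  have "cmod (ahat y (z - Complex l \<sigma>) * c) \<le> (8 * T * M * exp (T * \<bar>Im z - \<sigma>\<bar>) * (decay s)\<^sup>2) * ((1 + \<bar>s\<bar>) * Q)"
    unfolding norm_mult using ahat_bound[of y "z - Complex l \<sigma>"] bd
    by (intro mult_mono) (auto simp: s_def T[THEN less_imp_le] M)
  also have "\<dots> = (8 * T * M * exp (T * \<bar>Im z - \<sigma>\<bar>) * Q) * ((1 + \<bar>s\<bar>) * (decay s)\<^sup>2)"
    by (simp add: mult_ac)
  also have "\<dots> \<le> (8 * T * M * exp (T * \<bar>Im z - \<sigma>\<bar>) * Q) * (2 * decay s)"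
    using T M Q by (intro mult_left_mono decay_square_weight_le) auto
  finally show ?thesis by (simp add: s_def mult_ac)
qed

lemma line_conv_integrable:
  assumes v: "v \<in> borel_measurable borel" and bd: "\<And>l. cmod (v l) \<le> (1 + \<bar>Re z - l\<bar>) * Q"
  shows "integrable lborel (\<lambda>l. ahat y (z - Complex l \<sigma>) * v l)"
proof (rule Bochner_Integration.integrable_bound)
  show "integrable lborel (\<lambda>l. (16 * T * M * exp (T * \<bar>Im z - \<sigma>\<bar>) * Q) * decay (Re z - l))"
    by (intro integrable_mult_right integrable_decay_reflect)
  show "(\<lambda>l. ahat y (z - Complex l \<sigma>) * v l) \<in> borel_measurable lborel"
    using v ahat_line_measurable by simp
  show "AE l in lborel. cmod (ahat y (z - Complex l \<sigma>) * v l) \<le> norm ((16 * T * M * exp (T * \<bar>Im z - \<sigma>\<bar>) * Q) * decay (Re z - l))"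
    using line_conv_pointwise[OF bd] by (intro AE_I2) (auto intro: order_trans[OF _ abs_ge_self])
qed

text \<open>
  The growth \<open>1 + \<bar>Re z - l\<bar>\<close> is what a weight can lose between the points \<open>z\<close> and \<open>l + \<i>\<sigma>\<close>; the plain
  and the weighted estimate are both instances.
\<close>

lemma line_conv_bound:
  assumes v: "v \<in> borel_measurable borel" and bd: "\<And>l. cmod (v l) \<le> (1 + \<bar>Re z - l\<bar>) * Q"
  shows "cmod (line_conv \<sigma> v y z) \<le> B * exp (T * \<bar>Im z - \<sigma>\<bar>) * Q"
proof -
  have Q: "Q \<ge> 0" using order_trans[OF norm_ge_zero bd[of 0]] zero_le_mult_iff[of "1 + \<bar>Re z - 0\<bar>" Q] by linarith
  have "cmod (\<integral>l. ahat y (z - Complex l \<sigma>) * v l \<partial>lborel) \<le> (\<integral>l. (16 * T * M * exp (T * \<bar>Im z - \<sigma>\<bar>) * Q) * decay (Re z - l) \<partial>lborel)"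
    using line_conv_integrable[OF v bd] line_conv_pointwise[OF bd]
    by (intro Bochner_Integration.integral_norm_bound_integral integrable_mult_right integrable_decay_reflect)
  also have "\<dots> = 2 * (B * exp (T * \<bar>Im z - \<sigma>\<bar>) * Q)"
    by (simp add: integral_decay_reflect B_def mult_ac)
  finally have "cmod (line_conv \<sigma> v y z) \<le> (B * exp (T * \<bar>Im z - \<sigma>\<bar>) * Q) / pi"
    unfolding line_conv_def norm_mult by (simp add: norm_divide norm_mult field_simps)
  also have "\<dots> \<le> (B * exp (T * \<bar>Im z - \<sigma>\<bar>) * Q) / 1"
    using B_nonneg Q pi_gt3 by (intro divide_left_mono) auto
  finally show ?thesis by simp
qed

text \<open>
  The triangle inequality for \<open>z + \<i>\<close>, multiplied out with \<open>\<bar>l + \<i>\<sigma> + \<i>\<bar> \<ge> 1\<close>.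
\<close>

lemma line_weight_le:
  assumes \<sigma>: "\<sigma> \<ge> 0" and z: "Im z \<ge> 0"
  shows "1 / cmod (Complex l \<sigma> + \<i>) \<le> (1 + \<bar>Re z - l\<bar>) * ((1 + \<bar>Im z - \<sigma>\<bar>) / cmod (z + \<i>))"
proof -
  let ?w = "Complex l \<sigma> + \<i>" and ?s = "\<bar>Re z - l\<bar>" and ?d = "\<bar>Im z - \<sigma>\<bar>"
  have w: "cmod ?w \<ge> 1" using abs_Im_le_cmod[of ?w] \<sigma> by simp
  have zi: "cmod (z + \<i>) \<ge> 1" using abs_Im_le_cmod[of "z + \<i>"] z by simp
  have "z + \<i> = ?w + (z - Complex l \<sigma>)" by simp
  then have "cmod (z + \<i>) \<le> cmod ?w + cmod (z - Complex l \<sigma>)"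
    by (metis norm_triangle_ineq)
  also have "\<dots> \<le> cmod ?w + (?s + ?d)"
    using cmod_le[of "z - Complex l \<sigma>"] by simp
  also have "\<dots> \<le> cmod ?w + cmod ?w * (?s + ?d)"
    using mult_right_mono[OF w, of "?s + ?d"] by simp
  also have "\<dots> \<le> cmod ?w * ((1 + ?s) * (1 + ?d))"
    using w by (simp add: algebra_simps)
  finally have "cmod (z + \<i>) / (cmod ?w * cmod (z + \<i>)) \<le> cmod ?w * ((1 + ?s) * (1 + ?d)) / (cmod ?w * cmod (z + \<i>))"
    by (intro divide_right_mono) auto
  moreover have "cmod ?w \<noteq> 0" "cmod (z + \<i>) \<noteq> 0" using w zi by linarith+
  ultimately show ?thesis by simp
qed

lemma line_conv_weighted_bound:
  assumes v: "v \<in> borel_measurable borel" and bd: "\<And>l. cmod (v l) \<le> N / cmod (Complex l \<sigma> + \<i>)"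
    and \<sigma>: "\<sigma> \<ge> 0" and z: "Im z \<ge> 0"
  shows "cmod (line_conv \<sigma> v y z) \<le> B * exp (T * \<bar>Im z - \<sigma>\<bar>) * (1 + \<bar>Im z - \<sigma>\<bar>) * N / cmod (z + \<i>)"
proof -
  have N: "N \<ge> 0"
  proof -
    have "cmod (Complex 0 \<sigma> + \<i>) > 0" using \<sigma> by (simp add: complex_eq_iff)
    then show ?thesis using order_trans[OF norm_ge_zero bd[of 0]] by (simp add: zero_le_divide_iff)
  qed
  have "cmod (v l) \<le> (1 + \<bar>Re z - l\<bar>) * ((1 + \<bar>Im z - \<sigma>\<bar>) / cmod (z + \<i>) * N)" for l
    using order_trans[OF bd[of l]] mult_right_mono[OF line_weight_le[OF \<sigma> z, of l] N] by (simp add: mult_ac)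
  from line_conv_bound[OF v this, of \<sigma> y] show ?thesis by (simp add: mult_ac)
qed

lemma line_conv_uniform_bound:
  assumes v: "v \<in> borel_measurable borel" and bd: "\<And>l. cmod (v l) \<le> N"
  shows "cmod (line_conv \<sigma> v y z) \<le> B * exp (T * \<bar>Im z - \<sigma>\<bar>) * N"
proof (rule line_conv_bound[OF v])
  fix l
  have "N \<ge> 0" using order_trans[OF norm_ge_zero bd] .
  then have "N \<le> (1 + \<bar>Re z - l\<bar>) * N" by (simp add: distrib_right)
  then show "cmod (v l) \<le> (1 + \<bar>Re z - l\<bar>) * N" using bd[of l] by linarith
qed

lemma line_conv_measurable:
  assumes "(\<lambda>(y, l). v y l) \<in> borel_measurable (lebesgue \<Otimes>\<^sub>M lborel)"
  shows "(\<lambda>y. line_conv \<sigma> (v y) y z) \<in> borel_measurable lebesgue"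
proof -
  have "(\<lambda>(y, l). ahat y (z - Complex l \<sigma>)) \<in> borel_measurable (lebesgue \<Otimes>\<^sub>M lborel)"
    by (intro Caratheodory_measurable ahat_measurable continuous_on_compose2[OF ahat_continuous[of UNIV]])
       (auto simp: Complex_eq intro!: continuous_intros)
  then have "(\<lambda>(y, l). ahat y (z - Complex l \<sigma>) * v y l) \<in> borel_measurable (lebesgue \<Otimes>\<^sub>M lborel)"
    using borel_measurable_times[OF _ assms] by (simp add: case_prod_unfold)
  from lborel.borel_measurable_lebesgue_integral[OF this]
  show ?thesis unfolding line_conv_def by (intro borel_measurable_times borel_measurable_const)
qed

lemma line_conv_holomorphic:
  assumes v: "v \<in> borel_measurable borel" and bd: "\<And>l. cmod (v l) \<le> N"
  shows "line_conv \<sigma> v y holomorphic_on UNIV"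
proof -
  have N: "N \<ge> 0" using order_trans[OF norm_ge_zero bd] .
  have "(\<lambda>z. \<integral>l. ahat y (z - Complex l \<sigma>) * v l \<partial>lborel) holomorphic_on UNIV"
  proof (rule holomorphic_on_integral)
    show "(\<lambda>l. ahat y (z - Complex l \<sigma>) * v l) \<in> borel_measurable lborel" for z
      using v ahat_line_measurable by simp
    show "(\<lambda>z. ahat y (z - Complex l \<sigma>) * v l) holomorphic_on UNIV" for l
      by (intro holomorphic_on_mult holomorphic_on_const
          holomorphic_on_compose_gen[OF _ ahat_holomorphic[of y UNIV], of "\<lambda>z. z - Complex l \<sigma>", unfolded o_def] holomorphic_intros) auto
    fix z :: complex
    define C where "C = 16 * T * M * exp (T * (\<bar>Im z - \<sigma>\<bar> + 1)) * (1 + (\<bar>Re z\<bar> + 1)\<^sup>2) * N"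
    have "cmod (ahat y (w - Complex l \<sigma>) * v l) \<le> C * decay l" if w: "w \<in> cball z 1" for w l
    proof -
      have im: "\<bar>Im w - \<sigma>\<bar> \<le> \<bar>Im z - \<sigma>\<bar> + 1" and re: "\<bar>Re w\<bar> \<le> \<bar>Re z\<bar> + 1"
        using w abs_Im_le_cmod[of "z - w"] abs_Re_le_cmod[of "z - w"] by (simp_all add: dist_norm)
      have "cmod (ahat y (w - Complex l \<sigma>)) \<le> 16 * T * M * exp (T * (\<bar>Im z - \<sigma>\<bar> + 1)) * (1 + (Re w)\<^sup>2) * decay l"
        using ahat_shift_bound[of w "Complex l \<sigma>"] im by simp
      also have "\<dots> \<le> 16 * T * M * exp (T * (\<bar>Im z - \<sigma>\<bar> + 1)) * (1 + (\<bar>Re z\<bar> + 1)\<^sup>2) * decay l"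
        using power_mono[OF re, of 2] T M decay_pos[of l] by (intro mult_right_mono mult_left_mono) auto
      finally have 1: "cmod (ahat y (w - Complex l \<sigma>)) \<le> 16 * T * M * exp (T * (\<bar>Im z - \<sigma>\<bar> + 1)) * (1 + (\<bar>Re z\<bar> + 1)\<^sup>2) * decay l" .
      show ?thesis
        unfolding norm_mult C_def using mult_mono[OF 1 bd[of l] order_trans[OF norm_ge_zero 1]] by (simp add: mult_ac)
    qed
    then show "\<exists>r>0. \<exists>g. cball z r \<subseteq> UNIV \<and> integrable lborel g \<and>
        (\<forall>w\<in>cball z r. \<forall>l\<in>space lborel. cmod (ahat y (w - Complex l \<sigma>) * v l) \<le> g l)"
      by (intro exI[of _ 1] conjI exI[of _ "\<lambda>l. C * decay l"]) (auto intro: integrable_decay)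
  qed auto
  then show ?thesis unfolding line_conv_def[abs_def] by (intro holomorphic_intros)
qed

end

section \<open>The Green function of the Helmholtz operator\<close>

lemma continuous_on_dominated_integral:
  fixes F :: "'p::metric_space \<Rightarrow> 'a \<Rightarrow> complex"
  assumes meas: "\<And>p. F p \<in> borel_measurable M" and cont: "\<And>t. continuous_on S (\<lambda>p. F p t)"
    and g: "integrable M g" and dom: "\<And>p t. p \<in> S \<Longrightarrow> cmod (F p t) \<le> g t"
  shows "continuous_on S (\<lambda>p. \<integral>t. F p t \<partial>M)"
  unfolding continuous_on_sequentially o_def
proof (intro allI ballI impI, elim conjE)
  fix X p assume p: "p \<in> S" and X: "\<forall>n::nat. X n \<in> S" and lim: "X \<longlonglongrightarrow> p"
  show "(\<lambda>n. \<integral>t. F (X n) t \<partial>M) \<longlonglongrightarrow> (\<integral>t. F p t \<partial>M)"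
  proof (rule integral_dominated_convergence[OF meas meas g])
    show "AE t in M. (\<lambda>n. F (X n) t) \<longlonglongrightarrow> F p t"
      using cont p X lim by (intro AE_I2) (auto intro!: continuous_on_tendsto_compose[of S])
    show "AE t in M. cmod (F (X n) t) \<le> g t" for n
      using dom X by (intro AE_I2) auto
  qed
qed

lemma borel_measurable_lebesgue_continuous:
  fixes f :: "real \<Rightarrow> complex"
  assumes "continuous_on UNIV f"
  shows "f \<in> borel_measurable lebesgue"
  using assms by (intro measurable_completion) (auto intro!: borel_measurable_continuous_onI)

text \<open>
  The operator \<open>D\<^sub>x\<^sup>2 - \<omega>\<^sup>2\<close>, as it acts on test functions in the definition of a distributional solution.
\<close>

definition Helmholtz_adjoint :: "complex \<Rightarrow> (real \<Rightarrow> complex) \<Rightarrow> real \<Rightarrow> complex" where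
  "Helmholtz_adjoint \<omega> \<phi> x = - vderiv (vderiv \<phi>) x - \<omega>\<^sup>2 * \<phi> x"

lemma D_x_D_x: "smooth \<phi> \<Longrightarrow> D\<^sub>x (D\<^sub>x \<phi>) x = - vderiv (vderiv \<phi>) x"
proof -
  assume sm: "smooth \<phi>"
  have "((\<lambda>x. vderiv \<phi> x / \<i>) has_vector_derivative vderiv (vderiv \<phi>) x / \<i>) (at x)" for x
    using smooth_has_vderiv[OF smooth_vderiv[OF sm]] by (rule has_vector_derivative_divide)
  then have "vderiv (\<lambda>x. vderiv \<phi> x / \<i>) = (\<lambda>x. vderiv (vderiv \<phi>) x / \<i>)" by (rule vderiv_eqI)
  then show ?thesis by (simp add: D\<^sub>x_def)
qed

lemma smooth_Helmholtz_adjoint: "smooth \<phi> \<Longrightarrow> smooth (Helmholtz_adjoint \<omega> \<phi>)"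
proof -
  assume "smooth \<phi>"
  then have "smooth (\<lambda>x. (- 1) * vderiv (vderiv \<phi>) x - \<omega>\<^sup>2 * \<phi> x)"
    by (intro smooth_diff smooth_mult smooth_const smooth_vderiv)
  then show ?thesis by (simp add: Helmholtz_adjoint_def[abs_def])
qed

lemma Helmholtz_adjoint_support:
  assumes "smooth \<phi>" "\<And>t. \<bar>t\<bar> > K \<Longrightarrow> \<phi> t = 0" "\<bar>x\<bar> > K"
  shows "Helmholtz_adjoint \<omega> \<phi> x = 0"
  using assms vderiv_support[of \<phi> K] vderiv_support[of "vderiv \<phi>" K] smooth_vderiv
  by (simp add: Helmholtz_adjoint_def)

lemma plane_wave_Helmholtz:
  assumes sm: "smooth \<phi>" and \<phi>: "\<And>t. \<bar>t\<bar> > K \<Longrightarrow> \<phi> t = 0" and c: "c\<^sup>2 = - \<omega>\<^sup>2"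
  shows "(\<integral>x. exp (c * of_real x) * Helmholtz_adjoint \<omega> \<phi> x \<partial>lborel) = 0"
proof -
  define e where "e x = exp (c * of_real x)" for x :: real
  have sme: "smooth e" unfolding e_def by (rule smooth_exp)
  have de: "(e has_vector_derivative c * e t) (at t)" for t
    unfolding e_def by (rule has_vector_derivative_exp_of_real)
  define h where "h x = c * e x * \<phi> x - e x * vderiv \<phi> x" for x
  have smh: "smooth h"
    unfolding h_def by (intro smooth_diff smooth_mult smooth_const sme sm smooth_vderiv)
  have "vderiv h = (\<lambda>x. e x * Helmholtz_adjoint \<omega> \<phi> x)"
  proof (rule vderiv_eqI)
    fix x
    have "(h has_vector_derivative ((c * e x) * vderiv \<phi> x + (c * (c * e x)) * \<phi> x)
        - (e x * vderiv (vderiv \<phi>) x + (c * e x) * vderiv \<phi> x)) (at x)"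
      unfolding h_def
      by (intro has_vector_derivative_diff has_vector_derivative_mult has_vector_derivative_mult_right
          smooth_has_vderiv sm smooth_vderiv de)
    moreover have "((c * e x) * vderiv \<phi> x + (c * (c * e x)) * \<phi> x)
        - (e x * vderiv (vderiv \<phi>) x + (c * e x) * vderiv \<phi> x) = e x * (- vderiv (vderiv \<phi>) x + c\<^sup>2 * \<phi> x)"
      by (simp add: algebra_simps power2_eq_square)
    ultimately show "(h has_vector_derivative e x * Helmholtz_adjoint \<omega> \<phi> x) (at x)"
      by (simp add: c Helmholtz_adjoint_def)
  qed
  moreover have "(\<integral>x. vderiv h x \<partial>lborel) = 0"
    by (rule integral_vderiv_compact_support[OF smh, of K]) (simp add: h_def \<phi> vderiv_support[OF sm \<phi>])
  ultimately show ?thesis by (simp add: e_def)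
qed

text \<open>
  The kernel is a fundamental solution.  On either side of \<open>y\<close> the integrand has the primitive
  \<open>(c \<phi> - \<phi>') exp (c (x - y))\<close> with \<open>c = \<plusminus>\<i>\<omega>\<close>; the terms with \<open>\<phi>'\<close> cancel at \<open>y\<close>, those with \<open>\<phi>\<close> add up.
\<close>

lemma Green_kernel_Helmholtz:
  assumes sm: "smooth \<phi>" and \<phi>: "\<And>t. \<bar>t\<bar> > K \<Longrightarrow> \<phi> t = 0" and \<omega>: "\<omega> \<noteq> 0"
  shows "(\<integral>x. exp (\<i> * \<omega> * of_real \<bar>x - y\<bar>) * Helmholtz_adjoint \<omega> \<phi> x \<partial>lborel) = - 2 * \<i> * \<omega> * \<phi> y"
proof -
  define L where "L = \<bar>K\<bar> + \<bar>y\<bar> + 1"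
  have L: "- L \<le> y" "y \<le> L" by (auto simp: L_def)
  have half: "((\<lambda>x. exp (c * of_real (x - y)) * Helmholtz_adjoint \<omega> \<phi> x) has_integral
      ((c * \<phi> q - vderiv \<phi> q) * exp (c * of_real (q - y)) - (c * \<phi> p - vderiv \<phi> p) * exp (c * of_real (p - y)))) {p..q}"
    if c: "c\<^sup>2 = - \<omega>\<^sup>2" and pq: "p \<le> q" for c p q
  proof (rule fundamental_theorem_of_calculus[OF pq])
    fix x
    have e: "((\<lambda>x. exp (c * of_real (x - y))) has_vector_derivative c * exp (c * of_real (x - y))) (at x)" for x
    proof -
      have "((\<lambda>x. exp (- c * of_real y) * exp (c * of_real x)) has_vector_derivative
          exp (- c * of_real y) * (c * exp (c * of_real x))) (at x)"
        by (intro has_vector_derivative_mult_right has_vector_derivative_exp_of_real)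
      moreover have "exp (c * of_real (x - y)) = exp (- c * of_real y) * exp (c * of_real x)" for x
        by (simp add: exp_add[symmetric] algebra_simps)
      ultimately show ?thesis by (simp add: mult_ac)
    qed
    have "((\<lambda>x. (c * \<phi> x - vderiv \<phi> x) * exp (c * of_real (x - y))) has_vector_derivative
        (c * \<phi> x - vderiv \<phi> x) * (c * exp (c * of_real (x - y))) + (c * vderiv \<phi> x - vderiv (vderiv \<phi>) x) * exp (c * of_real (x - y))) (at x)"
      by (intro has_vector_derivative_diff has_vector_derivative_mult has_vector_derivative_mult_right
          smooth_has_vderiv sm smooth_vderiv e)
    moreover have "(c * \<phi> x - vderiv \<phi> x) * (c * E) + (c * vderiv \<phi> x - vderiv (vderiv \<phi>) x) * E
        = E * (- vderiv (vderiv \<phi>) x + c\<^sup>2 * \<phi> x)" for E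
      by (simp add: algebra_simps power2_eq_square)
    ultimately have "((\<lambda>x. (c * \<phi> x - vderiv \<phi> x) * exp (c * of_real (x - y))) has_vector_derivative
        exp (c * of_real (x - y)) * Helmholtz_adjoint \<omega> \<phi> x) (at x)"
      by (simp add: c Helmholtz_adjoint_def)
    then show "((\<lambda>x. (c * \<phi> x - vderiv \<phi> x) * exp (c * of_real (x - y))) has_vector_derivative
        exp (c * of_real (x - y)) * Helmholtz_adjoint \<omega> \<phi> x) (at x within {p..q})"
      by (rule has_vector_derivative_at_within)
  qed
  let ?f = "\<lambda>x. exp (\<i> * \<omega> * of_real \<bar>x - y\<bar>) * Helmholtz_adjoint \<omega> \<phi> x"
  have 0: "\<phi> L = 0" "vderiv \<phi> L = 0" "\<phi> (- L) = 0" "vderiv \<phi> (- L) = 0"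
    using \<phi> vderiv_support[OF sm \<phi>] by (auto simp: L_def)
  have "((\<lambda>x. exp ((\<i> * \<omega>) * of_real (x - y)) * Helmholtz_adjoint \<omega> \<phi> x) has_integral - (\<i> * \<omega> * \<phi> y - vderiv \<phi> y)) {y..L}"
    using half[of "\<i> * \<omega>" y L] L 0 by (simp add: power_mult_distrib)
  then have right: "(?f has_integral - (\<i> * \<omega> * \<phi> y - vderiv \<phi> y)) {y..L}"
    by (rule has_integral_eq[rotated]) simp
  have "((\<lambda>x. exp ((- (\<i> * \<omega>)) * of_real (x - y)) * Helmholtz_adjoint \<omega> \<phi> x) has_integral (- (\<i> * \<omega>) * \<phi> y - vderiv \<phi> y)) {-L..y}"
    using half[of "- (\<i> * \<omega>)" "-L" y] L 0 by (simp add: power_mult_distrib)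
  then have left: "(?f has_integral (- (\<i> * \<omega>) * \<phi> y - vderiv \<phi> y)) {-L..y}"
    by (rule has_integral_eq[rotated]) (simp add: algebra_simps)
  have "(?f has_integral (- 2 * \<i> * \<omega> * \<phi> y)) {-L..L}"
    using has_integral_combine[OF L left right] by (simp add: algebra_simps)
  then have "(?f has_integral (- 2 * \<i> * \<omega> * \<phi> y)) UNIV"
  proof (rule has_integral_on_superset)
    fix x assume "x \<notin> {-L..L}"
    then have "\<bar>x\<bar> > K" unfolding L_def atLeastAtMost_iff by linarith
    then show "?f x = 0" using Helmholtz_adjoint_support[OF sm \<phi>] by simp
  qed simp
  moreover have "integrable lborel ?f"
  proof (rule integrable_continuous_compact_support[of _ K])
    show "continuous_on UNIV ?f"
      by (intro continuous_intros smooth_continuous smooth_Helmholtz_adjoint sm)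
  qed (simp add: Helmholtz_adjoint_support[OF sm \<phi>])
  then have "(?f has_integral (\<integral>x. ?f x \<partial>lborel)) UNIV" by (rule has_integral_integral_lborel)
  ultimately show ?thesis by (rule has_integral_unique[symmetric])
qed

definition Green :: "complex \<Rightarrow> (real \<Rightarrow> complex) \<Rightarrow> real \<Rightarrow> complex" where
  "Green \<omega> S x = \<i> / (2 * \<omega>) * (\<integral>y. exp (\<i> * \<omega> * of_real \<bar>x - y\<bar>) * S y \<partial>lebesgue)"

lemma norm_Green_kernel_le: "\<omega> \<in> Cplus \<Longrightarrow> t \<ge> 0 \<Longrightarrow> cmod (exp (\<i> * \<omega> * of_real t)) \<le> 1"
  unfolding norm_exp_ii_times Cplus_def by simp

lemma norm_Green_integrand_le:
  assumes \<omega>: "\<omega> \<in> Cplus" shows "cmod (exp (\<i> * \<omega> * of_real \<bar>d\<bar>) * c) \<le> cmod c"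
  unfolding norm_mult[of _ c] using mult_right_mono[OF norm_Green_kernel_le[OF \<omega> abs_ge_zero], of "cmod c" d] by simp

lemma Cplus_nonzero: "\<omega> \<in> Cplus \<Longrightarrow> \<omega> \<noteq> 0"
  by (auto simp: Cplus_def)

lemma integrable_exp_abs_mult:
  assumes S: "integrable lebesgue S" and \<omega>: "\<omega> \<in> Cplus"
  shows "integrable lebesgue (\<lambda>y. exp (\<i> * \<omega> * of_real \<bar>x - y\<bar>) * S y)"
proof (rule Bochner_Integration.integrable_bound[OF S])
  show "(\<lambda>y. exp (\<i> * \<omega> * of_real \<bar>x - y\<bar>) * S y) \<in> borel_measurable lebesgue"
    using S by (intro borel_measurable_times borel_measurable_integrable[of lebesgue S] borel_measurable_lebesgue_continuous continuous_intros)
  show "AE y in lebesgue. cmod (exp (\<i> * \<omega> * of_real \<bar>x - y\<bar>) * S y) \<le> cmod (S y)"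
    by (intro AE_I2 norm_Green_integrand_le \<omega>)
qed

lemma Green_continuous:
  assumes S: "integrable lebesgue S" and \<omega>: "\<omega> \<in> Cplus"
  shows "continuous_on UNIV (Green \<omega> S)"
  unfolding Green_def[abs_def]
proof (intro continuous_on_mult continuous_on_const continuous_on_dominated_integral[where g = "\<lambda>y. cmod (S y)"])
  show "(\<lambda>y. exp (\<i> * \<omega> * of_real \<bar>x - y\<bar>) * S y) \<in> borel_measurable lebesgue" for x
    by (intro borel_measurable_integrable integrable_exp_abs_mult assms)
  show "cmod (exp (\<i> * \<omega> * of_real \<bar>x - y\<bar>) * S y) \<le> cmod (S y)" for x y
    by (rule norm_Green_integrand_le[OF \<omega>])
qed (use S in \<open>auto intro!: continuous_intros\<close>)

lemma Green_bound:
  assumes S: "integrable lebesgue S" and \<omega>: "\<omega> \<in> Cplus"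
  shows "cmod (Green \<omega> S x) \<le> (\<integral>y. cmod (S y) \<partial>lebesgue) / (2 * cmod \<omega>)"
proof -
  have "cmod (\<integral>y. exp (\<i> * \<omega> * of_real \<bar>x - y\<bar>) * S y \<partial>lebesgue) \<le> (\<integral>y. cmod (S y) \<partial>lebesgue)"
  proof (rule Bochner_Integration.integral_norm_bound_integral[OF integrable_exp_abs_mult[OF assms]])
    show "cmod (exp (\<i> * \<omega> * of_real \<bar>x - y\<bar>) * S y) \<le> cmod (S y)" for y
      by (rule norm_Green_integrand_le[OF \<omega>])
  qed (use S in auto)
  then show ?thesis
    by (simp add: Green_def norm_mult norm_divide divide_simps)
qed

lemma integrable_bounded_interval:
  fixes S :: "real \<Rightarrow> complex"
  assumes meas: "S \<in> borel_measurable lebesgue" and supp: "\<And>y. \<bar>y\<bar> > R \<Longrightarrow> S y = 0"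
    and bd: "AE y in lebesgue. cmod (S y) \<le> N" and R: "R > 0"
  shows "integrable lebesgue S" and "(\<integral>y. cmod (S y) \<partial>lebesgue) \<le> 2 * R * N"
proof -
  have bd': "AE y in lebesgue. cmod (S y) \<le> N * indicator {-R..R} y"
    using bd by eventually_elim (use supp in \<open>force simp: indicator_def\<close>)
  have ind: "integrable lebesgue (\<lambda>y. N * indicator {-R..R} y)"
    using R by (intro integrable_mult_right integrable_real_indicator) auto
  show int: "integrable lebesgue S"
  proof (rule Bochner_Integration.integrable_bound[OF ind meas])
    show "AE y in lebesgue. cmod (S y) \<le> norm (N * indicator {-R..R} y)"
      using bd' by eventually_elim (auto intro: order_trans[OF _ abs_ge_self])
  qed
  have "(\<integral>y. cmod (S y) \<partial>lebesgue) \<le> (\<integral>y. N * indicator {-R..R} y \<partial>lebesgue)"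
    using int ind bd' by (intro integral_mono_AE) auto
  then show "(\<integral>y. cmod (S y) \<partial>lebesgue) \<le> 2 * R * N" using R by (simp add: mult_ac)
qed

text \<open>
  The factor \<open>R / \<bar>\<omega>\<bar>\<close> is the origin of the contraction on lines of large height.
\<close>

lemma Green_bound_interval:
  assumes S: "integrable lebesgue S" and supp: "\<And>y. \<bar>y\<bar> > R \<Longrightarrow> S y = 0" and R: "R > 0"
    and bd: "\<And>y. \<bar>y\<bar> \<le> R \<Longrightarrow> cmod (S y) \<le> C" and \<omega>: "\<omega> \<in> Cplus"
  shows "cmod (Green \<omega> S x) \<le> R * C / cmod \<omega>"
proof -
  have "cmod (S y) \<le> C" for y
    using bd[of y] supp[of y] order_trans[OF norm_ge_zero bd[of 0]] R by (cases "\<bar>y\<bar> \<le> R") auto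
  then have "(\<integral>y. cmod (S y) \<partial>lebesgue) \<le> 2 * R * C"
    by (intro integrable_bounded_interval(2)[OF borel_measurable_integrable[OF S] supp _ R] AE_I2)
  then have "(\<integral>y. cmod (S y) \<partial>lebesgue) / (2 * cmod \<omega>) \<le> (2 * R * C) / (2 * cmod \<omega>)"
    by (rule divide_right_mono) simp
  then show ?thesis using Green_bound[OF S \<omega>, of x] by simp
qed

lemma Green_right:
  assumes supp: "\<And>y. \<bar>y\<bar> > R \<Longrightarrow> S y = 0" and x: "x > R"
  shows "Green \<omega> S x = \<i> / (2 * \<omega>) * (\<integral>y. exp (- \<i> * \<omega> * of_real y) * S y \<partial>lebesgue) * exp (\<i> * \<omega> * of_real x)"
proof -
  have "(\<lambda>y. exp (\<i> * \<omega> * of_real \<bar>x - y\<bar>) * S y) = (\<lambda>y. (exp (- \<i> * \<omega> * of_real y) * S y) * exp (\<i> * \<omega> * of_real x))"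
  proof
    fix y
    show "exp (\<i> * \<omega> * of_real \<bar>x - y\<bar>) * S y = (exp (- \<i> * \<omega> * of_real y) * S y) * exp (\<i> * \<omega> * of_real x)"
    proof (cases "\<bar>y\<bar> > R")
      case False
      then have "\<bar>x - y\<bar> = x - y" using x by auto
      then have "exp (\<i> * \<omega> * of_real \<bar>x - y\<bar>) = exp (- \<i> * \<omega> * of_real y) * exp (\<i> * \<omega> * of_real x)"
        by (simp add: exp_add[symmetric] algebra_simps)
      then show ?thesis by simp
    qed (simp add: supp)
  qed
  then show ?thesis by (simp add: Green_def)
qed

lemma Green_left:
  assumes supp: "\<And>y. \<bar>y\<bar> > R \<Longrightarrow> S y = 0" and x: "x < - R"
  shows "Green \<omega> S x = \<i> / (2 * \<omega>) * (\<integral>y. exp (\<i> * \<omega> * of_real y) * S y \<partial>lebesgue) * exp (- \<i> * \<omega> * of_real x)"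
proof -
  have "(\<lambda>y. exp (\<i> * \<omega> * of_real \<bar>x - y\<bar>) * S y) = (\<lambda>y. (exp (\<i> * \<omega> * of_real y) * S y) * exp (- \<i> * \<omega> * of_real x))"
  proof
    fix y
    show "exp (\<i> * \<omega> * of_real \<bar>x - y\<bar>) * S y = (exp (\<i> * \<omega> * of_real y) * S y) * exp (- \<i> * \<omega> * of_real x)"
    proof (cases "\<bar>y\<bar> > R")
      case False
      then have "\<bar>x - y\<bar> = y - x" using x by auto
      then have "exp (\<i> * \<omega> * of_real \<bar>x - y\<bar>) = exp (\<i> * \<omega> * of_real y) * exp (- \<i> * \<omega> * of_real x)"
        by (simp add: exp_add[symmetric] algebra_simps)
      then show ?thesis by simp
    qed (simp add: supp)
  qed
  then show ?thesis by (simp add: Green_def)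
qed

text \<open>
  Fubini's theorem reduces the distributional equation \<open>(D\<^sub>x\<^sup>2 - \<omega>\<^sup>2) (Green \<omega> S) = S\<close> to the statement
  about the kernel.
\<close>

lemma Green_distribution:
  assumes S: "integrable lebesgue S" and \<omega>: "\<omega> \<in> Cplus" and \<phi>: "test_function \<phi>"
  shows "has_bochner_integral lebesgue (\<lambda>x. Green \<omega> S x * Helmholtz_adjoint \<omega> \<phi> x) (\<integral>y. S y * \<phi> y \<partial>lebesgue)"
proof -
  have sm: "smooth \<phi>" using \<phi> by (simp add: test_function_def)
  obtain K where K: "\<And>t. \<bar>t\<bar> \<ge> K \<Longrightarrow> \<phi> t = 0" using test_functionE[OF \<phi>] by blast
  then have K': "\<And>t. \<bar>t\<bar> > K \<Longrightarrow> \<phi> t = 0" by simp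
  define h where "h = Helmholtz_adjoint \<omega> \<phi>"
  have hcont: "continuous_on UNIV h" unfolding h_def by (intro smooth_continuous smooth_Helmholtz_adjoint sm)
  have hint: "integrable lborel h"
    using hcont Helmholtz_adjoint_support[OF sm K'] unfolding h_def by (rule integrable_continuous_compact_support) 
  define k where "k x y = exp (\<i> * \<omega> * of_real \<bar>x - y\<bar>)" for x y :: real
  interpret L: sigma_finite_measure "lebesgue :: real measure" by (rule sigma_finite_lebesgue)
  interpret pair_sigma_finite "lborel :: real measure" "lebesgue :: real measure" ..
  have Smeas: "S \<in> borel_measurable lebesgue" using S by simp
  have idm: "(\<lambda>y::real. y) \<in> borel_measurable lebesgue"
    by (rule measurable_completion) simp
  have fstm: "(\<lambda>p. fst p) \<in> borel_measurable ((lborel :: real measure) \<Otimes>\<^sub>M (lebesgue :: real measure))"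
    by (rule measurable_compose[OF measurable_fst]) simp
  have sndm: "(\<lambda>p. snd p) \<in> borel_measurable ((lborel :: real measure) \<Otimes>\<^sub>M (lebesgue :: real measure))"
    by (rule measurable_compose[OF measurable_snd idm])
  have meas: "(\<lambda>(x, y). k x y * S y * h x) \<in> borel_measurable (lborel \<Otimes>\<^sub>M lebesgue)"
    unfolding k_def case_prod_unfold
    by (intro borel_measurable_times measurable_compose[OF measurable_snd Smeas] measurable_compose[OF fstm, of h]
        measurable_compose[OF borel_measurable_abs[OF borel_measurable_diff[OF fstm sndm]], of "\<lambda>d. exp (\<i> * \<omega> * of_real d)"])
       (auto intro!: borel_measurable_continuous_onI continuous_intros hcont)
  have bd: "cmod (k x y * S y * h x) \<le> cmod (S y) * cmod (h x)" for x y
    using norm_Green_integrand_le[OF \<omega>, of "x - y" "S y * h x"] by (simp add: k_def mult.assoc norm_mult)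
  have bigint: "integrable (lborel \<Otimes>\<^sub>M lebesgue) (\<lambda>(x, y). k x y * S y * h x)"
  proof (rule Fubini_integrable[OF meas])
    have inner: "integrable lebesgue (\<lambda>y. k x y * S y * h x)" for x
      unfolding k_def by (intro integrable_mult_left integrable_exp_abs_mult S \<omega>)
    show "AE x in lborel. integrable lebesgue (\<lambda>y. case (x, y) of (x, y) \<Rightarrow> k x y * S y * h x)"
      using inner by simp
    have "integrable lborel (\<lambda>x. (\<integral>y. cmod (S y) \<partial>lebesgue) * cmod (h x))"
      using hint by simp
    then show "integrable lborel (\<lambda>x. \<integral>y. cmod (case (x, y) of (x, y) \<Rightarrow> k x y * S y * h x) \<partial>lebesgue)"
    proof (rule Bochner_Integration.integrable_bound)
      show "(\<lambda>x. \<integral>y. cmod (case (x, y) of (x, y) \<Rightarrow> k x y * S y * h x) \<partial>lebesgue) \<in> borel_measurable lborel"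
        using L.borel_measurable_lebesgue_integral[of "\<lambda>x y. cmod (k x y * S y * h x)" lborel] measurable_compose[OF meas borel_measurable_norm]
        by (simp add: case_prod_unfold)
      show "AE x in lborel. norm (\<integral>y. cmod (case (x, y) of (x, y) \<Rightarrow> k x y * S y * h x) \<partial>lebesgue)
          \<le> norm ((\<integral>y. cmod (S y) \<partial>lebesgue) * cmod (h x))"
      proof (rule AE_I2)
        fix x
        have "(\<integral>y. cmod (k x y * S y * h x) \<partial>lebesgue) \<le> (\<integral>y. cmod (S y) * cmod (h x) \<partial>lebesgue)"
          using inner S bd by (intro integral_mono integrable_norm) auto
        then show "norm (\<integral>y. cmod (case (x, y) of (x, y) \<Rightarrow> k x y * S y * h x) \<partial>lebesgue)
          \<le> norm ((\<integral>y. cmod (S y) \<partial>lebesgue) * cmod (h x))"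
          by (auto intro: order_trans[OF _ abs_ge_self])
      qed
    qed
  qed
  have int: "integrable lborel (\<lambda>x. Green \<omega> S x * h x)"
  proof (rule integrable_continuous_compact_support[of _ K])
    show "continuous_on UNIV (\<lambda>x. Green \<omega> S x * h x)"
      by (intro continuous_intros hcont Green_continuous S \<omega>)
  qed (simp add: h_def Helmholtz_adjoint_support[OF sm K'])
  have "Green \<omega> S x * h x = \<i> / (2 * \<omega>) * (\<integral>y. k x y * S y * h x \<partial>lebesgue)" for x
    unfolding Green_def k_def by (subst integral_mult_left_zero) (simp only: mult.assoc)
  then have "(\<integral>x. Green \<omega> S x * h x \<partial>lborel) = (\<integral>x. \<i> / (2 * \<omega>) * (\<integral>y. k x y * S y * h x \<partial>lebesgue) \<partial>lborel)"
    by (simp only:)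
  also have "\<dots> = \<i> / (2 * \<omega>) * (\<integral>x. (\<integral>y. k x y * S y * h x \<partial>lebesgue) \<partial>lborel)" by simp
  also have "(\<integral>x. (\<integral>y. k x y * S y * h x \<partial>lebesgue) \<partial>lborel) = (\<integral>y. (\<integral>x. k x y * S y * h x \<partial>lborel) \<partial>lebesgue)"
    using Fubini_integral[OF bigint] by simp
  also have "\<dots> = (\<integral>y. S y * (- 2 * \<i> * \<omega> * \<phi> y) \<partial>lebesgue)"
  proof (rule Bochner_Integration.integral_cong[OF refl])
    fix y
    have "(\<integral>x. k x y * S y * h x \<partial>lborel) = (\<integral>x. S y * (k x y * h x) \<partial>lborel)" by (simp add: mult_ac)
    also have "\<dots> = S y * (- 2 * \<i> * \<omega> * \<phi> y)"
      using Green_kernel_Helmholtz[OF sm K' Cplus_nonzero[OF \<omega>], of K y] by (simp add: k_def h_def)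
    finally show "(\<integral>x. k x y * S y * h x \<partial>lborel) = S y * (- 2 * \<i> * \<omega> * \<phi> y)" .
  qed
  also have "\<dots> = (- 2 * \<i> * \<omega>) * (\<integral>y. S y * \<phi> y \<partial>lebesgue)"
    by (subst integral_mult_right_zero[symmetric]) (simp add: mult_ac)
  also have "\<i> / (2 * \<omega>) * \<dots> = (\<integral>y. S y * \<phi> y \<partial>lebesgue)" using Cplus_nonzero[OF \<omega>] by simp
  finally have "(\<integral>x. Green \<omega> S x * h x \<partial>lborel) = (\<integral>y. S y * \<phi> y \<partial>lebesgue)" .
  moreover have "(\<lambda>x. Green \<omega> S x * h x) \<in> borel_measurable lborel" using int by simp
  ultimately show ?thesis using int unfolding h_def[symmetric]
    by (simp add: has_bochner_integral_iff integrable_completion integral_completion)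
qed

section \<open>The integral equation on one horizontal line\<close>

lemma Complex_in_Cplus: "\<sigma> > 0 \<Longrightarrow> Complex l \<sigma> \<in> Cplus"
  by (simp add: Cplus_def)

lemma continuous_Complex: "continuous_on S f \<Longrightarrow> continuous_on S g \<Longrightarrow> continuous_on S (\<lambda>x. Complex (f x) (g x))"
  by (simp add: Complex_eq continuous_intros)

context coefficient
begin

text \<open>
  The height of the line on which the equation is solved.  It makes the contraction factor at most
  \<open>1/2\<close>, and it is at least \<open>2\<close> so that discs of radius one around points of the line lie in the
  half-plane.
\<close>

definition s\<^sub>0 :: real where
  "s\<^sub>0 = 2 + 2 * R * B"

lemma s\<^sub>0_ge: "s\<^sub>0 \<ge> 2"
  using R B_nonneg by (simp add: s\<^sub>0_def)

lemma contraction_factor: "\<sigma> \<ge> s\<^sub>0 \<Longrightarrow> R * B / \<sigma> \<le> 1 / 2"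
proof -
  assume \<sigma>: "\<sigma> \<ge> s\<^sub>0"
  have "R * B \<le> s\<^sub>0 / 2" by (simp add: s\<^sub>0_def)
  then show ?thesis using \<sigma> s\<^sub>0_ge by (simp add: divide_le_eq)
qed

text \<open>
  In the time variable this multiplier subtracts from a function its average over the past with
  weight \<open>\<gamma> exp (-\<gamma>t)\<close>.
\<close>

definition memory :: "complex \<Rightarrow> complex" where
  "memory \<omega> = \<omega> / (\<omega> + \<i> * of_real \<gamma>)"

lemma norm_memory_le: "\<omega> \<in> Cplus \<Longrightarrow> cmod (memory \<omega>) \<le> 1"
proof -
  assume \<omega>: "\<omega> \<in> Cplus"
  then have "(cmod \<omega>)\<^sup>2 \<le> (cmod (\<omega> + \<i> * of_real \<gamma>))\<^sup>2"
    using \<gamma> by (simp add: cmod_power2 Cplus_def power_mono)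
  then have "cmod \<omega> \<le> cmod (\<omega> + \<i> * of_real \<gamma>)" by (rule power2_le_imp_le) simp
  then show ?thesis by (simp add: memory_def norm_divide divide_le_eq_1)
qed

lemma memory_holomorphic: "memory holomorphic_on Cplus"
proof -
  have "\<omega> + \<i> * of_real \<gamma> \<noteq> 0" if "\<omega> \<in> Cplus" for \<omega>
    using that \<gamma> by (auto simp: Cplus_def complex_eq_iff)
  then show ?thesis unfolding memory_def[abs_def] by (intro holomorphic_intros)
qed

lemma line_in_Cplus: "Complex l s\<^sub>0 \<in> Cplus"
  using s\<^sub>0_ge by (simp add: Cplus_def)

lemma norm_plus_ii_ge_1: "Im z \<ge> 0 \<Longrightarrow> cmod (z + \<i>) \<ge> 1"
  using abs_Im_le_cmod[of "z + \<i>"] by simp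

text \<open>
  The unknown on the line is \<open>U(x, l) = (\<omega> + \<i>) u(x, \<omega>)\<close> with \<open>\<omega> = l + \<i>s\<^sub>0\<close>, so that the weighted norm of
  \<open>u\<close> becomes the supremum norm of \<open>U\<close>; dividing by \<open>\<omega> + \<i>\<close> recovers \<open>u\<close>.
\<close>

definition line_density :: "(real \<Rightarrow> complex) \<Rightarrow> real \<Rightarrow> complex" where
  "line_density U l = memory (Complex l s\<^sub>0) * (U l / (Complex l s\<^sub>0 + \<i>))"

definition source :: "(real \<times> real \<Rightarrow> complex) \<Rightarrow> real \<Rightarrow> complex \<Rightarrow> complex" where
  "source U y z = line_conv s\<^sub>0 (line_density (\<lambda>l. U (y, l))) y z"

lemma line_density_continuous:
  assumes "continuous_on S U" shows "continuous_on S (line_density U)"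
proof -
  have "Complex l s\<^sub>0 + \<i> \<noteq> 0" for l using s\<^sub>0_ge by (simp add: complex_eq_iff)
  moreover have "continuous_on S (\<lambda>l. memory (Complex l s\<^sub>0))"
    using line_in_Cplus
    by (intro continuous_on_compose2[OF holomorphic_on_imp_continuous_on[OF memory_holomorphic]] continuous_Complex continuous_intros) auto
  ultimately show ?thesis
    unfolding line_density_def[abs_def] by (intro continuous_intros continuous_Complex assms) auto
qed

lemma line_density_weighted_bound: "cmod (U l) \<le> N \<Longrightarrow> cmod (line_density U l) \<le> N / cmod (Complex l s\<^sub>0 + \<i>)"
  using mult_mono[OF norm_memory_le[OF line_in_Cplus[of l]] divide_right_mono[of "cmod (U l)" N "cmod (Complex l s\<^sub>0 + \<i>)"]]
  by (simp add: line_density_def norm_mult norm_divide)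

lemma line_density_bound: "cmod (U l) \<le> N \<Longrightarrow> cmod (line_density U l) \<le> N"
proof -
  assume U: "cmod (U l) \<le> N"
  then have N: "N \<ge> 0" using order_trans[OF norm_ge_zero] by blast
  have "cmod (line_density U l) \<le> N / cmod (Complex l s\<^sub>0 + \<i>)" using U by (rule line_density_weighted_bound)
  also have "\<dots> \<le> N / 1"
    using N norm_plus_ii_ge_1[of "Complex l s\<^sub>0"] s\<^sub>0_ge by (intro divide_left_mono) auto
  finally show ?thesis by simp
qed

context
  fixes U :: "real \<times> real \<Rightarrow> complex" and N :: real
  assumes U: "continuous_on UNIV U" and N: "\<And>p. cmod (U p) \<le> N"
begin

lemma N_nonneg: "N \<ge> 0" using order_trans[OF norm_ge_zero N] .

lemma slice_continuous: "continuous_on S (line_density (\<lambda>l. U (y, l)))"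
  by (intro line_density_continuous continuous_on_compose2[OF U] continuous_intros) auto

lemma slice_measurable: "line_density (\<lambda>l. U (y, l)) \<in> borel_measurable borel"
  by (intro borel_measurable_continuous_onI slice_continuous)

lemma source_outside: "\<bar>y\<bar> > R \<Longrightarrow> source U y z = 0"
  by (simp add: source_def line_conv_outside)

lemma source_weighted_bound:
  assumes "Im z \<ge> 0"
  shows "cmod (source U y z) \<le> B * exp (T * \<bar>Im z - s\<^sub>0\<bar>) * (1 + \<bar>Im z - s\<^sub>0\<bar>) * N / cmod (z + \<i>)"
  unfolding source_def
  by (rule line_conv_weighted_bound[OF slice_measurable line_density_weighted_bound[OF N]]) (use assms s\<^sub>0_ge in auto)

lemma source_bound: "cmod (source U y z) \<le> B * exp (T * \<bar>Im z - s\<^sub>0\<bar>) * N"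
  unfolding source_def by (rule line_conv_uniform_bound[OF slice_measurable line_density_bound[OF N]])

lemma source_holomorphic: "source U y holomorphic_on S"
proof -
  have "source U y = line_conv s\<^sub>0 (line_density (\<lambda>l. U (y, l))) y" by (simp add: source_def fun_eq_iff)
  then show ?thesis
    using line_conv_holomorphic[OF slice_measurable line_density_bound[OF N], of s\<^sub>0 y y]
    by (auto intro: holomorphic_on_subset)
qed

lemma source_continuous: "continuous_on S (source U y)"
  by (intro holomorphic_on_imp_continuous_on source_holomorphic)

lemma source_measurable: "(\<lambda>y. source U y z) \<in> borel_measurable lebesgue"
proof -
  have "(\<lambda>(y, l). line_density (\<lambda>l. U (y, l)) l) \<in> borel_measurable (lebesgue \<Otimes>\<^sub>M lborel)"
  proof (rule Caratheodory_measurable)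
    fix l
    have "continuous_on UNIV (\<lambda>y. memory (Complex l s\<^sub>0) * (U (y, l) / (Complex l s\<^sub>0 + \<i>)))"
      using s\<^sub>0_ge by (intro continuous_intros continuous_on_compose2[OF U]) (auto simp: complex_eq_iff)
    then show "(\<lambda>y. line_density (\<lambda>l. U (y, l)) l) \<in> borel_measurable lebesgue"
      unfolding line_density_def by (rule borel_measurable_lebesgue_continuous)
  qed (rule slice_continuous)
  from line_conv_measurable[OF this] show ?thesis unfolding source_def .
qed

lemma source_integrable: "integrable lebesgue (\<lambda>y. source U y z)"
  using source_bound by (intro integrable_bounded_interval(1)[OF source_measurable source_outside _ R] AE_I2)

text \<open>
  Applied with \<open>k(y) = \<bar>x - y\<bar>\<close> for the solution and with \<open>k(y) = \<plusminus>y\<close> for the reflected and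
  transmitted coefficients.
\<close>

lemma source_integral_holomorphic:
  assumes k: "continuous_on UNIV k"
  shows "(\<lambda>\<omega>. \<integral>y. exp (\<i> * \<omega> * of_real (k y)) * source U y \<omega> \<partial>lebesgue) holomorphic_on S"
proof -
  have "(\<lambda>\<omega>. \<integral>y. exp (\<i> * \<omega> * of_real (k y)) * source U y \<omega> \<partial>lebesgue) holomorphic_on UNIV"
  proof (rule holomorphic_on_integral)
    show "(\<lambda>y. exp (\<i> * z * of_real (k y)) * source U y z) \<in> borel_measurable lebesgue" for z
      using k by (intro borel_measurable_times source_measurable borel_measurable_lebesgue_continuous continuous_intros) auto
    show "(\<lambda>z. exp (\<i> * z * of_real (k y)) * source U y z) holomorphic_on UNIV" for y
      by (intro holomorphic_intros source_holomorphic)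
    fix z :: complex
    have "compact (k ` {-R..R})" using k by (intro compact_continuous_image) (auto intro: continuous_on_subset)
    then obtain K where "\<forall>y\<in>{-R..R}. \<bar>k y\<bar> \<le> K"
      using compact_imp_bounded[of "k ` {-R..R}"] unfolding bounded_iff by auto
    then have K: "\<And>y. y \<in> {-R..R} \<Longrightarrow> \<bar>k y\<bar> \<le> K" by blast
    have K0: "K \<ge> 0" using K[of 0] R by auto
    define C where "C = exp ((cmod z + 1) * K) * (B * exp (T * (\<bar>Im z - s\<^sub>0\<bar> + 1)) * N)"
    have "cmod (exp (\<i> * w * of_real (k y)) * source U y w) \<le> C * indicator {-R..R} y" if w: "w \<in> cball z 1" for w y
    proof (cases "y \<in> {-R..R}")
      case True
      have im: "\<bar>Im w - s\<^sub>0\<bar> \<le> \<bar>Im z - s\<^sub>0\<bar> + 1" using w abs_Im_le_cmod[of "z - w"] by (simp add: dist_norm)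
      have nw: "cmod w \<le> cmod z + 1" using w norm_triangle_ineq3[of z w] by (simp add: dist_norm)
      have "cmod (exp (\<i> * w * of_real (k y))) \<le> exp (cmod (\<i> * w * of_real (k y)))" by (rule norm_exp)
      also have "\<dots> \<le> exp ((cmod z + 1) * K)"
        using nw K[OF True] by (simp add: norm_mult) (intro mult_mono; simp)
      finally have 1: "cmod (exp (\<i> * w * of_real (k y))) \<le> exp ((cmod z + 1) * K)" .
      have "cmod (source U y w) \<le> B * exp (T * \<bar>Im w - s\<^sub>0\<bar>) * N" by (rule source_bound)
      also have "\<dots> \<le> B * exp (T * (\<bar>Im z - s\<^sub>0\<bar> + 1)) * N"
        using im T B_nonneg N_nonneg by (intro mult_right_mono mult_left_mono) auto
      finally show ?thesis using True 1 unfolding C_def norm_mult by (simp add: mult_mono)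
    qed (use source_outside in auto)
    moreover have "integrable lebesgue (\<lambda>y. C * indicator {-R..R} y)"
      using R by (intro integrable_mult_right integrable_real_indicator) auto
    ultimately show "\<exists>r>0. \<exists>g. cball z r \<subseteq> UNIV \<and> integrable lebesgue g \<and>
        (\<forall>w\<in>cball z r. \<forall>y\<in>space lebesgue. cmod (exp (\<i> * w * of_real (k y)) * source U y w) \<le> g y)"
      by (intro exI[of _ 1] conjI exI[of _ "\<lambda>y. C * indicator {-R..R} y"]) auto
  qed auto
  then show ?thesis by (rule holomorphic_on_subset) (rule subset_UNIV)
qed

lemma line_Green_continuous:
  "continuous_on UNIV (\<lambda>(x, l). (Complex l s\<^sub>0 + \<i>) * Green (Complex l s\<^sub>0) (\<lambda>y. source U y (Complex l s\<^sub>0)) x)"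
proof -
  have "continuous_on UNIV (\<lambda>p. \<integral>y. exp (\<i> * Complex (snd p) s\<^sub>0 * of_real \<bar>fst p - y\<bar>) * source U y (Complex (snd p) s\<^sub>0) \<partial>lebesgue)"
  proof (rule continuous_on_dominated_integral)
    show "(\<lambda>y. exp (\<i> * Complex (snd p) s\<^sub>0 * of_real \<bar>fst p - y\<bar>) * source U y (Complex (snd p) s\<^sub>0)) \<in> borel_measurable lebesgue" for p :: "real \<times> real"
      by (intro borel_measurable_times source_measurable borel_measurable_lebesgue_continuous continuous_intros)
    show "continuous_on UNIV (\<lambda>p. exp (\<i> * Complex (snd p) s\<^sub>0 * of_real \<bar>fst p - y\<bar>) * source U y (Complex (snd p) s\<^sub>0))" for y
      by (intro continuous_intros continuous_Complex continuous_on_compose2[OF source_continuous[of UNIV]]) auto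
    show "integrable lebesgue (\<lambda>y. (B * N) * indicator {-R..R} y)"
      using R by (intro integrable_mult_right integrable_real_indicator) auto
    show "cmod (exp (\<i> * Complex (snd p) s\<^sub>0 * of_real \<bar>fst p - y\<bar>) * source U y (Complex (snd p) s\<^sub>0)) \<le> (B * N) * indicator {-R..R} y" for p :: "real \<times> real" and y
    proof (cases "y \<in> {-R..R}")
      case True
      then show ?thesis
        using order_trans[OF norm_Green_integrand_le[OF line_in_Cplus] source_bound[of y "Complex (snd p) s\<^sub>0"]] by simp
    qed (use source_outside in auto)
  qed
  then show ?thesis
    unfolding Green_def case_prod_unfold using s\<^sub>0_ge
    by (intro continuous_intros continuous_Complex) (simp_all add: complex_eq_iff)
qed

lemma line_Green_bound:
  "cmod ((Complex l s\<^sub>0 + \<i>) * Green (Complex l s\<^sub>0) (\<lambda>y. source U y (Complex l s\<^sub>0)) x) \<le> N / 2"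
proof -
  let ?\<omega> = "Complex l s\<^sub>0"
  have \<omega>i: "cmod (?\<omega> + \<i>) \<noteq> 0" using s\<^sub>0_ge by (simp add: complex_eq_iff)
  have \<omega>: "cmod ?\<omega> \<ge> s\<^sub>0" using abs_Im_le_cmod[of ?\<omega>] s\<^sub>0_ge by simp
  have "cmod (Green ?\<omega> (\<lambda>y. source U y ?\<omega>) x) \<le> R * (B * N / cmod (?\<omega> + \<i>)) / cmod ?\<omega>"
    using source_weighted_bound[of ?\<omega>] s\<^sub>0_ge
    by (intro Green_bound_interval[OF source_integrable source_outside R _ line_in_Cplus]) auto
  then have "cmod (?\<omega> + \<i>) * cmod (Green ?\<omega> (\<lambda>y. source U y ?\<omega>) x) \<le> cmod (?\<omega> + \<i>) * (R * (B * N / cmod (?\<omega> + \<i>)) / cmod ?\<omega>)"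
    by (rule mult_left_mono) simp
  also have "\<dots> = R * B / cmod ?\<omega> * N" using \<omega>i by simp
  also have "\<dots> \<le> 1 / 2 * N" by (intro mult_right_mono contraction_factor \<omega> N_nonneg)
  finally show ?thesis by (simp add: norm_mult)
qed

end

lemma source_linear:
  assumes U: "continuous_on UNIV U" "\<And>p. cmod (U p) \<le> N" and V: "continuous_on UNIV V" "\<And>p. cmod (V p) \<le> N'"
  shows "source (\<lambda>p. c * U p + d * V p) y z = c * source U y z + d * source V y z"
proof -
  have int: "integrable lborel (\<lambda>l. ahat y (z - Complex l s\<^sub>0) * line_density (\<lambda>l. W (y, l)) l)"
    if W: "continuous_on UNIV W" "\<And>p. cmod (W p) \<le> K" for W :: "real \<times> real \<Rightarrow> complex" and K
  proof (rule line_conv_integrable[OF slice_measurable[OF W]])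
    fix l
    have "cmod (line_density (\<lambda>l. W (y, l)) l) \<le> K" by (rule line_density_bound) (rule W)
    also have "K \<le> (1 + \<bar>Re z - l\<bar>) * K" using N_nonneg[OF W] by (simp add: distrib_right)
    finally show "cmod (line_density (\<lambda>l. W (y, l)) l) \<le> (1 + \<bar>Re z - l\<bar>) * K" .
  qed
  have "ahat y (z - Complex l s\<^sub>0) * line_density (\<lambda>l. c * U (y, l) + d * V (y, l)) l
      = c * (ahat y (z - Complex l s\<^sub>0) * line_density (\<lambda>l. U (y, l)) l) + d * (ahat y (z - Complex l s\<^sub>0) * line_density (\<lambda>l. V (y, l)) l)" for l
    by (simp add: line_density_def algebra_simps add_divide_distrib)
  then show ?thesis
    unfolding source_def line_conv_def using int[OF U] int[OF V] by (simp add: algebra_simps)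
qed

lemma Green_linear:
  assumes "integrable lebesgue S" "integrable lebesgue S'" "\<omega> \<in> Cplus"
  shows "Green \<omega> (\<lambda>y. c * S y + d * S' y) x = c * Green \<omega> S x + d * Green \<omega> S' x"
proof -
  have "(\<integral>y. exp (\<i> * \<omega> * of_real \<bar>x - y\<bar>) * (c * S y + d * S' y) \<partial>lebesgue)
      = (\<integral>y. c * (exp (\<i> * \<omega> * of_real \<bar>x - y\<bar>) * S y) + d * (exp (\<i> * \<omega> * of_real \<bar>x - y\<bar>) * S' y) \<partial>lebesgue)"
    by (simp add: algebra_simps)
  also have "\<dots> = c * (\<integral>y. exp (\<i> * \<omega> * of_real \<bar>x - y\<bar>) * S y \<partial>lebesgue) + d * (\<integral>y. exp (\<i> * \<omega> * of_real \<bar>x - y\<bar>) * S' y \<partial>lebesgue)"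
    using integrable_exp_abs_mult[OF assms(1,3)] integrable_exp_abs_mult[OF assms(2,3)] by simp
  finally show ?thesis by (simp add: Green_def algebra_simps)
qed

text \<open>
  The map \<open>u \<mapsto> Green (A u)\<close> on the line of height \<open>s\<^sub>0\<close>, acting on the weighted unknown in the Banach
  space of bounded continuous functions.
\<close>

definition line_op :: "((real \<times> real) \<Rightarrow>\<^sub>C complex) \<Rightarrow> ((real \<times> real) \<Rightarrow>\<^sub>C complex)" where
  "line_op U = Bcontfun (\<lambda>(x, l). (Complex l s\<^sub>0 + \<i>) * Green (Complex l s\<^sub>0) (\<lambda>y. source (apply_bcontfun U) y (Complex l s\<^sub>0)) x)"

lemma apply_line_op:
  "apply_bcontfun (line_op U) (x, l) = (Complex l s\<^sub>0 + \<i>) * Green (Complex l s\<^sub>0) (\<lambda>y. source (apply_bcontfun U) y (Complex l s\<^sub>0)) x"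
proof -
  have "(\<lambda>(x, l). (Complex l s\<^sub>0 + \<i>) * Green (Complex l s\<^sub>0) (\<lambda>y. source (apply_bcontfun U) y (Complex l s\<^sub>0)) x) \<in> bcontfun"
    using line_Green_continuous[of "apply_bcontfun U" "norm U"] line_Green_bound[of "apply_bcontfun U" "norm U"]
    by (intro bcontfun_normI[where b = "norm U / 2"]) (auto simp: norm_bounded)
  then show ?thesis by (simp add: line_op_def Bcontfun_inverse)
qed

lemma norm_line_op_le: "norm (line_op U) \<le> norm U / 2"
proof (rule norm_bound)
  fix p
  show "cmod (apply_bcontfun (line_op U) p) \<le> norm U / 2"
    using line_Green_bound[of "apply_bcontfun U" "norm U"] by (cases p) (simp add: apply_line_op norm_bounded)
qed

lemma line_op_linear:
  assumes "\<And>p. apply_bcontfun W p = c * apply_bcontfun U p + d * apply_bcontfun V p"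
  shows "apply_bcontfun (line_op W) p = c * apply_bcontfun (line_op U) p + d * apply_bcontfun (line_op V) p"
proof -
  obtain x l where p: "p = (x, l)" by (cases p)
  have W: "apply_bcontfun W = (\<lambda>p. c * apply_bcontfun U p + d * apply_bcontfun V p)" using assms by auto
  have "source (apply_bcontfun W) y z = c * source (apply_bcontfun U) y z + d * source (apply_bcontfun V) y z" for y z
    unfolding W by (rule source_linear) (auto intro: norm_bounded)
  moreover have "integrable lebesgue (\<lambda>y. source (apply_bcontfun U') y z)" for U' :: "(real \<times> real) \<Rightarrow>\<^sub>C complex" and z
    by (rule source_integrable[of _ "norm U'"]) (auto intro: norm_bounded)
  ultimately show ?thesis by (simp add: p apply_line_op Green_linear[OF _ _ line_in_Cplus] algebra_simps)
qed

lemma line_equation_ex1: "\<exists>!U. F - line_op U = U"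
proof (rule banach_fix_type[where c = "1 / 2"])
  show "\<forall>U V. dist (F - line_op U) (F - line_op V) \<le> 1 / 2 * dist U V"
  proof (intro allI)
    fix U V
    have "line_op (V - U) = line_op V - line_op U"
      using line_op_linear[of "V - U" 1 V "- 1" U] by (intro bcontfun_eqI) simp
    then have "dist (F - line_op U) (F - line_op V) = norm (line_op (V - U))" by (simp add: dist_norm)
    also have "\<dots> \<le> norm (V - U) / 2" by (rule norm_line_op_le)
    finally show "dist (F - line_op U) (F - line_op V) \<le> 1 / 2 * dist U V"
      by (simp add: dist_norm norm_minus_commute)
  qed
qed auto

definition line_sol :: "((real \<times> real) \<Rightarrow>\<^sub>C complex) \<Rightarrow> ((real \<times> real) \<Rightarrow>\<^sub>C complex)" where
  "line_sol F = (THE U. F - line_op U = U)"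

lemma line_sol_eq: "F - line_op (line_sol F) = line_sol F"
  unfolding line_sol_def using line_equation_ex1 by (rule theI')

lemma line_sol_unique: "F - line_op U = U \<Longrightarrow> U = line_sol F"
  using line_equation_ex1[of F] line_sol_eq[of F] by blast

lemma norm_line_sol_le: "norm (line_sol F) \<le> 2 * norm F"
proof -
  have "norm (line_sol F) \<le> norm F + norm (line_op (line_sol F))"
    using norm_triangle_ineq4[of F "line_op (line_sol F)"] by (simp only: line_sol_eq)
  then show ?thesis using norm_line_op_le[of "line_sol F"] by simp
qed

lemma line_sol_linear:
  assumes "\<And>p. apply_bcontfun H p = c * apply_bcontfun F p + d * apply_bcontfun G p"
  shows "apply_bcontfun (line_sol H) p = c * apply_bcontfun (line_sol F) p + d * apply_bcontfun (line_sol G) p"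
proof -
  define W where "W = Bcontfun (\<lambda>p. c * apply_bcontfun (line_sol F) p + d * apply_bcontfun (line_sol G) p)"
  have "(\<lambda>p. c * apply_bcontfun (line_sol F) p + d * apply_bcontfun (line_sol G) p) \<in> bcontfun"
  proof (rule bcontfun_normI)
    show "cmod (c * apply_bcontfun (line_sol F) p + d * apply_bcontfun (line_sol G) p)
        \<le> cmod c * norm (line_sol F) + cmod d * norm (line_sol G)" for p
      by (intro norm_triangle_le add_mono) (auto simp: norm_mult intro!: mult_left_mono norm_bounded)
  qed (intro continuous_intros continuous_on_apply_bcontfun)
  then have W: "apply_bcontfun W p = c * apply_bcontfun (line_sol F) p + d * apply_bcontfun (line_sol G) p" for p
    by (simp add: W_def Bcontfun_inverse)
  have eq: "apply_bcontfun F p - apply_bcontfun (line_op (line_sol F)) p = apply_bcontfun (line_sol F) p" for F p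
    using line_sol_eq[of F] by (metis minus_bcontfun.rep_eq)
  have "H - line_op W = W"
  proof (rule bcontfun_eqI)
    fix p
    show "apply_bcontfun (H - line_op W) p = apply_bcontfun W p"
    proof -
      have "apply_bcontfun F p = apply_bcontfun (line_sol F) p + apply_bcontfun (line_op (line_sol F)) p"
        "apply_bcontfun G p = apply_bcontfun (line_sol G) p + apply_bcontfun (line_op (line_sol G)) p"
        using eq[of F p] eq[of G p] by (simp_all add: diff_eq_eq)
      then show ?thesis by (simp only: minus_bcontfun.rep_eq line_op_linear[OF W] W assms) (simp add: algebra_simps)
    qed
  qed
  then have "W = line_sol H" by (rule line_sol_unique)
  then show ?thesis using W by simp
qed

end

section \<open>Estimates in the norms of \<open>H\<^sub>\<alpha>\<close>\<close>

lemma H_normsq_cong: "(\<And>\<omega>. \<omega> \<in> Cplus \<Longrightarrow> f \<omega> = g \<omega>) \<Longrightarrow> H_normsq \<alpha> f = H_normsq \<alpha> g"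
  unfolding H_normsq_def by (intro SUP_cong refl) (simp add: Complex_in_Cplus)

lemma H_space_cong:
  assumes "\<And>\<omega>. \<omega> \<in> Cplus \<Longrightarrow> f \<omega> = g \<omega>" shows "f \<in> H_space \<alpha> \<longleftrightarrow> g \<in> H_space \<alpha>"
  using assms H_normsq_cong[OF assms] holomorphic_cong[OF refl assms] by (simp add: H_space_def)

lemma Cplus_plus_ii_nonzero: "\<omega> \<in> Cplus \<Longrightarrow> \<omega> + \<i> \<noteq> 0"
  by (auto simp: Cplus_def complex_eq_iff)

lemma norm_le_norm_plus_ii: "\<omega> \<in> Cplus \<Longrightarrow> cmod \<omega> \<le> cmod (\<omega> + \<i>)"
  by (rule power2_le_imp_le) (simp_all add: cmod_power2 Cplus_def power_mono)

lemma weight_square_le: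
  assumes "\<omega> \<in> Cplus" shows "(C / cmod (\<omega> + \<i>))\<^sup>2 \<le> C\<^sup>2 * decay (Re \<omega>)"
proof -
  have pos: "0 < 1 + (Re \<omega>)\<^sup>2" using zero_le_power2[of "Re \<omega>"] by linarith
  have le: "1 + (Re \<omega>)\<^sup>2 \<le> (cmod (\<omega> + \<i>))\<^sup>2"
    unfolding cmod_power2 using assms power_mono[of 1 "Im \<omega> + 1" 2] by (simp add: Cplus_def)
  have "C\<^sup>2 / (cmod (\<omega> + \<i>))\<^sup>2 \<le> C\<^sup>2 / (1 + (Re \<omega>)\<^sup>2)" using le pos by (intro divide_left_mono mult_pos_pos) auto
  then show ?thesis by (simp add: decay_def power_divide)
qed

lemma mult_H_iff:
  assumes m: "\<And>\<omega>. \<omega> \<in> Cplus \<Longrightarrow> m \<omega> \<noteq> 0"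
  shows "f \<in> mult_H (\<lambda>\<omega>. inverse (m \<omega>)) \<alpha> \<longleftrightarrow> (\<lambda>\<omega>. f \<omega> * m \<omega>) \<in> H_space \<alpha>"
proof
  assume "f \<in> mult_H (\<lambda>\<omega>. inverse (m \<omega>)) \<alpha>"
  then obtain g where g: "g \<in> H_space \<alpha>" "\<And>\<omega>. \<omega> \<in> Cplus \<Longrightarrow> f \<omega> = inverse (m \<omega>) * g \<omega>"
    by (auto simp: mult_H_def)
  then show "(\<lambda>\<omega>. f \<omega> * m \<omega>) \<in> H_space \<alpha>"
    using m H_space_cong[of g "\<lambda>\<omega>. f \<omega> * m \<omega>"] by simp
next
  assume "(\<lambda>\<omega>. f \<omega> * m \<omega>) \<in> H_space \<alpha>"
  then show "f \<in> mult_H (\<lambda>\<omega>. inverse (m \<omega>)) \<alpha>"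
    unfolding mult_H_def using m by (intro CollectI bexI[of _ "\<lambda>\<omega>. f \<omega> * m \<omega>"]) auto
qed

lemma mult_H_norm_inverse: "mult_H_norm (\<lambda>\<omega>. inverse (m \<omega>)) \<alpha> f = H_norm \<alpha> (\<lambda>\<omega>. f \<omega> * m \<omega>)"
  by (simp add: mult_H_norm_def divide_inverse)

lemma H_normsq_eq_H_norm: "g \<in> H_space \<alpha> \<Longrightarrow> H_normsq \<alpha> g = ennreal ((H_norm \<alpha> g)\<^sup>2)"
  by (simp add: H_space_def H_norm_def)

lemma H_norm_le:
  assumes "H_normsq \<alpha> g \<le> ennreal (E\<^sup>2)" "E \<ge> 0" shows "H_norm \<alpha> g \<le> E"
proof -
  have "enn2real (H_normsq \<alpha> g) \<le> E\<^sup>2" using assms(1) by (rule enn2real_leI[rotated]) simp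
  then show ?thesis unfolding H_norm_def using assms(2) by (metis real_sqrt_le_iff real_sqrt_abs abs_of_nonneg)
qed

text \<open>
  The way back from weighted supremum bounds to square integrals over lines.
\<close>

lemma H_normsq_decay_bound:
  assumes bd: "\<And>\<omega>. \<omega> \<in> Cplus \<Longrightarrow> cmod (h \<omega>) \<le> D * exp (Im \<omega> * \<beta>) / cmod (\<omega> + \<i>)" and D: "D \<ge> 0"
  shows "H_normsq \<beta> h \<le> ennreal (D\<^sup>2 * decay_mass)"
  unfolding H_normsq_def
proof (rule SUP_least)
  fix \<sigma> :: real assume "\<sigma> \<in> {0<..}"
  then have \<sigma>: "\<sigma> > 0" by simp
  have "(\<integral>\<^sup>+l. ennreal ((cmod (h (Complex l \<sigma>)))\<^sup>2) \<partial>lborel) \<le> (\<integral>\<^sup>+l. ennreal ((D * exp (\<sigma> * \<beta>))\<^sup>2 * decay l) \<partial>lborel)"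
  proof (intro nn_integral_mono ennreal_leI)
    fix l :: real
    have "(cmod (h (Complex l \<sigma>)))\<^sup>2 \<le> (D * exp (\<sigma> * \<beta>) / cmod (Complex l \<sigma> + \<i>))\<^sup>2"
      using bd[OF Complex_in_Cplus[OF \<sigma>], of l] by (intro power_mono) auto
    also have "\<dots> \<le> (D * exp (\<sigma> * \<beta>))\<^sup>2 * decay l"
      using weight_square_le[OF Complex_in_Cplus[OF \<sigma>], of "D * exp (\<sigma> * \<beta>)" l] by simp
    finally show "(cmod (h (Complex l \<sigma>)))\<^sup>2 \<le> (D * exp (\<sigma> * \<beta>))\<^sup>2 * decay l" .
  qed
  also have "\<dots> = ennreal ((D * exp (\<sigma> * \<beta>))\<^sup>2 * decay_mass)"
    using integrable_decay decay_pos unfolding decay_mass_def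
    by (subst nn_integral_eq_integral) (auto intro!: AE_I2 mult_nonneg_nonneg less_imp_le[OF decay_pos])
  finally have "ennreal (exp (- 2 * \<sigma> * \<beta>)) * (\<integral>\<^sup>+l. ennreal ((cmod (h (Complex l \<sigma>)))\<^sup>2) \<partial>lborel)
      \<le> ennreal (exp (- 2 * \<sigma> * \<beta>)) * ennreal ((D * exp (\<sigma> * \<beta>))\<^sup>2 * decay_mass)"
    by (rule mult_left_mono) simp
  also have "\<dots> = ennreal (exp (- 2 * \<sigma> * \<beta>) * ((D * exp (\<sigma> * \<beta>))\<^sup>2 * decay_mass))"
    using decay_mass_nonneg by (simp add: ennreal_mult)
  also have "exp (- 2 * \<sigma> * \<beta>) * ((D * exp (\<sigma> * \<beta>))\<^sup>2 * decay_mass) = D\<^sup>2 * decay_mass"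
    by (simp add: power_mult_distrib exp_double[symmetric] exp_minus field_simps)
  finally show "ennreal (exp (- 2 * \<sigma> * \<beta>)) * (\<integral>\<^sup>+l. ennreal ((cmod (h (Complex l \<sigma>)))\<^sup>2) \<partial>lborel) \<le> ennreal (D\<^sup>2 * decay_mass)" .
qed

lemma holomorphic_line_measurable:
  assumes "h holomorphic_on Cplus" "\<sigma> > 0"
  shows "(\<lambda>l. h (Complex l \<sigma>)) \<in> borel_measurable borel"
  using assms
  by (intro borel_measurable_continuous_onI continuous_on_compose2[OF holomorphic_on_imp_continuous_on[OF assms(1)]] )
     (auto simp: Cplus_def Complex_eq intro!: continuous_intros)

lemma norm_add_square_le: "(cmod (x + y))\<^sup>2 \<le> 2 * (cmod x)\<^sup>2 + 2 * (cmod y)\<^sup>2"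
proof -
  have "(cmod (x + y))\<^sup>2 \<le> (cmod x + cmod y)\<^sup>2" by (intro power_mono norm_triangle_ineq) simp
  also have "\<dots> \<le> 2 * (cmod x)\<^sup>2 + 2 * (cmod y)\<^sup>2"
    using sum_squares_bound[of "cmod x" "cmod y"] by (simp add: power2_sum)
  finally show ?thesis .
qed

lemma H_normsq_add_le:
  assumes "g holomorphic_on Cplus" "h holomorphic_on Cplus"
  shows "H_normsq \<beta> (\<lambda>\<omega>. g \<omega> + h \<omega>) \<le> 2 * H_normsq \<beta> g + 2 * H_normsq \<beta> h"
  unfolding H_normsq_def[of _ "\<lambda>\<omega>. g \<omega> + h \<omega>"]
proof (rule SUP_least)
  fix \<sigma> :: real assume "\<sigma> \<in> {0<..}"
  then have \<sigma>: "\<sigma> > 0" by simp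
  let ?n = "\<lambda>f. \<integral>\<^sup>+l. ennreal ((cmod (f (Complex l \<sigma>)))\<^sup>2) \<partial>lborel" and ?e = "ennreal (exp (- 2 * \<sigma> * \<beta>))"
  have [measurable]: "(\<lambda>l. g (Complex l \<sigma>)) \<in> borel_measurable borel" "(\<lambda>l. h (Complex l \<sigma>)) \<in> borel_measurable borel"
    using assms \<sigma> by (auto intro: holomorphic_line_measurable)
  have "?n (\<lambda>\<omega>. g \<omega> + h \<omega>) \<le> (\<integral>\<^sup>+l. 2 * ennreal ((cmod (g (Complex l \<sigma>)))\<^sup>2) + 2 * ennreal ((cmod (h (Complex l \<sigma>)))\<^sup>2) \<partial>lborel)"
  proof (rule nn_integral_mono)
    fix l
    have "ennreal ((cmod (g (Complex l \<sigma>) + h (Complex l \<sigma>)))\<^sup>2)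
        \<le> ennreal (2 * (cmod (g (Complex l \<sigma>)))\<^sup>2 + 2 * (cmod (h (Complex l \<sigma>)))\<^sup>2)"
      by (intro ennreal_leI norm_add_square_le)
    then show "ennreal ((cmod (g (Complex l \<sigma>) + h (Complex l \<sigma>)))\<^sup>2)
        \<le> 2 * ennreal ((cmod (g (Complex l \<sigma>)))\<^sup>2) + 2 * ennreal ((cmod (h (Complex l \<sigma>)))\<^sup>2)"
      by (simp add: ennreal_mult)
  qed
  also have "\<dots> = 2 * ?n g + 2 * ?n h" by (subst nn_integral_add) (auto simp: nn_integral_cmult)
  finally have "?e * ?n (\<lambda>\<omega>. g \<omega> + h \<omega>) \<le> ?e * (2 * ?n g + 2 * ?n h)" by (rule mult_left_mono) simp
  also have "\<dots> = 2 * (?e * ?n g) + 2 * (?e * ?n h)" by (simp add: distrib_left mult.left_commute)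
  also have "\<dots> \<le> 2 * H_normsq \<beta> g + 2 * H_normsq \<beta> h"
    unfolding H_normsq_def using \<sigma> by (intro add_mono mult_left_mono SUP_upper2[of \<sigma>]) auto
  finally show "?e * ?n (\<lambda>\<omega>. g \<omega> + h \<omega>) \<le> 2 * H_normsq \<beta> g + 2 * H_normsq \<beta> h" .
qed

lemma H_space_add: "g \<in> H_space \<beta> \<Longrightarrow> h \<in> H_space \<beta> \<Longrightarrow> (\<lambda>\<omega>. g \<omega> + h \<omega>) \<in> H_space \<beta>"
  using H_normsq_add_le[of g h \<beta>] unfolding H_space_def
  by (auto intro!: holomorphic_on_add elim!: order_le_less_trans simp: ennreal_mult_less_top)

lemma H_space_cmult:
  assumes h: "h \<in> H_space \<beta>" shows "(\<lambda>\<omega>. c * h \<omega>) \<in> H_space \<beta>"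
proof -
  have [measurable]: "(\<lambda>l. h (Complex l \<sigma>)) \<in> borel_measurable borel" if "\<sigma> > 0" for \<sigma>
    using h that by (auto simp: H_space_def intro: holomorphic_line_measurable)
  have "H_normsq \<beta> (\<lambda>\<omega>. c * h \<omega>) \<le> ennreal ((cmod c)\<^sup>2) * H_normsq \<beta> h"
    unfolding H_normsq_def[of _ "\<lambda>\<omega>. c * h \<omega>"]
  proof (rule SUP_least)
    fix \<sigma> :: real assume "\<sigma> \<in> {0<..}"
    then have \<sigma>: "\<sigma> > 0" by simp
    have "ennreal (exp (- 2 * \<sigma> * \<beta>)) * (\<integral>\<^sup>+l. ennreal ((cmod (c * h (Complex l \<sigma>)))\<^sup>2) \<partial>lborel)
        = ennreal ((cmod c)\<^sup>2) * (ennreal (exp (- 2 * \<sigma> * \<beta>)) * (\<integral>\<^sup>+l. ennreal ((cmod (h (Complex l \<sigma>)))\<^sup>2) \<partial>lborel))"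
      using \<sigma> by (simp add: norm_mult power_mult_distrib ennreal_mult nn_integral_cmult mult_ac)
    also have "\<dots> \<le> ennreal ((cmod c)\<^sup>2) * H_normsq \<beta> h"
      unfolding H_normsq_def using \<sigma> by (intro mult_left_mono SUP_upper) auto
    finally show "ennreal (exp (- 2 * \<sigma> * \<beta>)) * (\<integral>\<^sup>+l. ennreal ((cmod (c * h (Complex l \<sigma>)))\<^sup>2) \<partial>lborel)
        \<le> ennreal ((cmod c)\<^sup>2) * H_normsq \<beta> h" .
  qed
  also have "\<dots> < top" using h by (simp add: H_space_def ennreal_mult_less_top)
  finally show ?thesis using h by (auto simp: H_space_def intro!: holomorphic_on_mult)
qed

lemma H_normsq_mono:
  assumes "\<And>\<omega>. \<omega> \<in> Cplus \<Longrightarrow> cmod (h \<omega>) \<le> cmod (g \<omega>)" and "\<alpha> \<le> \<beta>"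
  shows "H_normsq \<beta> h \<le> H_normsq \<alpha> g"
  unfolding H_normsq_def
proof (rule SUP_mono)
  fix \<sigma> :: real assume \<sigma>: "\<sigma> \<in> {0<..}"
  have "ennreal (exp (- 2 * \<sigma> * \<beta>)) * (\<integral>\<^sup>+l. ennreal ((cmod (h (Complex l \<sigma>)))\<^sup>2) \<partial>lborel)
      \<le> ennreal (exp (- 2 * \<sigma> * \<alpha>)) * (\<integral>\<^sup>+l. ennreal ((cmod (g (Complex l \<sigma>)))\<^sup>2) \<partial>lborel)"
    using \<sigma> assms(2) by (intro mult_mono nn_integral_mono ennreal_leI power_mono assms(1)) (auto simp: Complex_in_Cplus)
  then show "\<exists>\<sigma>'\<in>{0<..}. ennreal (exp (- 2 * \<sigma> * \<beta>)) * (\<integral>\<^sup>+l. ennreal ((cmod (h (Complex l \<sigma>)))\<^sup>2) \<partial>lborel)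
      \<le> ennreal (exp (- 2 * \<sigma>' * \<alpha>)) * (\<integral>\<^sup>+l. ennreal ((cmod (g (Complex l \<sigma>')))\<^sup>2) \<partial>lborel)"
    using \<sigma> by blast
qed

context coefficient
begin

section \<open>The scattered field\<close>

text \<open>
  The incident wave grows exponentially as \<open>x \<rightarrow> -\<infinity>\<close>.  The source depends on the solution only for
  \<open>\<bar>x\<bar> \<le> R\<close>, so the wave is frozen outside this interval to make it a bounded function.
\<close>

definition clamp_x :: "real \<Rightarrow> real" where
  "clamp_x x = max (- R) (min R x)"

definition incident :: "(complex \<Rightarrow> complex) \<Rightarrow> ((real \<times> real) \<Rightarrow>\<^sub>C complex)" where
  "incident f = Bcontfun (\<lambda>(x, l). f (Complex l s\<^sub>0) * (Complex l s\<^sub>0 + \<i>) * exp (\<i> * Complex l s\<^sub>0 * of_real (clamp_x x)))"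

definition scatter_source :: "(complex \<Rightarrow> complex) \<Rightarrow> real \<Rightarrow> complex \<Rightarrow> complex" where
  "scatter_source f = source (apply_bcontfun (line_sol (incident f)))"

text \<open>
  Defined in the whole half-plane, although the source comes from the line of height \<open>s\<^sub>0\<close> alone.
\<close>

definition sol :: "(complex \<Rightarrow> complex) \<Rightarrow> real \<Rightarrow> complex \<Rightarrow> complex" where
  "sol f x \<omega> = f \<omega> * exp (\<i> * \<omega> * of_real x) - Green \<omega> (\<lambda>y. scatter_source f y \<omega>) x"

definition transmission :: "(complex \<Rightarrow> complex) \<Rightarrow> complex \<Rightarrow> complex" where
  "transmission f \<omega> = f \<omega> - \<i> / (2 * \<omega>) * (\<integral>y. exp (- \<i> * \<omega> * of_real y) * scatter_source f y \<omega> \<partial>lebesgue)"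

definition reflection :: "(complex \<Rightarrow> complex) \<Rightarrow> complex \<Rightarrow> complex" where
  "reflection f \<omega> = - (\<i> / (2 * \<omega>) * (\<integral>y. exp (\<i> * \<omega> * of_real y) * scatter_source f y \<omega> \<partial>lebesgue))"

definition incident_const :: "real \<Rightarrow> real" where
  "incident_const \<alpha> = 2 * exp (s\<^sub>0 * \<alpha> + \<bar>\<alpha>\<bar>) * exp (s\<^sub>0 * R)"

text \<open>
  The first summand bounds the source above the height \<open>s\<^sub>0\<close>, the second one below it; the last
  exponential makes up for \<open>exp (\<sigma> (\<alpha> + R))\<close> being small on \<open>0 < \<sigma> < s\<^sub>0\<close> when \<open>\<alpha> + R < 0\<close>.
\<close>

definition source_const :: "real \<Rightarrow> real" where
  "source_const \<alpha> = 4 * B * exp \<bar>\<alpha>\<bar>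
     + B * exp (T * s\<^sub>0) * (1 + s\<^sub>0) * (2 * incident_const \<alpha>) * exp (s\<^sub>0 * \<bar>\<alpha> + R\<bar>)"

lemma source_const_nonneg: "source_const \<alpha> \<ge> 0"
  using B_nonneg s\<^sub>0_ge by (simp add: source_const_def incident_const_def)

lemma sol_left: "x < - R \<Longrightarrow> sol f x \<omega> = f \<omega> * exp (\<i> * \<omega> * of_real x) + reflection f \<omega> * exp (- \<i> * \<omega> * of_real x)"
  unfolding sol_def reflection_def
  by (subst Green_left[where R = R]) (auto simp: scatter_source_def source_def line_conv_outside)

lemma sol_right: "x > R \<Longrightarrow> sol f x \<omega> = transmission f \<omega> * exp (\<i> * \<omega> * of_real x)"
  unfolding sol_def transmission_def
  by (subst Green_right[where R = R]) (auto simp: scatter_source_def source_def line_conv_outside left_diff_distrib)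

abbreviation weighted_H :: "real \<Rightarrow> (complex \<Rightarrow> complex) set" where
  "weighted_H \<equiv> mult_H (\<lambda>\<omega>. inverse (\<omega> + \<i>))"

context
  fixes f :: "complex \<Rightarrow> complex" and \<alpha> :: real
  assumes f: "f \<in> weighted_H \<alpha>"
begin

abbreviation (input) F :: "complex \<Rightarrow> complex" where "F \<omega> \<equiv> f \<omega> * (\<omega> + \<i>)"
abbreviation (input) N :: real where "N \<equiv> H_norm \<alpha> F"
abbreviation (input) U :: "(real \<times> real) \<Rightarrow>\<^sub>C complex" where "U \<equiv> line_sol (incident f)"

lemma F_in_H: "F \<in> H_space \<alpha>"
  using f mult_H_iff[OF Cplus_plus_ii_nonzero] by simp

lemma F_holomorphic: "F holomorphic_on Cplus"
  using F_in_H by (simp add: H_space_def)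

lemma f_holomorphic: "f holomorphic_on Cplus"
proof -
  have "(\<lambda>\<omega>. F \<omega> / (\<omega> + \<i>)) holomorphic_on Cplus"
    using Cplus_plus_ii_nonzero by (intro holomorphic_on_divide[OF F_holomorphic] holomorphic_intros) auto
  then show ?thesis using holomorphic_cong[OF refl, of Cplus f "\<lambda>\<omega>. F \<omega> / (\<omega> + \<i>)"] Cplus_plus_ii_nonzero by simp
qed

lemma F_bound: "Im \<omega> \<ge> 2 \<Longrightarrow> cmod (F \<omega>) \<le> 2 * exp (Im \<omega> * \<alpha> + \<bar>\<alpha>\<bar>) * N"
  using H_space_pointwise_bound[OF F_in_H, of 1 \<omega>] by simp

lemma norm_exp_line_le: "\<omega> \<in> Cplus \<Longrightarrow> \<bar>x\<bar> \<le> R \<Longrightarrow> cmod (exp (\<i> * \<omega> * of_real x)) \<le> exp (Im \<omega> * R)"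
proof -
  assume \<omega>: "\<omega> \<in> Cplus" and x: "\<bar>x\<bar> \<le> R"
  have "Im \<omega> * (- x) \<le> Im \<omega> * R" using \<omega> x by (intro mult_left_mono) (auto simp: Cplus_def)
  then show ?thesis unfolding norm_exp_ii_times by simp
qed

lemma apply_incident:
  "apply_bcontfun (incident f) (x, l) = F (Complex l s\<^sub>0) * exp (\<i> * Complex l s\<^sub>0 * of_real (clamp_x x))"
  and norm_incident_le: "norm (incident f) \<le> incident_const \<alpha> * N"
proof -
  let ?g = "\<lambda>(x, l). F (Complex l s\<^sub>0) * exp (\<i> * Complex l s\<^sub>0 * of_real (clamp_x x))"
  have cont: "continuous_on UNIV ?g"
    unfolding case_prod_unfold clamp_x_def using line_in_Cplus
    by (intro continuous_intros continuous_Complex continuous_on_compose2[OF holomorphic_on_imp_continuous_on[OF f_holomorphic]]) auto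
  have bd: "cmod (?g p) \<le> incident_const \<alpha> * N" for p
  proof (cases p)
    case (Pair x l)
    have "cmod (F (Complex l s\<^sub>0)) \<le> 2 * exp (s\<^sub>0 * \<alpha> + \<bar>\<alpha>\<bar>) * N"
      using F_bound[of "Complex l s\<^sub>0"] s\<^sub>0_ge by simp
    moreover have "cmod (exp (\<i> * Complex l s\<^sub>0 * of_real (clamp_x x))) \<le> exp (s\<^sub>0 * R)"
      using norm_exp_line_le[OF line_in_Cplus, of "clamp_x x" l] R by (simp add: clamp_x_def)
    ultimately have "cmod (F (Complex l s\<^sub>0)) * cmod (exp (\<i> * Complex l s\<^sub>0 * of_real (clamp_x x)))
        \<le> (2 * exp (s\<^sub>0 * \<alpha> + \<bar>\<alpha>\<bar>) * N) * exp (s\<^sub>0 * R)"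
      by (intro mult_mono) (auto simp: H_norm_nonneg)
    then show ?thesis unfolding Pair incident_const_def by (simp add: norm_mult mult_ac)
  qed
  have g: "?g \<in> bcontfun" by (rule bcontfun_normI[OF cont bd])
  then have app: "apply_bcontfun (incident f) = ?g" by (simp add: incident_def Bcontfun_inverse)
  then show "apply_bcontfun (incident f) (x, l) = F (Complex l s\<^sub>0) * exp (\<i> * Complex l s\<^sub>0 * of_real (clamp_x x))"
    by simp
  show "norm (incident f) \<le> incident_const \<alpha> * N"
    using bd by (intro norm_bound) (simp only: app)
qed

lemma norm_U_le: "norm U \<le> 2 * incident_const \<alpha> * N"
  using norm_line_sol_le[of "incident f"] norm_incident_le by simp

lemma U_cont: "continuous_on UNIV (apply_bcontfun U)" and U_bd: "\<And>p. cmod (apply_bcontfun U p) \<le> norm U"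
  by (auto intro: norm_bounded)

lemma scatter_source_outside: "\<bar>y\<bar> > R \<Longrightarrow> scatter_source f y z = 0"
  unfolding scatter_source_def by (rule source_outside[OF U_cont U_bd])

lemma scatter_source_integrable: "integrable lebesgue (\<lambda>y. scatter_source f y z)"
  unfolding scatter_source_def by (rule source_integrable[OF U_cont U_bd])

lemma sol_eq_line_sol:
  assumes "\<bar>x\<bar> \<le> R"
  shows "apply_bcontfun U (x, l) = (Complex l s\<^sub>0 + \<i>) * sol f x (Complex l s\<^sub>0)"
proof -
  have "clamp_x x = x" using assms by (auto simp: clamp_x_def)
  moreover have "apply_bcontfun U (x, l) = apply_bcontfun (incident f) (x, l) - apply_bcontfun (line_op U) (x, l)"
    using line_sol_eq[of "incident f"] by (metis minus_bcontfun.rep_eq)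
  ultimately show ?thesis
    by (simp add: apply_incident apply_line_op sol_def scatter_source_def algebra_simps)
qed

lemma scatter_source_eq_line_conv:
  "scatter_source f y z = line_conv s\<^sub>0 (\<lambda>l. memory (Complex l s\<^sub>0) * sol f y (Complex l s\<^sub>0)) y z"
proof (cases "\<bar>y\<bar> \<le> R")
  case True
  have "line_density (\<lambda>l. apply_bcontfun U (y, l)) = (\<lambda>l. memory (Complex l s\<^sub>0) * sol f y (Complex l s\<^sub>0))"
    using Cplus_plus_ii_nonzero[OF line_in_Cplus] by (simp add: fun_eq_iff line_density_def sol_eq_line_sol[OF True])
  then show ?thesis by (simp add: scatter_source_def source_def)
qed (simp add: scatter_source_outside line_conv_outside)

lemma scatter_integral_holomorphic:
  "continuous_on UNIV k \<Longrightarrow> (\<lambda>\<omega>. \<integral>y. exp (\<i> * \<omega> * of_real (k y)) * scatter_source f y \<omega> \<partial>lebesgue) holomorphic_on Cplus"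
  unfolding scatter_source_def by (rule source_integral_holomorphic[OF U_cont U_bd])

lemma sol_holomorphic: "sol f x holomorphic_on Cplus"
proof -
  have "(\<lambda>\<omega>. f \<omega> * exp (\<i> * \<omega> * of_real x) - \<i> / (2 * \<omega>) * (\<integral>y. exp (\<i> * \<omega> * of_real \<bar>x - y\<bar>) * scatter_source f y \<omega> \<partial>lebesgue)) holomorphic_on Cplus"
    using Cplus_nonzero
    by (intro holomorphic_on_diff holomorphic_on_mult[OF f_holomorphic] holomorphic_on_mult[OF _ scatter_integral_holomorphic] holomorphic_intros continuous_intros) auto
  then show ?thesis by (simp add: sol_def[abs_def] Green_def)
qed

text \<open>
  Boundedness in strips is all that moving the line of integration requires, since the transform of
  the coefficient decays.
\<close>

lemma sol_strip_bound:
  assumes "0 < \<sigma>"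
  shows "\<exists>C. \<forall>x z. \<bar>x\<bar> \<le> R \<and> \<sigma> \<le> Im z \<and> Im z \<le> \<tau> \<longrightarrow> cmod (sol f x z) \<le> C"
proof -
  define C1 where "C1 = (1 + 1 / (\<sigma> / 2)) * exp (\<tau> * \<bar>\<alpha>\<bar> + \<sigma> / 2 * \<bar>\<alpha>\<bar>) * N * exp (\<tau> * R)"
  define C2 where "C2 = B * exp (T * (\<tau> + s\<^sub>0)) * norm U"
  have "cmod (sol f x z) \<le> C1 + R * C2 / \<sigma>" if x: "\<bar>x\<bar> \<le> R" and z: "\<sigma> \<le> Im z" "Im z \<le> \<tau>" for x z
  proof -
    have zC: "z \<in> Cplus" using z assms by (simp add: Cplus_def)
    have "cmod (F z) \<le> (1 + 1 / (\<sigma> / 2)) * exp (Im z * \<alpha> + \<sigma> / 2 * \<bar>\<alpha>\<bar>) * N"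
      using assms z by (intro H_space_pointwise_bound F_in_H) auto
    also have "\<dots> \<le> (1 + 1 / (\<sigma> / 2)) * exp (\<tau> * \<bar>\<alpha>\<bar> + \<sigma> / 2 * \<bar>\<alpha>\<bar>) * N"
    proof -
      have "Im z * \<alpha> \<le> Im z * \<bar>\<alpha>\<bar>" using z assms by (intro mult_left_mono) auto
      also have "\<dots> \<le> \<tau> * \<bar>\<alpha>\<bar>" using z by (intro mult_right_mono) auto
      finally show ?thesis using assms by (intro mult_right_mono mult_left_mono) (auto simp: H_norm_nonneg)
    qed
    also have "cmod (f z) \<le> cmod (F z)"
      using mult_left_mono[OF norm_plus_ii_ge_1[of z], of "cmod (f z)"] z assms by (simp add: norm_mult)
    finally have 1: "cmod (f z) \<le> (1 + 1 / (\<sigma> / 2)) * exp (\<tau> * \<bar>\<alpha>\<bar> + \<sigma> / 2 * \<bar>\<alpha>\<bar>) * N" by simp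
    have "cmod (exp (\<i> * z * of_real x)) \<le> exp (Im z * R)" by (rule norm_exp_line_le[OF zC x])
    also have "\<dots> \<le> exp (\<tau> * R)" using z R by (simp add: mult_right_mono)
    finally have 2: "cmod (f z * exp (\<i> * z * of_real x)) \<le> C1"
      unfolding C1_def norm_mult using 1 assms by (intro mult_mono) (auto simp: H_norm_nonneg)
    have im: "\<bar>Im z - s\<^sub>0\<bar> \<le> \<tau> + s\<^sub>0" using z assms s\<^sub>0_ge by auto
    have C2: "cmod (scatter_source f y z) \<le> C2" for y
    proof -
      have "cmod (scatter_source f y z) \<le> B * exp (T * \<bar>Im z - s\<^sub>0\<bar>) * norm U"
        unfolding scatter_source_def by (rule source_bound[OF U_cont U_bd])
      also have "\<dots> \<le> C2" unfolding C2_def using im T B_nonneg by (intro mult_right_mono mult_left_mono) auto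
      finally show ?thesis .
    qed
    have "cmod (Green z (\<lambda>y. scatter_source f y z) x) \<le> R * C2 / cmod z"
      by (rule Green_bound_interval[OF scatter_source_integrable scatter_source_outside R C2 zC])
    also have "\<dots> \<le> R * C2 / \<sigma>"
    proof (rule divide_left_mono)
      have "\<sigma> \<le> cmod z" using assms z abs_Im_le_cmod[of z] by linarith
      then show "\<sigma> \<le> cmod z" "0 < cmod z * \<sigma>" using assms by (auto simp: zero_less_mult_iff)
      show "0 \<le> R * C2" using R order_trans[OF norm_ge_zero C2] by simp
    qed
    finally show ?thesis unfolding sol_def using 2 by (intro order_trans[OF norm_triangle_ineq4] add_mono)
  qed
  then show ?thesis by blast
qed

text \<open>
  The integrand \<open>ahat(z - \<zeta>) memory(\<zeta>) sol(y, \<zeta>)\<close> is holomorphic in \<open>\<zeta>\<close> and decays in strips, so its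
  integral over the line \<open>Im \<zeta> = s\<^sub>0\<close>, which is the source, equals the integral over any other line.
\<close>

lemma scatter_source_any_line:
  assumes \<sigma>: "\<sigma> > 0"
  shows "scatter_source f y z = line_conv \<sigma> (\<lambda>l. memory (Complex l \<sigma>) * sol f y (Complex l \<sigma>)) y z"
proof (cases "\<bar>y\<bar> \<le> R")
  case True
  define H where "H \<zeta> = ahat y (z - \<zeta>) * (memory \<zeta> * sol f y \<zeta>)" for \<zeta>
  have "(\<integral>l. H (Complex l s\<^sub>0) \<partial>lborel) = (\<integral>l. H (Complex l \<sigma>) \<partial>lborel)"
  proof (rule horizontal_integral_constant)
    have "(\<lambda>\<zeta>. ahat y (z - \<zeta>)) holomorphic_on Cplus"
      by (rule holomorphic_on_compose_gen[OF _ ahat_holomorphic[of y UNIV], of "\<lambda>\<zeta>. z - \<zeta>", unfolded o_def])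
         (auto intro!: holomorphic_intros)
    then show "H holomorphic_on Cplus"
      unfolding H_def by (intro holomorphic_on_mult memory_holomorphic sol_holomorphic)
    fix \<sigma>\<^sub>1 \<tau> :: real assume \<sigma>1: "0 < \<sigma>\<^sub>1"
    obtain C where C: "\<And>\<zeta>. \<sigma>\<^sub>1 \<le> Im \<zeta> \<Longrightarrow> Im \<zeta> \<le> \<tau> \<Longrightarrow> cmod (sol f y \<zeta>) \<le> C"
      using sol_strip_bound[OF \<sigma>1, of \<tau>] True by blast
    define D where "D = 16 * T * M * exp (T * (\<bar>Im z\<bar> + \<bar>\<tau>\<bar>)) * (1 + (Re z)\<^sup>2) * C"
    have "cmod (H \<zeta>) \<le> D / (1 + (Re \<zeta>)\<^sup>2)" if \<zeta>: "\<sigma>\<^sub>1 \<le> Im \<zeta>" "Im \<zeta> \<le> \<tau>" for \<zeta>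
    proof -
      have \<zeta>C: "\<zeta> \<in> Cplus" using \<zeta> \<sigma>1 by (simp add: Cplus_def)
      have im: "\<bar>Im z - Im \<zeta>\<bar> \<le> \<bar>Im z\<bar> + \<bar>\<tau>\<bar>" using \<zeta> \<sigma>1 by auto
      note 1 = ahat_shift_bound[OF im, of y]
      have "cmod (memory \<zeta> * sol f y \<zeta>) \<le> 1 * C"
        unfolding norm_mult using C[OF \<zeta>] norm_memory_le[OF \<zeta>C] by (intro mult_mono) auto
      then have "cmod (H \<zeta>) \<le> (16 * T * M * exp (T * (\<bar>Im z\<bar> + \<bar>\<tau>\<bar>)) * (1 + (Re z)\<^sup>2) * decay (Re \<zeta>)) * C"
        unfolding H_def norm_mult[of "ahat y (z - \<zeta>)"] using 1 by (intro mult_mono order_trans[OF norm_ge_zero 1]) auto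
      then show ?thesis by (simp add: D_def decay_def)
    qed
    then show "\<exists>C. \<forall>\<zeta>. \<sigma>\<^sub>1 \<le> Im \<zeta> \<and> Im \<zeta> \<le> \<tau> \<longrightarrow> cmod (H \<zeta>) \<le> C / (1 + (Re \<zeta>)\<^sup>2)" by blast
  qed (use s\<^sub>0_ge \<sigma> in auto)
  then show ?thesis
    unfolding scatter_source_eq_line_conv line_conv_def H_def by simp
qed (simp add: scatter_source_outside line_conv_outside)

text \<open>
  With the line through \<open>\<omega>\<close> itself, the previous lemma says that the entire source is \<open>A\<close> applied to the
  solution at every frequency.
\<close>

lemma A_op_sol: "\<omega> \<in> Cplus \<Longrightarrow> A_op a \<gamma> (sol f) x \<omega> = scatter_source f x \<omega>"
  unfolding A_op_def a_D_eq_line_conv memory_def[symmetric]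
  by (rule scatter_source_any_line[symmetric]) (simp add: Cplus_def)

lemma scatter_source_line_bound:
  assumes \<sigma>: "\<sigma> > 0" and bd: "\<And>l. cmod ((Complex l \<sigma> + \<i>) * sol f y (Complex l \<sigma>)) \<le> K"
  shows "cmod (scatter_source f y (Complex l \<sigma>)) \<le> B * K / cmod (Complex l \<sigma> + \<i>)"
proof -
  have "cmod (line_conv \<sigma> (\<lambda>l. memory (Complex l \<sigma>) * sol f y (Complex l \<sigma>)) y (Complex l \<sigma>))
      \<le> B * exp (T * \<bar>Im (Complex l \<sigma>) - \<sigma>\<bar>) * (1 + \<bar>Im (Complex l \<sigma>) - \<sigma>\<bar>) * K / cmod (Complex l \<sigma> + \<i>)"
  proof (rule line_conv_weighted_bound)
    show "(\<lambda>l. memory (Complex l \<sigma>) * sol f y (Complex l \<sigma>)) \<in> borel_measurable borel"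
      using \<sigma> by (intro holomorphic_line_measurable[of "\<lambda>\<omega>. memory \<omega> * sol f y \<omega>"] holomorphic_on_mult memory_holomorphic sol_holomorphic)
    fix l
    have C: "Complex l \<sigma> \<in> Cplus" using \<sigma> by (rule Complex_in_Cplus)
    have "cmod (sol f y (Complex l \<sigma>)) \<le> K / cmod (Complex l \<sigma> + \<i>)"
      using bd[of l] Cplus_plus_ii_nonzero[OF C] by (simp add: norm_mult pos_le_divide_eq mult.commute)
    then show "cmod (memory (Complex l \<sigma>) * sol f y (Complex l \<sigma>)) \<le> K / cmod (Complex l \<sigma> + \<i>)"
      using mult_mono[OF norm_memory_le[OF C]] by (fastforce simp: norm_mult)
  qed (use \<sigma> in auto)
  then show ?thesis using scatter_source_any_line[OF \<sigma>, of y "Complex l \<sigma>"] by simp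
qed

text \<open>
  On a line of height \<open>\<sigma> \<ge> s\<^sub>0\<close> the solution satisfies the same contractive equation as on the line of
  height \<open>s\<^sub>0\<close>.  Its weighted supremum \<open>K\<close> is finite, by a crude bound on the source that grows with the
  distance of the lines, and then \<open>K \<le> A + K/2\<close> improves this to \<open>K \<le> 2A\<close> with the sharp growth in \<open>\<sigma>\<close>.
\<close>

lemma sol_line_bound:
  assumes \<sigma>: "\<sigma> \<ge> s\<^sub>0" and x: "\<bar>x\<bar> \<le> R"
  shows "cmod ((Complex l \<sigma> + \<i>) * sol f x (Complex l \<sigma>)) \<le> 4 * exp (\<sigma> * \<alpha> + \<bar>\<alpha>\<bar>) * exp (\<sigma> * R) * N"
proof -
  define A where "A = 2 * exp (\<sigma> * \<alpha> + \<bar>\<alpha>\<bar>) * exp (\<sigma> * R) * N"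
  define q where "q = (\<lambda>(x, l). cmod ((Complex l \<sigma> + \<i>) * sol f x (Complex l \<sigma>)))"
  define X where "X = {- R..R} \<times> (UNIV :: real set)"
  have s: "\<sigma> > 0" "\<sigma> \<ge> 2" using \<sigma> s\<^sub>0_ge by auto
  have C: "Complex l \<sigma> \<in> Cplus" for l using s by (simp add: Cplus_def)
  have step: "q (x, l) \<le> A + K / 2"
    if x: "\<bar>x\<bar> \<le> R" and K: "\<And>y. \<bar>y\<bar> \<le> R \<Longrightarrow> cmod (scatter_source f y (Complex l \<sigma>)) \<le> B * K / cmod (Complex l \<sigma> + \<i>)" and K0: "K \<ge> 0" for x l K
  proof -
    let ?\<omega> = "Complex l \<sigma>"
    have "cmod (F ?\<omega>) \<le> 2 * exp (\<sigma> * \<alpha> + \<bar>\<alpha>\<bar>) * N" using F_bound[of ?\<omega>] s by simp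
    then have 1: "cmod (F ?\<omega> * exp (\<i> * ?\<omega> * of_real x)) \<le> A"
      using mult_mono[OF _ norm_exp_line_le[OF C x], of "cmod (F ?\<omega>)" "2 * exp (\<sigma> * \<alpha> + \<bar>\<alpha>\<bar>) * N" l]
      unfolding A_def norm_mult by (simp add: H_norm_nonneg mult_ac)
    have \<omega>: "cmod ?\<omega> \<ge> \<sigma>" using abs_Im_le_cmod[of ?\<omega>] s by simp
    have "cmod (Green ?\<omega> (\<lambda>y. scatter_source f y ?\<omega>) x) \<le> R * (B * K / cmod (?\<omega> + \<i>)) / cmod ?\<omega>"
      by (rule Green_bound_interval[OF scatter_source_integrable scatter_source_outside R K C])
    then have "cmod (?\<omega> + \<i>) * cmod (Green ?\<omega> (\<lambda>y. scatter_source f y ?\<omega>) x) \<le> cmod (?\<omega> + \<i>) * (R * (B * K / cmod (?\<omega> + \<i>)) / cmod ?\<omega>)"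
      by (rule mult_left_mono) simp
    also have "\<dots> = R * B / cmod ?\<omega> * K" using Cplus_plus_ii_nonzero[OF C] by simp
    also have "\<dots> \<le> 1 / 2 * K" using K0 \<omega> \<sigma> by (intro mult_right_mono contraction_factor) auto
    finally have 2: "cmod ((?\<omega> + \<i>) * Green ?\<omega> (\<lambda>y. scatter_source f y ?\<omega>) x) \<le> K / 2" by (simp add: norm_mult)
    have "(?\<omega> + \<i>) * sol f x ?\<omega> = F ?\<omega> * exp (\<i> * ?\<omega> * of_real x) - (?\<omega> + \<i>) * Green ?\<omega> (\<lambda>y. scatter_source f y ?\<omega>) x"
      by (simp add: sol_def algebra_simps)
    then have "q (x, l) = cmod (F ?\<omega> * exp (\<i> * ?\<omega> * of_real x) - (?\<omega> + \<i>) * Green ?\<omega> (\<lambda>y. scatter_source f y ?\<omega>) x)"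
      unfolding q_def prod.case by (simp only:)
    then show ?thesis
      using 1 2 norm_triangle_ineq4[of "F ?\<omega> * exp (\<i> * ?\<omega> * of_real x)" "(?\<omega> + \<i>) * Green ?\<omega> (\<lambda>y. scatter_source f y ?\<omega>) x"] by linarith
  qed
  have "q p \<le> A + (exp (T * \<bar>\<sigma> - s\<^sub>0\<bar>) * (1 + \<bar>\<sigma> - s\<^sub>0\<bar>) * norm U) / 2" if "p \<in> X" for p
  proof -
    obtain x l where p: "p = (x, l)" "\<bar>x\<bar> \<le> R" using \<open>p \<in> X\<close> by (auto simp: X_def)
    have "cmod (scatter_source f y (Complex l \<sigma>)) \<le> B * (exp (T * \<bar>\<sigma> - s\<^sub>0\<bar>) * (1 + \<bar>\<sigma> - s\<^sub>0\<bar>) * norm U) / cmod (Complex l \<sigma> + \<i>)" for y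
      unfolding scatter_source_def using source_weighted_bound[OF U_cont U_bd, of "Complex l \<sigma>" y] s by (simp add: mult.assoc)
    then show ?thesis unfolding p(1) by (intro step p(2)) auto
  qed
  then have bdd: "bdd_above (q ` X)" by (rule bdd_aboveI2)
  have ne: "X \<noteq> {}" using R by (auto simp: X_def)
  define K where "K = (SUP p\<in>X. q p)"
  have qK: "q (y, l) \<le> K" if "\<bar>y\<bar> \<le> R" for y l
    unfolding K_def using that by (intro cSUP_upper bdd) (auto simp: X_def)
  have K0: "K \<ge> 0" using qK[of 0 0] R by (auto simp: q_def intro: order_trans[OF norm_ge_zero])
  have src: "cmod (scatter_source f y (Complex l \<sigma>)) \<le> B * K / cmod (Complex l \<sigma> + \<i>)" if y: "\<bar>y\<bar> \<le> R" for y l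
    using qK[OF y] by (intro scatter_source_line_bound s(1)) (simp add: q_def)
  have "K \<le> A + K / 2"
    unfolding K_def
  proof (rule cSUP_least[OF ne])
    fix p assume "p \<in> X"
    then obtain x l where p: "p = (x, l)" "\<bar>x\<bar> \<le> R" by (auto simp: X_def)
    show "q p \<le> A + (SUP p\<in>X. q p) / 2"
      unfolding p(1) K_def[symmetric] by (rule step[OF p(2) src K0])
  qed
  then have "K \<le> 2 * A" by simp
  then show ?thesis using qK[OF x, of l] by (simp add: q_def A_def)
qed

text \<open>
  For \<open>Im z < s\<^sub>0\<close> the source is the extension from the line of height \<open>s\<^sub>0\<close>, at a distance of at most
  \<open>s\<^sub>0\<close>, so the bound persists up to the real axis; for \<open>Im z \<ge> s\<^sub>0\<close> it is computed on the line through \<open>z\<close>.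
\<close>

lemma scatter_source_bound:
  assumes z: "z \<in> Cplus"
  shows "cmod (scatter_source f y z) \<le> source_const \<alpha> * N * exp (Im z * (\<alpha> + R)) / cmod (z + \<i>)"
proof (cases "\<bar>y\<bar> \<le> R")
  case True
  have z0: "Im z > 0" using z by (simp add: Cplus_def)
  define E where "E = exp (Im z * (\<alpha> + R))"
  define c1 where "c1 = 4 * B * exp \<bar>\<alpha>\<bar>"
  define c2 where "c2 = B * exp (T * s\<^sub>0) * (1 + s\<^sub>0) * (2 * incident_const \<alpha>) * exp (s\<^sub>0 * \<bar>\<alpha> + R\<bar>)"
  have c: "c1 \<ge> 0" "c2 \<ge> 0" "source_const \<alpha> = c1 + c2"
    using B_nonneg s\<^sub>0_ge by (auto simp: c1_def c2_def source_const_def incident_const_def)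
  have "cmod (scatter_source f y z) \<le> c1 * E * N / cmod (z + \<i>) \<or> cmod (scatter_source f y z) \<le> c2 * E * N / cmod (z + \<i>)"
  proof (cases "Im z \<ge> s\<^sub>0")
    case False
    have "cmod (scatter_source f y z) \<le> B * exp (T * \<bar>Im z - s\<^sub>0\<bar>) * (1 + \<bar>Im z - s\<^sub>0\<bar>) * norm U / cmod (z + \<i>)"
      unfolding scatter_source_def using z0 by (intro source_weighted_bound[OF U_cont U_bd]) simp
    also have "\<dots> \<le> B * exp (T * s\<^sub>0) * (1 + s\<^sub>0) * (2 * incident_const \<alpha> * N) / cmod (z + \<i>)"
      using False z0 T B_nonneg norm_U_le s\<^sub>0_ge by (intro divide_right_mono mult_mono mult_nonneg_nonneg) auto
    also have "\<dots> \<le> c2 * E * N / cmod (z + \<i>)"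
    proof -
      have "Im z * (- (\<alpha> + R)) \<le> Im z * \<bar>\<alpha> + R\<bar>" using z0 by (intro mult_left_mono) auto
      also have "\<dots> \<le> s\<^sub>0 * \<bar>\<alpha> + R\<bar>" using False by (intro mult_right_mono) auto
      finally have "Im z * (- (\<alpha> + R)) \<le> s\<^sub>0 * \<bar>\<alpha> + R\<bar>" .
      then have "0 \<le> s\<^sub>0 * \<bar>\<alpha> + R\<bar> + Im z * (\<alpha> + R)" unfolding mult_minus_right by linarith
      then have "1 \<le> exp (s\<^sub>0 * \<bar>\<alpha> + R\<bar>) * E" unfolding E_def exp_add[symmetric] by simp
      from mult_left_mono[OF this, of "B * exp (T * s\<^sub>0) * (1 + s\<^sub>0) * (2 * incident_const \<alpha> * N)"]
      have "B * exp (T * s\<^sub>0) * (1 + s\<^sub>0) * (2 * incident_const \<alpha> * N) \<le> c2 * E * N"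
        using B_nonneg s\<^sub>0_ge by (simp add: c2_def incident_const_def H_norm_nonneg mult_ac)
      then show ?thesis by (rule divide_right_mono) simp
    qed
    finally show ?thesis by simp
  next
    case True
    define \<sigma> where "\<sigma> = Im z"
    have s: "\<sigma> > 0" using z0 by (simp add: \<sigma>_def)
    define A where "A = 4 * exp (\<sigma> * \<alpha> + \<bar>\<alpha>\<bar>) * exp (\<sigma> * R) * N"
    have "cmod (scatter_source f y (Complex (Re z) \<sigma>)) \<le> B * A / cmod (Complex (Re z) \<sigma> + \<i>)"
      unfolding A_def using True \<open>\<bar>y\<bar> \<le> R\<close>
      by (intro scatter_source_line_bound s sol_line_bound) (simp_all add: \<sigma>_def)
    moreover have "Complex (Re z) \<sigma> = z" by (simp add: \<sigma>_def)
    ultimately have "cmod (scatter_source f y z) \<le> B * A / cmod (z + \<i>)" by simp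
    also have "B * A = c1 * E * N" by (simp add: A_def c1_def E_def \<sigma>_def exp_add distrib_left mult_ac)
    finally show ?thesis by simp
  qed
  moreover have "c1 * E * N / cmod (z + \<i>) \<le> source_const \<alpha> * N * E / cmod (z + \<i>)"
    "c2 * E * N / cmod (z + \<i>) \<le> source_const \<alpha> * N * E / cmod (z + \<i>)"
    unfolding c(3) using c(1,2) by (auto simp: E_def H_norm_nonneg distrib_right mult_ac intro!: divide_right_mono)
  ultimately show ?thesis unfolding E_def by linarith
qed (simp add: scatter_source_outside source_const_nonneg H_norm_nonneg)

lemma
  assumes z: "z \<in> Cplus" and k: "\<And>y. \<bar>y\<bar> \<le> R \<Longrightarrow> \<bar>k y\<bar> \<le> R" and kc: "continuous_on UNIV k"
  shows scatter_integrand_integrable: "integrable lebesgue (\<lambda>y. exp (\<i> * z * of_real (k y)) * scatter_source f y z)"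
    and scatter_integral_bound: "cmod (\<integral>y. exp (\<i> * z * of_real (k y)) * scatter_source f y z \<partial>lebesgue)
      \<le> 2 * R * source_const \<alpha> * N * exp (Im z * (\<alpha> + 2 * R)) / cmod (z + \<i>)"
proof -
  define C where "C = source_const \<alpha> * N * exp (Im z * (\<alpha> + 2 * R)) / cmod (z + \<i>)"
  have z0: "Im z > 0" using z by (simp add: Cplus_def)
  let ?g = "\<lambda>y. exp (\<i> * z * of_real (k y)) * scatter_source f y z"
  have "?g \<in> borel_measurable lebesgue"
    using kc
    by (intro borel_measurable_times borel_measurable_integrable[OF scatter_source_integrable]
        borel_measurable_lebesgue_continuous continuous_intros) auto
  moreover have "cmod (?g y) \<le> C" for y
  proof (cases "\<bar>y\<bar> \<le> R")
    case True
    have "cmod (?g y) \<le> exp (Im z * R) * (source_const \<alpha> * N * exp (Im z * (\<alpha> + R)) / cmod (z + \<i>))"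
      unfolding norm_mult using norm_exp_line_le[OF z k[OF True]] scatter_source_bound[OF z, of y] by (intro mult_mono) auto
    also have "\<dots> = C" by (simp add: C_def exp_add[symmetric] algebra_simps)
    finally show ?thesis .
  qed (simp add: scatter_source_outside C_def source_const_nonneg H_norm_nonneg)
  ultimately have bdd: "?g \<in> borel_measurable lebesgue" "AE y in lebesgue. cmod (?g y) \<le> C" by auto
  have supp: "\<bar>y\<bar> > R \<Longrightarrow> ?g y = 0" for y by (simp add: scatter_source_outside)
  note * = integrable_bounded_interval[OF bdd(1) supp bdd(2) R]
  show "integrable lebesgue ?g" by (rule *(1))
  have "cmod (\<integral>y. ?g y \<partial>lebesgue) \<le> 2 * R * C"
    by (rule order_trans[OF integral_norm_bound *(2)])
  then show "cmod (\<integral>y. ?g y \<partial>lebesgue) \<le> 2 * R * source_const \<alpha> * N * exp (Im z * (\<alpha> + 2 * R)) / cmod (z + \<i>)"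
    by (simp add: C_def mult_ac)
qed


section \<open>The scattering operators\<close>

lemma reflection_bounded:
  shows "(\<lambda>\<omega>. reflection f \<omega> * \<omega>) holomorphic_on Cplus"
    and "H_normsq (\<alpha> + 2 * R) (\<lambda>\<omega>. reflection f \<omega> * \<omega>) \<le> ennreal ((R * source_const \<alpha> * N)\<^sup>2 * decay_mass)"
proof -
  have eq: "reflection f \<omega> * \<omega> = - (\<i> / 2) * (\<integral>y. exp (\<i> * \<omega> * of_real y) * scatter_source f y \<omega> \<partial>lebesgue)"
    if "\<omega> \<in> Cplus" for \<omega>
    using Cplus_nonzero[OF that] by (simp add: reflection_def)
  have "(\<lambda>\<omega>. - (\<i> / 2) * (\<integral>y. exp (\<i> * \<omega> * of_real y) * scatter_source f y \<omega> \<partial>lebesgue)) holomorphic_on Cplus"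
    by (intro holomorphic_on_mult holomorphic_on_const scatter_integral_holomorphic continuous_on_id)
  then show "(\<lambda>\<omega>. reflection f \<omega> * \<omega>) holomorphic_on Cplus" using holomorphic_cong[OF refl eq] by simp
  show "H_normsq (\<alpha> + 2 * R) (\<lambda>\<omega>. reflection f \<omega> * \<omega>) \<le> ennreal ((R * source_const \<alpha> * N)\<^sup>2 * decay_mass)"
  proof (rule H_normsq_decay_bound)
    fix \<omega> assume \<omega>: "\<omega> \<in> Cplus"
    show "cmod (reflection f \<omega> * \<omega>) \<le> R * source_const \<alpha> * N * exp (Im \<omega> * (\<alpha> + 2 * R)) / cmod (\<omega> + \<i>)"
      unfolding eq[OF \<omega>] using scatter_integral_bound[OF \<omega>, of "\<lambda>y. y"] by (simp add: norm_mult norm_divide mult_ac)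
  qed (use R in \<open>simp add: source_const_nonneg H_norm_nonneg\<close>)
qed

lemma transmission_bounded:
  shows "(\<lambda>\<omega>. transmission f \<omega> * \<omega>) holomorphic_on Cplus"
    and "H_normsq (\<alpha> + 2 * R) (\<lambda>\<omega>. transmission f \<omega> * \<omega>)
      \<le> 2 * ennreal (N\<^sup>2) + 2 * ennreal ((R * source_const \<alpha> * N)\<^sup>2 * decay_mass)"
proof -
  define h where "h \<omega> = - (\<i> / 2) * (\<integral>y. exp (\<i> * \<omega> * of_real (- y)) * scatter_source f y \<omega> \<partial>lebesgue)" for \<omega>
  have eq: "transmission f \<omega> * \<omega> = f \<omega> * \<omega> + h \<omega>" if "\<omega> \<in> Cplus" for \<omega>
    using Cplus_nonzero[OF that] by (simp add: transmission_def h_def left_diff_distrib)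
  have h: "h holomorphic_on Cplus" unfolding h_def
    by (intro holomorphic_on_mult holomorphic_on_const scatter_integral_holomorphic continuous_intros)
  have fw: "(\<lambda>\<omega>. f \<omega> * \<omega>) holomorphic_on Cplus"
    by (intro holomorphic_on_mult f_holomorphic holomorphic_intros)
  show "(\<lambda>\<omega>. transmission f \<omega> * \<omega>) holomorphic_on Cplus"
    using holomorphic_cong[OF refl eq] holomorphic_on_add[OF fw h] by simp
  have "H_normsq (\<alpha> + 2 * R) h \<le> ennreal ((R * source_const \<alpha> * N)\<^sup>2 * decay_mass)"
  proof (rule H_normsq_decay_bound)
    fix \<omega> assume \<omega>: "\<omega> \<in> Cplus"
    show "cmod (h \<omega>) \<le> R * source_const \<alpha> * N * exp (Im \<omega> * (\<alpha> + 2 * R)) / cmod (\<omega> + \<i>)"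
      unfolding h_def using scatter_integral_bound[OF \<omega>, of "\<lambda>y. - y"]
      by (simp add: norm_mult norm_divide continuous_on_minus mult_ac)
  qed (use R in \<open>simp add: source_const_nonneg H_norm_nonneg\<close>)
  moreover have "H_normsq (\<alpha> + 2 * R) (\<lambda>\<omega>. f \<omega> * \<omega>) \<le> ennreal (N\<^sup>2)"
  proof -
    have "cmod (f \<omega> * \<omega>) \<le> cmod (F \<omega>)" if "\<omega> \<in> Cplus" for \<omega>
    proof -
      show ?thesis using norm_le_norm_plus_ii[OF that] by (simp add: norm_mult mult_left_mono)
    qed
    then have "H_normsq (\<alpha> + 2 * R) (\<lambda>\<omega>. f \<omega> * \<omega>) \<le> H_normsq \<alpha> F" using R by (intro H_normsq_mono) auto
    then show ?thesis by (simp only: H_normsq_eq_H_norm[OF F_in_H])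
  qed
  moreover have "H_normsq (\<alpha> + 2 * R) (\<lambda>\<omega>. transmission f \<omega> * \<omega>) = H_normsq (\<alpha> + 2 * R) (\<lambda>\<omega>. f \<omega> * \<omega> + h \<omega>)"
    by (rule H_normsq_cong[OF eq])
  ultimately show "H_normsq (\<alpha> + 2 * R) (\<lambda>\<omega>. transmission f \<omega> * \<omega>)
      \<le> 2 * ennreal (N\<^sup>2) + 2 * ennreal ((R * source_const \<alpha> * N)\<^sup>2 * decay_mass)"
    using H_normsq_add_le[OF fw h, of "\<alpha> + 2 * R"]
    by (simp only:) (meson add_mono mult_left_mono order_trans zero_le)
qed

end

lemma scatter_source_linear:
  assumes f: "f \<in> weighted_H \<alpha>" and g: "g \<in> weighted_H \<alpha>"
  shows "scatter_source (\<lambda>\<omega>. c * f \<omega> + d * g \<omega>) y z = c * scatter_source f y z + d * scatter_source g y z"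
proof -
  have lin: "(\<lambda>\<omega>. c * f \<omega> + d * g \<omega>) \<in> weighted_H \<alpha>"
  proof -
    have "(\<lambda>\<omega>. c * (f \<omega> * (\<omega> + \<i>)) + d * (g \<omega> * (\<omega> + \<i>))) \<in> H_space \<alpha>"
      by (intro H_space_add H_space_cmult F_in_H f g)
    moreover have "(\<lambda>\<omega>. c * (f \<omega> * (\<omega> + \<i>)) + d * (g \<omega> * (\<omega> + \<i>))) = (\<lambda>\<omega>. (c * f \<omega> + d * g \<omega>) * (\<omega> + \<i>))"
      by (simp add: algebra_simps)
    ultimately show ?thesis using mult_H_iff[OF Cplus_plus_ii_nonzero] by simp
  qed
  have "apply_bcontfun (incident (\<lambda>\<omega>. c * f \<omega> + d * g \<omega>)) p = c * apply_bcontfun (incident f) p + d * apply_bcontfun (incident g) p" for p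
    by (cases p) (simp add: apply_incident[OF f] apply_incident[OF g] apply_incident[OF lin] algebra_simps)
  from line_sol_linear[of "incident (\<lambda>\<omega>. c * f \<omega> + d * g \<omega>)", OF this]
  have "apply_bcontfun (line_sol (incident (\<lambda>\<omega>. c * f \<omega> + d * g \<omega>)))
      = (\<lambda>p. c * apply_bcontfun (line_sol (incident f)) p + d * apply_bcontfun (line_sol (incident g)) p)"
    by (rule ext)
  then show ?thesis
    unfolding scatter_source_def using source_linear[OF U_cont[OF f] U_bd[OF f] U_cont[OF g] U_bd[OF g]] by simp
qed

lemma scatter_integral_linear:
  assumes f: "f \<in> weighted_H \<alpha>" and g: "g \<in> weighted_H \<alpha>" and k: "continuous_on UNIV k" and kR: "\<And>y. \<bar>y\<bar> \<le> R \<Longrightarrow> \<bar>k y\<bar> \<le> R"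
    and z: "z \<in> Cplus"
  shows "(\<integral>y. exp (\<i> * z * of_real (k y)) * scatter_source (\<lambda>\<omega>. c * f \<omega> + d * g \<omega>) y z \<partial>lebesgue)
      = c * (\<integral>y. exp (\<i> * z * of_real (k y)) * scatter_source f y z \<partial>lebesgue)
      + d * (\<integral>y. exp (\<i> * z * of_real (k y)) * scatter_source g y z \<partial>lebesgue)"
proof -
  have "(\<integral>y. exp (\<i> * z * of_real (k y)) * scatter_source (\<lambda>\<omega>. c * f \<omega> + d * g \<omega>) y z \<partial>lebesgue)
      = (\<integral>y. c * (exp (\<i> * z * of_real (k y)) * scatter_source f y z) + d * (exp (\<i> * z * of_real (k y)) * scatter_source g y z) \<partial>lebesgue)"
    by (simp add: scatter_source_linear[OF f g] algebra_simps)
  then show ?thesis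
    using scatter_integrand_integrable[OF f z kR k] scatter_integrand_integrable[OF g z kR k] by simp
qed

text \<open>
  The first summand is the contribution of the incident wave, the second one that of the scattered
  wave; both are quadratic in the norm \<open>K\<close> of the data.
\<close>

lemma H_norm_le_of_normsq:
  assumes "H_normsq \<beta> h \<le> 2 * ennreal (K\<^sup>2) + 2 * ennreal ((D * K)\<^sup>2 * decay_mass)" and K: "K \<ge> 0"
  shows "H_norm \<beta> h \<le> sqrt (2 + 2 * D\<^sup>2 * decay_mass) * K"
proof (rule H_norm_le)
  have nn: "0 \<le> 2 + 2 * D\<^sup>2 * decay_mass" using decay_mass_nonneg by simp
  have "2 * ennreal (K\<^sup>2) + 2 * ennreal ((D * K)\<^sup>2 * decay_mass) = ennreal (2 * K\<^sup>2 + 2 * ((D * K)\<^sup>2 * decay_mass))"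
    using decay_mass_nonneg by (simp add: ennreal_mult)
  also have "2 * K\<^sup>2 + 2 * ((D * K)\<^sup>2 * decay_mass) = (sqrt (2 + 2 * D\<^sup>2 * decay_mass) * K)\<^sup>2"
    using nn by (simp add: power_mult_distrib algebra_simps)
  finally show "H_normsq \<beta> h \<le> ennreal ((sqrt (2 + 2 * D\<^sup>2 * decay_mass) * K)\<^sup>2)" using assms(1) by simp
  show "0 \<le> sqrt (2 + 2 * D\<^sup>2 * decay_mass) * K" using nn K by simp
qed

theorem transmission_operator:
  "bounded_H_operator (\<lambda>\<omega>. inverse (\<omega> + \<i>)) \<alpha> (\<lambda>\<omega>. inverse \<omega>) (\<alpha> + 2 * R) transmission"
  unfolding bounded_H_operator_def
proof (intro conjI ballI allI)
  fix f assume f: "f \<in> weighted_H \<alpha>"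
  have "H_normsq (\<alpha> + 2 * R) (\<lambda>\<omega>. transmission f \<omega> * \<omega>) < top"
    using transmission_bounded(2)[OF f] by (rule order_le_less_trans) (simp add: ennreal_mult_less_top)
  then show "transmission f \<in> mult_H (\<lambda>\<omega>. inverse \<omega>) (\<alpha> + 2 * R)"
    using transmission_bounded(1)[OF f] by (subst mult_H_iff[OF Cplus_nonzero]) (auto simp: H_space_def)
next
  fix f g c d \<omega> assume f: "f \<in> weighted_H \<alpha>" and g: "g \<in> weighted_H \<alpha>" and \<omega>: "\<omega> \<in> Cplus"
  show "transmission (\<lambda>z. c * f z + d * g z) \<omega> = c * transmission f \<omega> + d * transmission g \<omega>"
    using scatter_integral_linear[OF f g _ _ \<omega>, of "\<lambda>y. - y" c d] unfolding transmission_def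
    by (simp add: continuous_on_minus algebra_simps)
next
  have "mult_H_norm (\<lambda>\<omega>. inverse \<omega>) (\<alpha> + 2 * R) (transmission f)
      \<le> sqrt (2 + 2 * (R * source_const \<alpha>)\<^sup>2 * decay_mass) * mult_H_norm (\<lambda>\<omega>. inverse (\<omega> + \<i>)) \<alpha> f"
    if f: "f \<in> weighted_H \<alpha>" for f
    unfolding mult_H_norm_inverse
    by (rule H_norm_le_of_normsq[OF transmission_bounded(2)[OF f] H_norm_nonneg])
  then show "\<exists>C. \<forall>f\<in>weighted_H \<alpha>. mult_H_norm (\<lambda>\<omega>. inverse \<omega>) (\<alpha> + 2 * R) (transmission f)
      \<le> C * mult_H_norm (\<lambda>\<omega>. inverse (\<omega> + \<i>)) \<alpha> f" by blast
qed

theorem reflection_operator: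
  "bounded_H_operator (\<lambda>\<omega>. inverse (\<omega> + \<i>)) \<alpha> (\<lambda>\<omega>. inverse \<omega>) (\<alpha> + 2 * R) reflection"
  unfolding bounded_H_operator_def
proof (intro conjI ballI allI)
  fix f assume f: "f \<in> weighted_H \<alpha>"
  have "H_normsq (\<alpha> + 2 * R) (\<lambda>\<omega>. reflection f \<omega> * \<omega>) < top"
    using reflection_bounded(2)[OF f] by (rule order_le_less_trans) simp
  then show "reflection f \<in> mult_H (\<lambda>\<omega>. inverse \<omega>) (\<alpha> + 2 * R)"
    using reflection_bounded(1)[OF f] by (subst mult_H_iff[OF Cplus_nonzero]) (auto simp: H_space_def)
next
  fix f g c d \<omega> assume f: "f \<in> weighted_H \<alpha>" and g: "g \<in> weighted_H \<alpha>" and \<omega>: "\<omega> \<in> Cplus"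
  show "reflection (\<lambda>z. c * f z + d * g z) \<omega> = c * reflection f \<omega> + d * reflection g \<omega>"
    using scatter_integral_linear[OF f g _ _ \<omega>, of "\<lambda>y. y" c d] unfolding reflection_def
    by (simp add: algebra_simps)
next
  have "mult_H_norm (\<lambda>\<omega>. inverse \<omega>) (\<alpha> + 2 * R) (reflection f)
      \<le> sqrt (2 + 2 * (R * source_const \<alpha>)\<^sup>2 * decay_mass) * mult_H_norm (\<lambda>\<omega>. inverse (\<omega> + \<i>)) \<alpha> f"
    if f: "f \<in> weighted_H \<alpha>" for f
    unfolding mult_H_norm_inverse
  proof (rule H_norm_le_of_normsq[OF _ H_norm_nonneg])
    let ?X = "ennreal ((R * source_const \<alpha> * H_norm \<alpha> (\<lambda>\<omega>. f \<omega> * (\<omega> + \<i>)))\<^sup>2 * decay_mass)"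
    have "?X \<le> 2 * ?X" by (simp add: mult_2)
    then show "H_normsq (\<alpha> + 2 * R) (\<lambda>\<omega>. reflection f \<omega> * \<omega>)
        \<le> 2 * ennreal ((H_norm \<alpha> (\<lambda>\<omega>. f \<omega> * (\<omega> + \<i>)))\<^sup>2) + 2 * ?X"
      using reflection_bounded(2)[OF f] by (meson add_increasing order_trans zero_le)
  qed
  then show "\<exists>C. \<forall>f\<in>weighted_H \<alpha>. mult_H_norm (\<lambda>\<omega>. inverse \<omega>) (\<alpha> + 2 * R) (reflection f)
      \<le> C * mult_H_norm (\<lambda>\<omega>. inverse (\<omega> + \<i>)) \<alpha> f" by blast
qed

end

section \<open>Distributional solutions vanishing outside an interval\<close>

lemma borel_measurable_lebesgue_AE:
  fixes f g :: "real \<Rightarrow> complex"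
  assumes f: "f \<in> borel_measurable lebesgue" and eq: "AE x in lebesgue. f x = g x"
  shows "g \<in> borel_measurable lebesgue"
proof (rule measurableI)
  fix S :: "complex set" assume S: "S \<in> sets borel"
  have ae: "AE x in lborel. \<not> (Q x \<and> f x \<noteq> g x)" for Q :: "real \<Rightarrow> bool"
    using eq unfolding AE_completion_iff by eventually_elim simp
  have null: "{x. Q x \<and> f x \<noteq> g x} \<in> sets lebesgue" for Q
    using sets_completion_AE[OF ae, of Q] by (simp add: pred_def)
  have "g -` S \<inter> space lebesgue = ((f -` S \<inter> space lebesgue) - {x. True \<and> f x \<noteq> g x}) \<union> {x. g x \<in> S \<and> f x \<noteq> g x}"
    by auto
  then show "g -` S \<inter> space lebesgue \<in> sets lebesgue"
    using measurable_sets[OF f S] null by (simp only:) (intro sets.Un sets.Diff)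
qed simp

lemma has_bochner_integral_lebesgue_AE:
  fixes f g :: "real \<Rightarrow> complex"
  assumes f: "has_bochner_integral lebesgue f I" and eq: "AE x in lebesgue. f x = g x"
  shows "has_bochner_integral lebesgue g I"
  using f has_bochner_integral_cong_AE[OF _ _ eq] borel_measurable_lebesgue_AE[OF _ eq]
    borel_measurable_has_bochner_integral[OF f] by blast

lemma vderiv_cong_open:
  assumes "open S" "x \<in> S" "\<And>y. y \<in> S \<Longrightarrow> f y = g y" "smooth f"
  shows "vderiv f x = vderiv g x"
proof -
  have "(g has_vector_derivative vderiv f x) (at x)"
    using has_vector_derivative_transform_within_open[OF smooth_has_vderiv[OF assms(4)] assms(1-3)] .
  then show ?thesis by (simp add: vderiv_def vector_derivative_at)
qed

lemma Helmholtz_adjoint_cong_open: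
  assumes S: "open S" "x \<in> S" and eq: "\<And>y. y \<in> S \<Longrightarrow> f y = g y" and sm: "smooth f"
  shows "Helmholtz_adjoint \<omega> f x = Helmholtz_adjoint \<omega> g x"
proof -
  have "vderiv f y = vderiv g y" if "y \<in> S" for y by (rule vderiv_cong_open[OF S(1) that eq sm])
  then have "vderiv (vderiv f) x = vderiv (vderiv g) x"
    by (intro vderiv_cong_open[OF S _ smooth_vderiv[OF sm]])
  then show ?thesis using eq[OF S(2)] by (simp add: Helmholtz_adjoint_def)
qed

lemma test_function_bounded:
  assumes "test_function \<phi>"
  obtains C where "\<And>x. cmod (\<phi> x) \<le> C"
proof -
  obtain K where K: "K > 0" "\<And>t. \<bar>t\<bar> \<ge> K \<Longrightarrow> \<phi> t = 0" using test_functionE[OF assms] by blast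
  have "compact (\<phi> ` {-K..K})"
    using assms unfolding test_function_def by (intro compact_continuous_image smooth_continuous) auto
  then have "bounded (\<phi> ` {-K..K})" by (rule compact_imp_bounded)
  then obtain C where "\<forall>y\<in>\<phi> ` {-K..K}. cmod y \<le> C" unfolding bounded_iff by auto
  then have C: "cmod (\<phi> x) \<le> C" if "\<bar>x\<bar> \<le> K" for x using that by (simp add: abs_le_iff)
  have "cmod (\<phi> x) \<le> \<bar>C\<bar>" for x
    using C[of x] K(2)[of x] by (cases "\<bar>x\<bar> \<le> K") auto
  then show thesis by (rule that)
qed

lemma integrable_mult_test_function:
  assumes S: "integrable lebesgue S" and \<phi>: "test_function \<phi>"
  shows "integrable lebesgue (\<lambda>x. S x * \<phi> x)"
proof -
  obtain C where C: "\<And>x. cmod (\<phi> x) \<le> C" using test_function_bounded[OF \<phi>] by blast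
  show ?thesis
  proof (rule Bochner_Integration.integrable_bound)
    show "integrable lebesgue (\<lambda>x. C * cmod (S x))" using S by simp
    show "(\<lambda>x. S x * \<phi> x) \<in> borel_measurable lebesgue"
      using S \<phi> by (intro borel_measurable_times borel_measurable_integrable[OF S] borel_measurable_lebesgue_continuous smooth_continuous)
        (simp add: test_function_def)
    show "AE x in lebesgue. cmod (S x * \<phi> x) \<le> norm (C * cmod (S x))"
    proof (rule AE_I2)
      fix x
      have "cmod (S x * \<phi> x) \<le> C * cmod (S x)"
        using mult_left_mono[OF C[of x], of "cmod (S x)"] by (simp add: norm_mult mult.commute)
      then show "cmod (S x * \<phi> x) \<le> norm (C * cmod (S x))" by simp
    qed
  qed
qed

text \<open>
  Both sides have the same image under \<open>D\<^sub>x\<^sup>2 - \<omega>\<^sup>2\<close>.  Testing with \<open>exp (\<plusminus>\<i>\<omega>x)\<close>, cut off outside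
  \<open>[-R, R]\<close>, shows that \<open>Q\<close> is orthogonal to these exponentials, hence that \<open>Green \<omega> Q\<close> vanishes outside
  \<open>[-R, R]\<close> as well.  The sum \<open>w + Green \<omega> Q\<close> is thus supported in \<open>[-R, R]\<close>, where every smooth \<open>\<phi>\<close> is
  \<open>(D\<^sub>x\<^sup>2 - \<omega>\<^sup>2) \<Phi>\<close> for a test function \<open>\<Phi>\<close>; so the sum is orthogonal to all smooth functions.
\<close>

lemma compactly_supported_solution_eq_Green:
  assumes R: "R > 0" and \<omega>: "\<omega> \<in> Cplus"
    and w: "\<And>x. \<bar>x\<bar> > R \<Longrightarrow> w x = 0" and wm: "w \<in> borel_measurable lebesgue"
    and Q: "integrable lebesgue Q" and Q0: "\<And>x. \<bar>x\<bar> > R \<Longrightarrow> Q x = 0"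
    and eq: "\<And>\<phi>. test_function \<phi> \<Longrightarrow> has_bochner_integral lebesgue (\<lambda>x. w x * Helmholtz_adjoint \<omega> \<phi> x + Q x * \<phi> x) 0"
  shows "AE x in lebesgue. w x = - Green \<omega> Q x"
proof -
  obtain \<psi> where \<psi>: "test_function \<psi>" "\<And>x. \<bar>x\<bar> \<le> R + 1 \<Longrightarrow> \<psi> x = 1"
    using plateau_exists[of "R + 1"] R by auto
  have cut: "test_function (\<lambda>x. \<psi> x * \<Phi> x)"
      and cut_eq: "\<And>x. \<bar>x\<bar> \<le> R \<Longrightarrow> Helmholtz_adjoint \<omega> (\<lambda>x. \<psi> x * \<Phi> x) x = Helmholtz_adjoint \<omega> \<Phi> x"
    if \<Phi>: "smooth \<Phi>" for \<Phi>
  proof -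
    obtain K where K: "\<And>t. \<bar>t\<bar> \<ge> K \<Longrightarrow> \<psi> t = 0" using test_functionE[OF \<psi>(1)] by blast
    have sm: "smooth (\<lambda>x. \<psi> x * \<Phi> x)" using \<psi>(1) \<Phi> by (intro smooth_mult) (auto simp: test_function_def)
    show "test_function (\<lambda>x. \<psi> x * \<Phi> x)" by (rule test_functionI[OF sm, of K]) (simp add: K)
    show "Helmholtz_adjoint \<omega> (\<lambda>x. \<psi> x * \<Phi> x) x = Helmholtz_adjoint \<omega> \<Phi> x" if "\<bar>x\<bar> \<le> R" for x
      by (rule Helmholtz_adjoint_cong_open[of "{x. \<bar>x\<bar> < R + 1}", OF _ _ _ sm])
         (use that \<psi>(2) in \<open>auto intro!: open_Collect_less continuous_intros\<close>)
  qed
  have Qcut: "Q x * (\<psi> x * \<Phi> x) = Q x * \<Phi> x" for \<Phi> x using Q0[of x] \<psi>(2)[of x] by (cases "\<bar>x\<bar> > R") auto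
  have wcut: "w x * Helmholtz_adjoint \<omega> (\<lambda>x. \<psi> x * \<Phi> x) x = w x * Helmholtz_adjoint \<omega> \<Phi> x" if "smooth \<Phi>" for \<Phi> x
    using w[of x] cut_eq[OF that, of x] by (cases "\<bar>x\<bar> > R") auto
  \<comment> \<open>The equation provides integrability of \<open>w\<close> against \<open>(D\<^sub>x\<^sup>2 - \<omega>\<^sup>2) \<phi>\<close> only;
        choose \<open>\<phi>\<close> for which this function is one on \<open>[-R, R]\<close>.\<close>
  have w_int: "integrable lebesgue w"
  proof -
    obtain \<Phi> where \<Phi>: "smooth \<Phi>" "\<And>x. - vderiv (vderiv \<Phi>) x - \<omega>\<^sup>2 * \<Phi> x = 1"
      using Helmholtz_smooth_solution[OF smooth_const[of 1] Cplus_nonzero[OF \<omega>]] by blast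
    have H1: "Helmholtz_adjoint \<omega> \<Phi> x = 1" for x using \<Phi>(2) by (simp add: Helmholtz_adjoint_def)
    have "integrable lebesgue (\<lambda>x. w x * Helmholtz_adjoint \<omega> (\<lambda>x. \<psi> x * \<Phi> x) x + Q x * (\<psi> x * \<Phi> x))"
      using eq[OF cut[OF \<Phi>(1)]] by (simp add: has_bochner_integral_iff)
    from Bochner_Integration.integrable_diff[OF this integrable_mult_test_function[OF Q cut[OF \<Phi>(1)]]]
    show ?thesis by (simp add: wcut[OF \<Phi>(1)] H1)
  qed
  have Q_orth: "(\<integral>x. Q x * exp (c * of_real x) \<partial>lebesgue) = 0" if c: "c\<^sup>2 = - \<omega>\<^sup>2" for c
  proof -
    define e where "e x = exp (c * of_real x)" for x :: real
    have sme: "smooth e" unfolding e_def by (rule smooth_exp)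
    have "vderiv e = (\<lambda>x. c * e x)" unfolding e_def by (intro vderiv_eqI has_vector_derivative_exp_of_real)
    moreover have "vderiv (\<lambda>x. c * e x) = (\<lambda>x. c * (c * e x))"
      unfolding e_def by (intro vderiv_eqI has_vector_derivative_mult_right has_vector_derivative_exp_of_real)
    ultimately have "Helmholtz_adjoint \<omega> e x = - c\<^sup>2 * e x - \<omega>\<^sup>2 * e x" for x
      by (simp add: Helmholtz_adjoint_def power2_eq_square)
    then have "Helmholtz_adjoint \<omega> e x = 0" for x by (simp add: c)
    then show ?thesis using eq[OF cut[OF sme]] unfolding wcut[OF sme] Qcut
      by (simp add: has_bochner_integral_iff e_def)
  qed
  have G0: "Green \<omega> Q x = 0" if "\<bar>x\<bar> > R" for x
  proof -
    have "(\<integral>y. exp (- \<i> * \<omega> * of_real y) * Q y \<partial>lebesgue) = 0" "(\<integral>y. exp (\<i> * \<omega> * of_real y) * Q y \<partial>lebesgue) = 0"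
      using Q_orth[of "- \<i> * \<omega>"] Q_orth[of "\<i> * \<omega>"] by (simp_all add: power_mult_distrib mult.commute)
    then show ?thesis using Green_right[of R Q x \<omega>, OF Q0] Green_left[of R Q x \<omega>, OF Q0] that
      by (cases "x > R") auto
  qed
  have G_int: "integrable lebesgue (Green \<omega> Q)"
    using Green_bound[OF Q \<omega>]
    by (intro integrable_bounded_interval(1)[OF borel_measurable_lebesgue_continuous[OF Green_continuous[OF Q \<omega>]] G0 AE_I2 R]) auto
  have "AE x in lebesgue. w x + Green \<omega> Q x = 0"
  proof (rule orthogonal_smooth_imp_AE_zero)
    show "integrable lebesgue (\<lambda>x. w x + Green \<omega> Q x)" using w_int G_int by simp
    fix \<phi> assume "smooth \<phi>"
    then obtain \<Phi> where \<Phi>: "smooth \<Phi>" "\<And>x. - vderiv (vderiv \<Phi>) x - \<omega>\<^sup>2 * \<Phi> x = \<phi> x"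
      using Helmholtz_smooth_solution[OF _ Cplus_nonzero[OF \<omega>]] by blast
    then have H: "Helmholtz_adjoint \<omega> \<Phi> x = \<phi> x" for x by (simp add: Helmholtz_adjoint_def)
    define h where "h = Helmholtz_adjoint \<omega> (\<lambda>x. \<psi> x * \<Phi> x)"
    have Gcut: "Green \<omega> Q x * h x = Green \<omega> Q x * \<phi> x" for x
      using G0[of x] cut_eq[OF \<Phi>(1), of x] unfolding h_def H by (cases "\<bar>x\<bar> > R") auto
    have 1: "has_bochner_integral lebesgue (\<lambda>x. w x * \<phi> x + Q x * \<Phi> x) 0"
      using eq[OF cut[OF \<Phi>(1)]] unfolding wcut[OF \<Phi>(1)] Qcut H .
    have 2: "has_bochner_integral lebesgue (\<lambda>x. Green \<omega> Q x * \<phi> x) (\<integral>x. Q x * \<Phi> x \<partial>lebesgue)"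
      using Green_distribution[OF Q \<omega> cut[OF \<Phi>(1)]] unfolding h_def[symmetric] Gcut Qcut .
    have 3: "has_bochner_integral lebesgue (\<lambda>x. Q x * \<Phi> x) (\<integral>x. Q x * \<Phi> x \<partial>lebesgue)"
      using integrable_mult_test_function[OF Q cut[OF \<Phi>(1)]] unfolding Qcut by (rule has_bochner_integral_integrable)
    have "has_bochner_integral lebesgue (\<lambda>x. (w x * \<phi> x + Q x * \<Phi> x) + (Green \<omega> Q x * \<phi> x - Q x * \<Phi> x))
        (0 + ((\<integral>x. Q x * \<Phi> x \<partial>lebesgue) - (\<integral>x. Q x * \<Phi> x \<partial>lebesgue)))"
      by (intro has_bochner_integral_add has_bochner_integral_diff 1 2 3)
    then have "has_bochner_integral lebesgue (\<lambda>x. (w x + Green \<omega> Q x) * \<phi> x) 0" by (simp add: algebra_simps)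
    then show "(\<integral>x. (w x + Green \<omega> Q x) * \<phi> x \<partial>lebesgue) = 0" by (simp add: has_bochner_integral_iff)
  qed
  then show ?thesis by eventually_elim (simp add: eq_neg_iff_add_eq_0)
qed

lemma continuous_le_if_rational_le:
  fixes g :: "real \<Rightarrow> real"
  assumes "continuous_on UNIV g" "\<And>q. q \<in> \<rat> \<Longrightarrow> g q \<le> K"
  shows "g l \<le> K"
proof -
  have "closed {l. g l \<le> K}" using assms(1) by (intro closed_Collect_le continuous_intros) auto
  moreover have "\<rat> \<subseteq> {l. g l \<le> K}" using assms(2) by auto
  ultimately have "closure \<rat> \<subseteq> {l. g l \<le> K}" by (rule closure_minimal[rotated])
  then show ?thesis using Rats_closure_real by auto
qed

lemma holomorphic_zero_on_line:
  assumes h: "h holomorphic_on Cplus" and \<sigma>: "\<sigma> > 0" and zero: "\<And>l. h (Complex l \<sigma>) = 0" and z: "z \<in> Cplus"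
  shows "h z = 0"
proof (rule analytic_continuation[OF h open_Cplus convex_connected[OF convex_Cplus]])
  show "range (\<lambda>l. Complex l \<sigma>) \<subseteq> Cplus" using \<sigma> by (auto simp: Cplus_def)
  show "Complex 0 \<sigma> \<in> Cplus" using \<sigma> by (simp add: Cplus_def)
  show "Complex 0 \<sigma> islimpt range (\<lambda>l. Complex l \<sigma>)"
    unfolding islimpt_sequential
  proof (intro exI[of _ "\<lambda>n. Complex (inverse (real (Suc n))) \<sigma>"] conjI allI)
    show "Complex (inverse (real (Suc n))) \<sigma> \<in> range (\<lambda>l. Complex l \<sigma>) - {Complex 0 \<sigma>}" for n by auto
    have "(\<lambda>n. of_real (inverse (real (Suc n))) + \<i> * of_real \<sigma>) \<longlonglongrightarrow> of_real 0 + \<i> * of_real \<sigma>"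
      by (intro tendsto_add tendsto_of_real tendsto_const LIMSEQ_inverse_real_of_nat)
    then show "(\<lambda>n. Complex (inverse (real (Suc n))) \<sigma>) \<longlonglongrightarrow> Complex 0 \<sigma>" by (simp only: Complex_eq)
  qed
qed (use zero z in auto)

text \<open>
  What membership in the local space says about \<open>[-R, R]\<close> and one horizontal line: a cutoff function
  that is one on \<open>[-R, R]\<close> turns the local condition into square integrability in both variables.
\<close>

lemma scriptH_loc_line:
  assumes u: "u \<in> mult_scriptH_infty_loc (\<lambda>\<omega>. inverse \<omega>)" and \<sigma>: "\<sigma> > 0" and R: "R > 0"
  defines "uc \<equiv> \<lambda>y l. if \<bar>y\<bar> \<le> R then u y (Complex l \<sigma>) else 0"
  shows "\<And>x. u x holomorphic_on Cplus"
    and "\<And>y. continuous_on UNIV (uc y)"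
    and "(\<lambda>(y, l). uc y l) \<in> borel_measurable (lebesgue \<Otimes>\<^sub>M lborel)"
    and "\<And>l. (\<lambda>y. uc y l) \<in> borel_measurable lebesgue"
    and "(\<integral>\<^sup>+p. ennreal ((cmod (uc (fst p) (snd p)))\<^sup>2) \<partial>(lebesgue \<Otimes>\<^sub>M lborel)) < \<infinity>"
proof -
  obtain g where g: "g \<in> scriptH_infty_loc" and ug: "\<And>x \<omega>. \<omega> \<in> Cplus \<Longrightarrow> u x \<omega> = inverse \<omega> * g x \<omega>"
    using u by (auto simp: mult_scriptH_infty_loc_def)
  have ghol: "g x holomorphic_on Cplus" for x using g by (simp add: scriptH_infty_loc_def)
  show hol: "u x holomorphic_on Cplus" for x
  proof -
    have "(\<lambda>\<omega>. inverse \<omega> * g x \<omega>) holomorphic_on Cplus"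
      using Cplus_nonzero by (intro holomorphic_on_mult ghol holomorphic_intros) auto
    then show ?thesis using holomorphic_cong[OF refl ug] by simp
  qed
  obtain \<psi> where \<psi>: "test_function \<psi>" "\<And>x. \<bar>x\<bar> \<le> R \<Longrightarrow> \<psi> x = 1" using plateau_exists[OF R] by blast
  obtain \<beta> where \<beta>: "(\<lambda>x \<omega>. \<psi> x * g x \<omega>) \<in> scriptH_space \<beta>"
    using g \<psi>(1) by (auto simp: scriptH_infty_loc_def scriptH_infty_def)
  define hc where "hc y l = \<psi> y * g y (Complex l \<sigma>)" for y l
  have C: "Complex l \<sigma> \<in> Cplus" for l using \<sigma> by (rule Complex_in_Cplus)
  have linecont: "continuous_on UNIV (\<lambda>l. k (Complex l \<sigma>))" if "k holomorphic_on Cplus" for k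
    using C by (intro continuous_on_compose2[OF holomorphic_on_imp_continuous_on[OF that]] continuous_Complex continuous_intros) auto
  have hcm: "(\<lambda>y. hc y l) \<in> borel_measurable lebesgue" for l
    using \<beta> C[of l] by (simp add: scriptH_space_def hc_def)
  have hcj: "(\<lambda>(y, l). hc y l) \<in> borel_measurable (lebesgue \<Otimes>\<^sub>M lborel)"
  proof (rule Caratheodory_measurable[OF hcm])
    show "continuous_on UNIV (hc y)" for y
      unfolding hc_def[abs_def] by (intro continuous_on_mult continuous_on_const linecont ghol)
  qed
  show uccont: "continuous_on UNIV (uc y)" for y
    by (cases "\<bar>y\<bar> \<le> R") (simp_all add: uc_def linecont hol)
  have uc: "uc y l = indicator {-R..R} y *\<^sub>R (inverse (Complex l \<sigma>) * hc y l)" for y l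
    using \<psi>(2)[of y] ug[OF C] by (auto simp: uc_def hc_def indicator_def abs_le_iff)
  show ucm: "(\<lambda>y. uc y l) \<in> borel_measurable lebesgue" for l
    unfolding uc by (intro borel_measurable_scaleR borel_measurable_times hcm borel_measurable_const borel_measurable_indicator) auto
  show "(\<lambda>(y, l). uc y l) \<in> borel_measurable (lebesgue \<Otimes>\<^sub>M lborel)"
    by (rule Caratheodory_measurable[OF ucm uccont])
  interpret L: sigma_finite_measure "lebesgue :: real measure" by (rule sigma_finite_lebesgue)
  interpret pair_sigma_finite "lebesgue :: real measure" "lborel :: real measure" ..
  have hc2: "(\<lambda>p. ennreal ((cmod (hc (fst p) (snd p)))\<^sup>2)) \<in> borel_measurable (lebesgue \<Otimes>\<^sub>M lborel)"
    using hcj by (simp add: case_prod_unfold)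
  let ?X = "\<integral>\<^sup>+l. (\<integral>\<^sup>+x. ennreal ((cmod (hc x l))\<^sup>2) \<partial>lebesgue) \<partial>lborel"
  have "ennreal (exp (- 2 * \<sigma> * \<beta>)) * ?X \<le> (SUP \<sigma>\<in>{0<..}. ennreal (exp (- 2 * \<sigma> * \<beta>)) *
        (\<integral>\<^sup>+l. (\<integral>\<^sup>+x. ennreal ((cmod (\<psi> x * g x (Complex l \<sigma>)))\<^sup>2) \<partial>lebesgue) \<partial>lborel))"
    unfolding hc_def using \<sigma> by (intro SUP_upper) auto
  also have "\<dots> < \<infinity>" using \<beta> by (simp add: scriptH_space_def)
  finally have X: "?X < \<infinity>" by (auto simp: ennreal_mult_less_top)
  have PX: "(\<integral>\<^sup>+p. ennreal ((cmod (hc (fst p) (snd p)))\<^sup>2) \<partial>(lebesgue \<Otimes>\<^sub>M lborel)) = ?X"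
    using nn_integral_snd[OF hc2] by simp
  have "(\<integral>\<^sup>+p. ennreal ((cmod (uc (fst p) (snd p)))\<^sup>2) \<partial>(lebesgue \<Otimes>\<^sub>M lborel))
      \<le> (\<integral>\<^sup>+p. ennreal (1 / \<sigma>\<^sup>2) * ennreal ((cmod (hc (fst p) (snd p)))\<^sup>2) \<partial>(lebesgue \<Otimes>\<^sub>M lborel))"
  proof (rule nn_integral_mono)
    fix p :: "real \<times> real"
    have "cmod (inverse (Complex (snd p) \<sigma>)) \<le> inverse \<sigma>"
      unfolding norm_inverse using \<sigma> abs_Im_le_cmod[of "Complex (snd p) \<sigma>"] by (intro le_imp_inverse_le) auto
    then have "cmod (uc (fst p) (snd p)) \<le> inverse \<sigma> * cmod (hc (fst p) (snd p))"
      unfolding uc using \<sigma> by (auto simp: indicator_def norm_mult intro!: mult_right_mono)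
    then have "(cmod (uc (fst p) (snd p)))\<^sup>2 \<le> (inverse \<sigma> * cmod (hc (fst p) (snd p)))\<^sup>2" by (intro power_mono) auto
    also have "\<dots> = 1 / \<sigma>\<^sup>2 * (cmod (hc (fst p) (snd p)))\<^sup>2" by (simp add: power_mult_distrib power_inverse inverse_eq_divide power_divide)
    finally show "ennreal ((cmod (uc (fst p) (snd p)))\<^sup>2) \<le> ennreal (1 / \<sigma>\<^sup>2) * ennreal ((cmod (hc (fst p) (snd p)))\<^sup>2)"
      by (simp add: ennreal_mult[symmetric] ennreal_leI)
  qed
  also have "\<dots> = ennreal (1 / \<sigma>\<^sup>2) * ?X" using hc2 by (simp add: nn_integral_cmult PX)
  also have "\<dots> < \<infinity>" using X by (simp add: ennreal_mult_less_top)
  finally show "(\<integral>\<^sup>+p. ennreal ((cmod (uc (fst p) (snd p)))\<^sup>2) \<partial>(lebesgue \<Otimes>\<^sub>M lborel)) < \<infinity>" .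
qed

context coefficient
begin

section \<open>Existence\<close>

lemma A_op_eq_line_conv: "A_op a \<gamma> v x z = line_conv (Im z) (\<lambda>l. memory (Complex l (Im z)) * v x (Complex l (Im z))) x z"
  unfolding A_op_def a_D_eq_line_conv memory_def[symmetric] ..

text \<open>
  On the support of the cutoff \<open>\<psi>\<close>, contained in \<open>[-K, K]\<close>, the incident part of \<open>\<omega> u\<close> is bounded by
  \<open>exp (\<sigma>K)\<close> times a function in \<open>H\<^sub>\<alpha>\<close>, and the scattered part by the weight \<open>1 / \<bar>\<omega> + \<i>\<bar>\<close> times
  \<open>exp (\<sigma> (\<alpha> + R))\<close>; \<open>\<beta> = \<bar>\<alpha>\<bar> + K + R\<close> dominates both exponents.
\<close>

lemma sol_in_space:
  assumes f: "f \<in> weighted_H \<alpha>"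
  shows "sol f \<in> mult_scriptH_infty_loc (\<lambda>\<omega>. inverse \<omega>)"
proof -
  define N where "N = H_norm \<alpha> (\<lambda>\<omega>. f \<omega> * (\<omega> + \<i>))"
  have N0: "N \<ge> 0" by (simp add: N_def H_norm_nonneg)
  define g where "g x \<omega> = \<omega> * sol f x \<omega>" for x \<omega>
  have ghol: "g x holomorphic_on Cplus" for x
    unfolding g_def[abs_def] by (intro holomorphic_on_mult sol_holomorphic[OF f] holomorphic_intros)
  have "(\<lambda>x \<omega>. \<psi> x * g x \<omega>) \<in> scriptH_infty" if \<psi>: "test_function \<psi>" for \<psi>
  proof -
    obtain K where K: "K > 0" "\<And>t. \<bar>t\<bar> \<ge> K \<Longrightarrow> \<psi> t = 0" using test_functionE[OF \<psi>] by blast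
    obtain c where c: "\<And>x. cmod (\<psi> x) \<le> c" using test_function_bounded[OF \<psi>] by blast
    have c0: "c \<ge> 0" using order_trans[OF norm_ge_zero c] .
    define D where "D = R * source_const \<alpha> * N"
    define \<beta> where "\<beta> = \<bar>\<alpha>\<bar> + K + R"
    define E where "E = 2 * K * (c\<^sup>2 * (2 * N\<^sup>2 + 2 * (D\<^sup>2 * decay_mass)))"
    have meas: "(\<lambda>x. \<psi> x * g x \<omega>) \<in> borel_measurable lebesgue" if \<omega>: "\<omega> \<in> Cplus" for \<omega>
    proof (rule borel_measurable_lebesgue_continuous)
      show "continuous_on UNIV (\<lambda>x. \<psi> x * g x \<omega>)"
        unfolding g_def sol_def using \<psi>
        by (intro continuous_intros smooth_continuous Green_continuous scatter_source_integrable[OF f] \<omega>)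
           (simp add: test_function_def)
    qed
    have pt: "(cmod (\<psi> x * g x \<omega>))\<^sup>2 \<le> (c\<^sup>2 * (2 * (exp (Im \<omega> * K) * cmod (f \<omega> * (\<omega> + \<i>)))\<^sup>2
        + 2 * ((D * exp (Im \<omega> * (\<alpha> + R)))\<^sup>2 * decay (Re \<omega>)))) * indicator {-K..K} x" if \<omega>: "\<omega> \<in> Cplus" for x \<omega>
    proof (cases "\<bar>x\<bar> \<le> K")
      case True
      have im: "Im \<omega> > 0" using \<omega> by (simp add: Cplus_def)
      have wi: "cmod \<omega> \<le> cmod (\<omega> + \<i>)" by (rule norm_le_norm_plus_ii[OF \<omega>])
      have "Im \<omega> * (- x) \<le> Im \<omega> * K" using im True by (intro mult_left_mono) auto
      then have "cmod (exp (\<i> * \<omega> * of_real x)) \<le> exp (Im \<omega> * K)" unfolding norm_exp_ii_times by simp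
      then have "cmod (exp (\<i> * \<omega> * of_real x)) * (cmod (f \<omega>) * cmod \<omega>) \<le> exp (Im \<omega> * K) * (cmod (f \<omega>) * cmod (\<omega> + \<i>))"
        using wi by (intro mult_mono mult_left_mono) auto
      then have 1: "cmod (\<omega> * (f \<omega> * exp (\<i> * \<omega> * of_real x))) \<le> exp (Im \<omega> * K) * cmod (f \<omega> * (\<omega> + \<i>))"
        by (simp add: norm_mult mult_ac)
      have "cmod (Green \<omega> (\<lambda>y. scatter_source f y \<omega>) x) \<le> R * (source_const \<alpha> * N * exp (Im \<omega> * (\<alpha> + R)) / cmod (\<omega> + \<i>)) / cmod \<omega>"
        unfolding N_def by (rule Green_bound_interval[OF scatter_source_integrable[OF f] scatter_source_outside[OF f] R scatter_source_bound[OF f \<omega>] \<omega>])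
      then have "cmod \<omega> * cmod (Green \<omega> (\<lambda>y. scatter_source f y \<omega>) x)
          \<le> cmod \<omega> * (R * (source_const \<alpha> * N * exp (Im \<omega> * (\<alpha> + R)) / cmod (\<omega> + \<i>)) / cmod \<omega>)"
        by (rule mult_left_mono) simp
      then have 2: "cmod (\<omega> * Green \<omega> (\<lambda>y. scatter_source f y \<omega>) x) \<le> D * exp (Im \<omega> * (\<alpha> + R)) / cmod (\<omega> + \<i>)"
        using Cplus_nonzero[OF \<omega>] by (simp add: norm_mult D_def mult_ac)
      note 3 = weight_square_le[OF \<omega>, of "D * exp (Im \<omega> * (\<alpha> + R))"]
      have "g x \<omega> = \<omega> * (f \<omega> * exp (\<i> * \<omega> * of_real x)) + - (\<omega> * Green \<omega> (\<lambda>y. scatter_source f y \<omega>) x)"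
        by (simp add: g_def sol_def algebra_simps)
      then have "(cmod (g x \<omega>))\<^sup>2 \<le> 2 * (cmod (\<omega> * (f \<omega> * exp (\<i> * \<omega> * of_real x))))\<^sup>2 + 2 * (cmod (\<omega> * Green \<omega> (\<lambda>y. scatter_source f y \<omega>) x))\<^sup>2"
        using norm_add_square_le by (metis norm_minus_cancel)
      also have "\<dots> \<le> 2 * (exp (Im \<omega> * K) * cmod (f \<omega> * (\<omega> + \<i>)))\<^sup>2 + 2 * ((D * exp (Im \<omega> * (\<alpha> + R)))\<^sup>2 * decay (Re \<omega>))"
        by (intro add_mono mult_left_mono power_mono[OF 1] order_trans[OF power_mono[OF 2] 3]) auto
      finally have "(cmod (\<psi> x))\<^sup>2 * (cmod (g x \<omega>))\<^sup>2 \<le> c\<^sup>2 * (2 * (exp (Im \<omega> * K) * cmod (f \<omega> * (\<omega> + \<i>)))\<^sup>2 + 2 * ((D * exp (Im \<omega> * (\<alpha> + R)))\<^sup>2 * decay (Re \<omega>)))"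
        using power_mono[OF c[of x], of 2] by (intro mult_mono) auto
      moreover have "x \<in> {-K..K}" using True by (simp add: abs_le_iff)
      ultimately show ?thesis by (simp add: norm_mult power_mult_distrib)
    next
      case False
      then have "x \<notin> {-K..K}" by auto
      then show ?thesis using False K(2)[of x] by simp
    qed
    have "(SUP \<sigma>\<in>{0<..}. ennreal (exp (- 2 * \<sigma> * \<beta>)) *
        (\<integral>\<^sup>+l. (\<integral>\<^sup>+x. ennreal ((cmod (\<psi> x * g x (Complex l \<sigma>)))\<^sup>2) \<partial>lebesgue) \<partial>lborel)) \<le> ennreal E"
    proof (rule SUP_least)
      fix \<sigma> :: real assume "\<sigma> \<in> {0<..}"
      then have \<sigma>: "\<sigma> > 0" by simp
      define F where "F l = (cmod (f (Complex l \<sigma>) * (Complex l \<sigma> + \<i>)))\<^sup>2" for l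
      define k1 where "k1 = 2 * K * (c\<^sup>2 * (2 * (exp (\<sigma> * K))\<^sup>2))"
      define k2 where "k2 = 2 * K * (c\<^sup>2 * (2 * (D * exp (\<sigma> * (\<alpha> + R)))\<^sup>2))"
      have k: "k1 \<ge> 0" "k2 \<ge> 0" using K(1) by (auto simp: k1_def k2_def)
      have Fm: "F \<in> borel_measurable borel"
        unfolding F_def[abs_def] using holomorphic_line_measurable[OF F_holomorphic[OF f] \<sigma>]
        by (intro borel_measurable_power measurable_compose[OF _ borel_measurable_norm]) auto
      have inner: "(\<integral>\<^sup>+x. ennreal ((cmod (\<psi> x * g x (Complex l \<sigma>)))\<^sup>2) \<partial>lebesgue) \<le> ennreal k1 * ennreal (F l) + ennreal (k2 * decay l)" for l
      proof -
        let ?c = "c\<^sup>2 * (2 * (exp (\<sigma> * K) * cmod (f (Complex l \<sigma>) * (Complex l \<sigma> + \<i>)))\<^sup>2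
            + 2 * ((D * exp (\<sigma> * (\<alpha> + R)))\<^sup>2 * decay l))"
        have c': "?c \<ge> 0" using decay_pos[of l] by (intro mult_nonneg_nonneg add_nonneg_nonneg) auto
        have "(\<integral>\<^sup>+x. ennreal ((cmod (\<psi> x * g x (Complex l \<sigma>)))\<^sup>2) \<partial>lebesgue) \<le> (\<integral>\<^sup>+x. ennreal ?c * indicator {-K..K} x \<partial>lebesgue)"
        proof (rule nn_integral_mono)
          fix x
          show "ennreal ((cmod (\<psi> x * g x (Complex l \<sigma>)))\<^sup>2) \<le> ennreal ?c * indicator {-K..K} x"
            using ennreal_leI[OF pt[OF Complex_in_Cplus[OF \<sigma>], of x l]] by (auto simp: indicator_def)
        qed
        also have "\<dots> = ennreal ?c * ennreal (2 * K)" using K(1) by (simp add: nn_integral_cmult_indicator)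
        also have "\<dots> = ennreal (?c * (2 * K))" using K(1) c' by (intro ennreal_mult[symmetric]) auto
        also have "?c * (2 * K) = k1 * F l + k2 * decay l"
          by (simp add: k1_def k2_def F_def power_mult_distrib algebra_simps)
        also have "ennreal \<dots> = ennreal k1 * ennreal (F l) + ennreal (k2 * decay l)"
          using k decay_pos[of l] by (subst ennreal_plus) (auto simp: F_def ennreal_mult)
        finally show ?thesis .
      qed
      have "(\<integral>\<^sup>+l. (\<integral>\<^sup>+x. ennreal ((cmod (\<psi> x * g x (Complex l \<sigma>)))\<^sup>2) \<partial>lebesgue) \<partial>lborel)
          \<le> (\<integral>\<^sup>+l. ennreal k1 * ennreal (F l) + ennreal (k2 * decay l) \<partial>lborel)"
        by (intro nn_integral_mono inner)
      also have "\<dots> = ennreal k1 * (\<integral>\<^sup>+l. ennreal (F l) \<partial>lborel) + (\<integral>\<^sup>+l. ennreal (k2 * decay l) \<partial>lborel)"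
        using Fm by (subst nn_integral_add) (auto simp: nn_integral_cmult)
      also have "(\<integral>\<^sup>+l. ennreal (k2 * decay l) \<partial>lborel) = ennreal (k2 * decay_mass)"
        using integrable_decay k unfolding decay_mass_def
        by (subst nn_integral_eq_integral) (auto intro!: AE_I2 mult_nonneg_nonneg less_imp_le[OF decay_pos])
      also have "ennreal k1 * (\<integral>\<^sup>+l. ennreal (F l) \<partial>lborel) \<le> ennreal k1 * ennreal ((exp (\<sigma> * \<alpha>) * N)\<^sup>2)"
        unfolding F_def N_def by (intro mult_left_mono H_norm_line_le[OF F_in_H[OF f] \<sigma>]) simp
      also have "ennreal k1 * ennreal ((exp (\<sigma> * \<alpha>) * N)\<^sup>2) + ennreal (k2 * decay_mass) = ennreal (k1 * (exp (\<sigma> * \<alpha>) * N)\<^sup>2 + k2 * decay_mass)"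
        using k decay_mass_nonneg by (simp add: ennreal_mult)
      finally have *: "(\<integral>\<^sup>+l. (\<integral>\<^sup>+x. ennreal ((cmod (\<psi> x * g x (Complex l \<sigma>)))\<^sup>2) \<partial>lebesgue) \<partial>lborel)
          \<le> ennreal (k1 * (exp (\<sigma> * \<alpha>) * N)\<^sup>2 + k2 * decay_mass)"
        by (simp add: add_right_mono)
      have e1: "(exp (\<sigma> * K))\<^sup>2 * (exp (\<sigma> * \<alpha>))\<^sup>2 \<le> exp (2 * \<sigma> * \<beta>)"
      proof -
        have "(exp (\<sigma> * K))\<^sup>2 * (exp (\<sigma> * \<alpha>))\<^sup>2 = exp (2 * \<sigma> * (K + \<alpha>))"
          by (simp add: exp_double[symmetric] exp_add[symmetric] algebra_simps)
        also have "\<dots> \<le> exp (2 * \<sigma> * \<beta>)" using \<sigma> R by (simp add: \<beta>_def)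
        finally show ?thesis .
      qed
      have e2: "(exp (\<sigma> * (\<alpha> + R)))\<^sup>2 \<le> exp (2 * \<sigma> * \<beta>)"
      proof -
        have "(exp (\<sigma> * (\<alpha> + R)))\<^sup>2 = exp (2 * \<sigma> * (\<alpha> + R))" by (simp add: exp_double[symmetric] mult_ac)
        also have "\<dots> \<le> exp (2 * \<sigma> * \<beta>)" using \<sigma> K(1) by (simp add: \<beta>_def)
        finally show ?thesis .
      qed
      have "k1 * (exp (\<sigma> * \<alpha>) * N)\<^sup>2 = 2 * K * c\<^sup>2 * 2 * N\<^sup>2 * ((exp (\<sigma> * K))\<^sup>2 * (exp (\<sigma> * \<alpha>))\<^sup>2)"
        by (simp add: k1_def power_mult_distrib)
      also have "\<dots> \<le> 2 * K * c\<^sup>2 * 2 * N\<^sup>2 * exp (2 * \<sigma> * \<beta>)" using K(1) by (intro mult_left_mono e1) auto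
      finally have b1: "k1 * (exp (\<sigma> * \<alpha>) * N)\<^sup>2 \<le> 2 * K * c\<^sup>2 * 2 * N\<^sup>2 * exp (2 * \<sigma> * \<beta>)" .
      have "k2 * decay_mass = 2 * K * c\<^sup>2 * 2 * D\<^sup>2 * decay_mass * (exp (\<sigma> * (\<alpha> + R)))\<^sup>2"
        by (simp add: k2_def power_mult_distrib)
      also have "\<dots> \<le> 2 * K * c\<^sup>2 * 2 * D\<^sup>2 * decay_mass * exp (2 * \<sigma> * \<beta>)"
        using K(1) decay_mass_nonneg by (intro mult_left_mono e2) auto
      finally have b2: "k2 * decay_mass \<le> 2 * K * c\<^sup>2 * 2 * D\<^sup>2 * decay_mass * exp (2 * \<sigma> * \<beta>)" .
      have "k1 * (exp (\<sigma> * \<alpha>) * N)\<^sup>2 + k2 * decay_mass \<le> E * exp (2 * \<sigma> * \<beta>)"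
        using b1 b2 by (simp add: E_def algebra_simps)
      with * have "(\<integral>\<^sup>+l. (\<integral>\<^sup>+x. ennreal ((cmod (\<psi> x * g x (Complex l \<sigma>)))\<^sup>2) \<partial>lebesgue) \<partial>lborel) \<le> ennreal (E * exp (2 * \<sigma> * \<beta>))"
        by (meson ennreal_leI order_trans)
      then have "ennreal (exp (- 2 * \<sigma> * \<beta>)) * (\<integral>\<^sup>+l. (\<integral>\<^sup>+x. ennreal ((cmod (\<psi> x * g x (Complex l \<sigma>)))\<^sup>2) \<partial>lebesgue) \<partial>lborel)
          \<le> ennreal (exp (- 2 * \<sigma> * \<beta>)) * ennreal (E * exp (2 * \<sigma> * \<beta>))" by (rule mult_left_mono) simp
      also have "\<dots> = ennreal (exp (- 2 * \<sigma> * \<beta>) * (E * exp (2 * \<sigma> * \<beta>)))"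
        by (rule ennreal_mult'[symmetric]) simp
      also have "exp (- 2 * \<sigma> * \<beta>) * (E * exp (2 * \<sigma> * \<beta>)) = E" by (simp add: exp_minus)
      finally show "ennreal (exp (- 2 * \<sigma> * \<beta>)) * (\<integral>\<^sup>+l. (\<integral>\<^sup>+x. ennreal ((cmod (\<psi> x * g x (Complex l \<sigma>)))\<^sup>2) \<partial>lebesgue) \<partial>lborel) \<le> ennreal E" .
    qed
    also have "\<dots> < \<infinity>" by simp
    finally have "(\<lambda>x \<omega>. \<psi> x * g x \<omega>) \<in> scriptH_space \<beta>"
      unfolding scriptH_space_def using meas by (auto intro!: holomorphic_on_mult ghol)
    then show ?thesis by (auto simp: scriptH_infty_def)
  qed
  then have "g \<in> scriptH_infty_loc" using ghol by (simp add: scriptH_infty_loc_def)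
  then show ?thesis
    unfolding mult_scriptH_infty_loc_def using Cplus_nonzero
    by (intro CollectI bexI[of _ g]) (auto simp: g_def)
qed

lemma sol_P_null:
  assumes f: "f \<in> weighted_H \<alpha>"
  shows "P_null a \<gamma> (sol f)"
  unfolding P_null_def
proof (intro allI impI ballI)
  fix \<phi> \<omega> assume \<phi>: "test_function \<phi>" and \<omega>: "\<omega> \<in> Cplus"
  have sm: "smooth \<phi>" using \<phi> by (simp add: test_function_def)
  obtain K where K: "\<And>t. \<bar>t\<bar> \<ge> K \<Longrightarrow> \<phi> t = 0" using test_functionE[OF \<phi>] by blast
  then have K': "\<And>t. \<bar>t\<bar> > K \<Longrightarrow> \<phi> t = 0" by simp
  let ?S = "\<lambda>y. scatter_source f y \<omega>" and ?h = "Helmholtz_adjoint \<omega> \<phi>"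
  have S: "integrable lebesgue ?S" by (rule scatter_source_integrable[OF f])
  have wave: "has_bochner_integral lebesgue (\<lambda>x. exp (\<i> * \<omega> * of_real x) * ?h x) 0"
  proof -
    have int: "integrable lborel (\<lambda>x. exp (\<i> * \<omega> * of_real x) * ?h x)"
    proof (rule integrable_continuous_compact_support[of _ K])
      show "continuous_on UNIV (\<lambda>x. exp (\<i> * \<omega> * of_real x) * ?h x)"
        by (intro continuous_intros smooth_continuous smooth_Helmholtz_adjoint sm)
    qed (simp add: Helmholtz_adjoint_support[OF sm K'])
    moreover have "(\<integral>x. exp (\<i> * \<omega> * of_real x) * ?h x \<partial>lborel) = 0"
      by (rule plane_wave_Helmholtz[OF sm K']) (simp_all add: power_mult_distrib)
    ultimately show ?thesis
      using borel_measurable_integrable[OF int] by (simp add: has_bochner_integral_iff integrable_completion integral_completion)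
  qed
  have src: "has_bochner_integral lebesgue (\<lambda>x. ?S x * \<phi> x) (\<integral>x. ?S x * \<phi> x \<partial>lebesgue)"
    by (rule has_bochner_integral_integrable[OF integrable_mult_test_function[OF S \<phi>]])
  have "has_bochner_integral lebesgue (\<lambda>x. (f \<omega> * (exp (\<i> * \<omega> * of_real x) * ?h x) - Green \<omega> ?S x * ?h x) + ?S x * \<phi> x)
      ((f \<omega> * 0 - (\<integral>x. ?S x * \<phi> x \<partial>lebesgue)) + (\<integral>x. ?S x * \<phi> x \<partial>lebesgue))"
    by (intro has_bochner_integral_add has_bochner_integral_diff has_bochner_integral_mult_right wave src Green_distribution S \<omega> \<phi>)
  then show "has_bochner_integral lebesgue
      (\<lambda>x. sol f x \<omega> * D\<^sub>x (D\<^sub>x \<phi>) x + (A_op a \<gamma> (sol f) x \<omega> - \<omega>\<^sup>2 * sol f x \<omega>) * \<phi> x) 0"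
    by (simp add: A_op_sol[OF f \<omega>] D_x_D_x[OF sm] Helmholtz_adjoint_def sol_def algebra_simps)
qed

lemma sol_scattering_solution:
  assumes f: "f \<in> weighted_H \<alpha>"
  shows "scattering_solution R \<gamma> a f (reflection f) (transmission f) (sol f)"
  unfolding scattering_solution_def using sol_in_space[OF f] sol_P_null[OF f] sol_left sol_right by blast

section \<open>Uniqueness\<close>

text \<open>
  The bound is linear in the square integral of \<open>v\<close>, and not in its norm, so that it can be integrated
  over \<open>y\<close>; it results from \<open>decay\<^sup>2 \<bar>v\<bar> \<le> decay + \<bar>v\<bar>\<^sup>2\<close>.
\<close>

lemma line_conv_square_integrable:
  assumes v: "v \<in> borel_measurable borel" and fin: "(\<integral>\<^sup>+l. ennreal ((cmod (v l))\<^sup>2) \<partial>lborel) < \<infinity>" and z: "Im z = \<sigma>"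
  shows "integrable lborel (\<lambda>l. ahat y (z - Complex l \<sigma>) * v l)"
    and "ennreal (cmod (line_conv \<sigma> v y z)) \<le> ennreal (8 * T * M) * (ennreal decay_mass + (\<integral>\<^sup>+l. ennreal ((cmod (v l))\<^sup>2) \<partial>lborel))"
proof -
  have v2: "integrable lborel (\<lambda>l. (cmod (v l))\<^sup>2)"
    using v fin by (intro integrableI_bounded) auto
  have bd: "cmod (ahat y (z - Complex l \<sigma>) * v l) \<le> 8 * T * M * (decay (Re z - l) + (cmod (v l))\<^sup>2)" for l
  proof -
    let ?d = "decay (Re z - l)"
    have d: "0 < ?d" "?d \<le> 1" by (rule decay_pos decay_le_1)+
    have "?d\<^sup>2 * cmod (v l) \<le> ?d * cmod (v l)" using decay_square_le by (intro mult_right_mono) auto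
    also have "\<dots> \<le> ?d\<^sup>2 + (cmod (v l))\<^sup>2"
    proof -
      have "0 \<le> ?d * cmod (v l)" using d by simp
      then show ?thesis using sum_squares_bound[of ?d "cmod (v l)"] by (simp only: mult.assoc)
    qed
    also have "\<dots> \<le> ?d + (cmod (v l))\<^sup>2" using decay_square_le by simp
    finally have 1: "?d\<^sup>2 * cmod (v l) \<le> ?d + (cmod (v l))\<^sup>2" .
    have "cmod (ahat y (z - Complex l \<sigma>)) \<le> 8 * T * M * ?d\<^sup>2" using ahat_bound[of y "z - Complex l \<sigma>"] z by simp
    then have "cmod (ahat y (z - Complex l \<sigma>)) * cmod (v l) \<le> (8 * T * M * ?d\<^sup>2) * cmod (v l)" by (rule mult_right_mono) simp
    also have "\<dots> = 8 * T * M * (?d\<^sup>2 * cmod (v l))" by simp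
    also have "\<dots> \<le> 8 * T * M * (?d + (cmod (v l))\<^sup>2)" using 1 T M by (intro mult_left_mono) auto
    finally show ?thesis by (simp add: norm_mult)
  qed
  have dom: "integrable lborel (\<lambda>l. 8 * T * M * (decay (Re z - l) + (cmod (v l))\<^sup>2))"
    using integrable_decay_reflect v2 by simp
  show int: "integrable lborel (\<lambda>l. ahat y (z - Complex l \<sigma>) * v l)"
  proof (rule Bochner_Integration.integrable_bound[OF dom])
    show "(\<lambda>l. ahat y (z - Complex l \<sigma>) * v l) \<in> borel_measurable lborel" using v ahat_line_measurable by simp
    show "AE l in lborel. cmod (ahat y (z - Complex l \<sigma>) * v l) \<le> norm (8 * T * M * (decay (Re z - l) + (cmod (v l))\<^sup>2))"
      by (intro AE_I2 order_trans[OF bd]) simp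
  qed
  let ?D = "\<integral>l. (cmod (v l))\<^sup>2 \<partial>lborel"
  have D: "ennreal ?D = (\<integral>\<^sup>+l. ennreal ((cmod (v l))\<^sup>2) \<partial>lborel)" using v2 by (intro nn_integral_eq_integral[symmetric]) auto
  have D0: "?D \<ge> 0" by simp
  have "cmod (\<integral>l. ahat y (z - Complex l \<sigma>) * v l \<partial>lborel) \<le> (\<integral>l. 8 * T * M * (decay (Re z - l) + (cmod (v l))\<^sup>2) \<partial>lborel)"
    by (rule Bochner_Integration.integral_norm_bound_integral[OF int dom bd])
  also have "\<dots> = 8 * T * M * (decay_mass + ?D)"
    using integrable_decay_reflect v2 by (simp add: integral_decay_reflect)
  finally have "cmod (\<integral>l. ahat y (z - Complex l \<sigma>) * v l \<partial>lborel) / (2 * pi) \<le> (8 * T * M * (decay_mass + ?D)) / (2 * pi)"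
    by (rule divide_right_mono) simp
  then have "cmod (line_conv \<sigma> v y z) \<le> (8 * T * M * (decay_mass + ?D)) / (2 * pi)"
    unfolding line_conv_def by (simp only: norm_mult norm_divide norm_one norm_of_real norm_numeral abs_of_pos[OF pi_gt_zero] times_divide_eq_left mult_1)
  also have "\<dots> \<le> (8 * T * M * (decay_mass + ?D)) / 1"
    using T M decay_mass_nonneg D0 pi_gt3 by (intro divide_left_mono mult_nonneg_nonneg add_nonneg_nonneg) auto
  finally have "ennreal (cmod (line_conv \<sigma> v y z)) \<le> ennreal (8 * T * M * (decay_mass + ?D))" by (simp add: ennreal_leI)
  also have "\<dots> = ennreal (8 * T * M) * (ennreal decay_mass + ennreal ?D)"
    using T M decay_mass_nonneg D0 by (simp add: ennreal_mult)
  finally show "ennreal (cmod (line_conv \<sigma> v y z)) \<le> ennreal (8 * T * M) * (ennreal decay_mass + (\<integral>\<^sup>+l. ennreal ((cmod (v l))\<^sup>2) \<partial>lborel))"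
    unfolding D .
qed

text \<open>
  The difference \<open>w\<close>, on the line of height \<open>s\<^sub>0\<close>, satisfies \<open>w = -Green Q\<close> with \<open>Q = A w\<close>.  Square
  integrability makes the integral of \<open>\<bar>Q(\<cdot>, l)\<bar>\<close> over \<open>[-R, R]\<close> finite, uniformly in \<open>l\<close>; hence \<open>w\<close> is
  bounded, and each further use of the equation halves the bound.
\<close>

lemma scattering_unique:
  assumes u: "u \<in> mult_scriptH_infty_loc (\<lambda>\<omega>. inverse \<omega>)" "P_null a \<gamma> u"
    and v: "v \<in> mult_scriptH_infty_loc (\<lambda>\<omega>. inverse \<omega>)" "P_null a \<gamma> v"
    and out: "\<And>x \<omega>. \<bar>x\<bar> > R \<Longrightarrow> \<omega> \<in> Cplus \<Longrightarrow> v x \<omega> = u x \<omega>"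
  shows "AE x in lebesgue. \<forall>\<omega>\<in>Cplus. v x \<omega> = u x \<omega>"
proof -
  have s: "s\<^sub>0 > 0" using s\<^sub>0_ge by simp
  define uc where "uc y l = (if \<bar>y\<bar> \<le> R then u y (Complex l s\<^sub>0) else 0)" for y l
  define vc where "vc y l = (if \<bar>y\<bar> \<le> R then v y (Complex l s\<^sub>0) else 0)" for y l
  note fu = scriptH_loc_line[OF u(1) s R, folded uc_def]
  note fv = scriptH_loc_line[OF v(1) s R, folded vc_def]
  define m where "m l = memory (Complex l s\<^sub>0)" for l
  have m: "cmod (m l) \<le> 1" "continuous_on UNIV m" for l
  proof -
    show "cmod (m l) \<le> 1" unfolding m_def by (rule norm_memory_le[OF line_in_Cplus])
    show "continuous_on UNIV m" unfolding m_def using line_in_Cplus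
      by (intro continuous_on_compose2[OF holomorphic_on_imp_continuous_on[OF memory_holomorphic]] continuous_Complex continuous_intros) auto
  qed
  have mm: "m \<in> borel_measurable borel" by (rule borel_measurable_continuous_onI[OF m(2)])
  define w where "w y l = vc y l - uc y l" for y l
  have w_cont: "continuous_on UNIV (w y)" for y unfolding w_def[abs_def] by (intro continuous_intros fu(2) fv(2))
  have w_meas: "(\<lambda>y. w y l) \<in> borel_measurable lebesgue" for l unfolding w_def by (intro borel_measurable_diff fu(4) fv(4))
  have w_joint: "(\<lambda>(y, l). w y l) \<in> borel_measurable (lebesgue \<Otimes>\<^sub>M lborel)"
    by (rule Caratheodory_measurable[OF w_meas w_cont])
  have w_out: "w y l = 0" if "\<bar>y\<bar> > R" for y l using that by (simp add: w_def uc_def vc_def)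
  have w_eq: "w y l = v y (Complex l s\<^sub>0) - u y (Complex l s\<^sub>0)" for y l
    using out[OF _ line_in_Cplus, of y l] by (auto simp: w_def uc_def vc_def not_le)
  interpret L: sigma_finite_measure "lebesgue :: real measure" by (rule sigma_finite_lebesgue)
  interpret pair_sigma_finite "lebesgue :: real measure" "lborel :: real measure" ..
  have slice_fin: "AE y in lebesgue. (\<integral>\<^sup>+l. ennreal ((cmod (c y l))\<^sup>2) \<partial>lborel) < \<infinity>"
    and slice_int: "(\<integral>\<^sup>+y. (\<integral>\<^sup>+l. ennreal ((cmod (c y l))\<^sup>2) \<partial>lborel) \<partial>lebesgue) < \<infinity>"
    and slice_meas: "(\<lambda>y. \<integral>\<^sup>+l. ennreal ((cmod (c y l))\<^sup>2) \<partial>lborel) \<in> borel_measurable lebesgue"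
    if c: "(\<lambda>(y, l). c y l) \<in> borel_measurable (lebesgue \<Otimes>\<^sub>M lborel)"
      "(\<integral>\<^sup>+p. ennreal ((cmod (c (fst p) (snd p)))\<^sup>2) \<partial>(lebesgue \<Otimes>\<^sub>M lborel)) < \<infinity>" for c :: "real \<Rightarrow> real \<Rightarrow> complex"
  proof -
    have c2: "(\<lambda>p. ennreal ((cmod (c (fst p) (snd p)))\<^sup>2)) \<in> borel_measurable (lebesgue \<Otimes>\<^sub>M lborel)"
      using c(1) by (simp add: case_prod_unfold)
    show meas: "(\<lambda>y. \<integral>\<^sup>+l. ennreal ((cmod (c y l))\<^sup>2) \<partial>lborel) \<in> borel_measurable lebesgue"
      using lborel.borel_measurable_nn_integral_fst[OF c2] by simp
    show fin: "(\<integral>\<^sup>+y. (\<integral>\<^sup>+l. ennreal ((cmod (c y l))\<^sup>2) \<partial>lborel) \<partial>lebesgue) < \<infinity>"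
      using lborel.nn_integral_fst[OF c2] c(2) by simp
    have "AE y in lebesgue. (\<integral>\<^sup>+l. ennreal ((cmod (c y l))\<^sup>2) \<partial>lborel) \<noteq> \<infinity>"
      using nn_integral_PInf_AE[OF meas] fin by simp
    then show "AE y in lebesgue. (\<integral>\<^sup>+l. ennreal ((cmod (c y l))\<^sup>2) \<partial>lborel) < \<infinity>"
      by eventually_elim (simp add: less_top)
  qed
  have w_fin: "(\<integral>\<^sup>+p. ennreal ((cmod (w (fst p) (snd p)))\<^sup>2) \<partial>(lebesgue \<Otimes>\<^sub>M lborel)) < \<infinity>"
  proof -
    have "(\<integral>\<^sup>+p. ennreal ((cmod (w (fst p) (snd p)))\<^sup>2) \<partial>(lebesgue \<Otimes>\<^sub>M lborel))
        \<le> (\<integral>\<^sup>+p. 2 * ennreal ((cmod (vc (fst p) (snd p)))\<^sup>2) + 2 * ennreal ((cmod (uc (fst p) (snd p)))\<^sup>2) \<partial>(lebesgue \<Otimes>\<^sub>M lborel))"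
    proof (rule nn_integral_mono)
      fix p :: "real \<times> real"
      have "(cmod (w (fst p) (snd p)))\<^sup>2 \<le> 2 * (cmod (vc (fst p) (snd p)))\<^sup>2 + 2 * (cmod (uc (fst p) (snd p)))\<^sup>2"
        using norm_add_square_le[of "vc (fst p) (snd p)" "- uc (fst p) (snd p)"] by (simp add: w_def)
      from ennreal_leI[OF this]
      show "ennreal ((cmod (w (fst p) (snd p)))\<^sup>2) \<le> 2 * ennreal ((cmod (vc (fst p) (snd p)))\<^sup>2) + 2 * ennreal ((cmod (uc (fst p) (snd p)))\<^sup>2)"
        by (simp add: ennreal_mult)
    qed
    also have "\<dots> = 2 * (\<integral>\<^sup>+p. ennreal ((cmod (vc (fst p) (snd p)))\<^sup>2) \<partial>(lebesgue \<Otimes>\<^sub>M lborel)) + 2 * (\<integral>\<^sup>+p. ennreal ((cmod (uc (fst p) (snd p)))\<^sup>2) \<partial>(lebesgue \<Otimes>\<^sub>M lborel))"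
      using fu(3) fv(3) by (subst nn_integral_add) (simp_all add: nn_integral_cmult case_prod_unfold)
    also have "\<dots> < \<infinity>" using fu(5) fv(5) by (simp add: ennreal_mult_less_top)
    finally show ?thesis .
  qed
  define n2 where "n2 y = (\<integral>\<^sup>+l. ennreal ((cmod (w y l))\<^sup>2) \<partial>lborel)" for y
  note n2 = slice_fin[OF w_joint w_fin, folded n2_def] slice_int[OF w_joint w_fin, folded n2_def] slice_meas[OF w_joint w_fin, folded n2_def]
  have mult_m: "(\<lambda>l. m l * c l) \<in> borel_measurable borel" "(\<integral>\<^sup>+l. ennreal ((cmod (m l * c l))\<^sup>2) \<partial>lborel) \<le> (\<integral>\<^sup>+l. ennreal ((cmod (c l))\<^sup>2) \<partial>lborel)"
    if "continuous_on UNIV c" for c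
  proof -
    show "(\<lambda>l. m l * c l) \<in> borel_measurable borel"
      by (intro borel_measurable_times mm borel_measurable_continuous_onI that)
    have "cmod (m l * c l) \<le> cmod (c l)" for l using mult_right_mono[OF m(1)[of l], of "cmod (c l)"] by (simp add: norm_mult)
    then show "(\<integral>\<^sup>+l. ennreal ((cmod (m l * c l))\<^sup>2) \<partial>lborel) \<le> (\<integral>\<^sup>+l. ennreal ((cmod (c l))\<^sup>2) \<partial>lborel)"
      by (intro nn_integral_mono ennreal_leI power_mono) auto
  qed
  define Q where "Q l y = line_conv s\<^sub>0 (\<lambda>l. m l * w y l) y (Complex l s\<^sub>0)" for l y
  have Q_out: "Q l y = 0" if "\<bar>y\<bar> > R" for l y using that by (simp add: Q_def line_conv_outside)
  have Q_meas: "Q l \<in> borel_measurable lebesgue" for l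
  proof -
    have "(\<lambda>(y, l). m l * w y l) \<in> borel_measurable (lebesgue \<Otimes>\<^sub>M lborel)"
      using mm w_joint by (simp add: case_prod_unfold)
    from line_conv_measurable[OF this] show ?thesis unfolding Q_def[abs_def] .
  qed
  define K0 where "K0 = enn2real (ennreal (8 * T * M) * (ennreal decay_mass * ennreal (2 * R) + (\<integral>\<^sup>+y. n2 y \<partial>lebesgue)))"
  have Q_int: "integrable lebesgue (Q l)" and Q_bd: "(\<integral>y. cmod (Q l y) \<partial>lebesgue) \<le> K0" for l
  proof -
    have "AE y in lebesgue. ennreal (cmod (Q l y)) \<le> ennreal (8 * T * M) * (ennreal decay_mass * indicator {-R..R} y + n2 y)"
      using n2(1)
    proof eventually_elim
      case (elim y)
      show ?case
      proof (cases "\<bar>y\<bar> \<le> R")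
        case True
        then have y: "y \<in> {-R..R}" by (simp add: abs_le_iff)
        have fin: "(\<integral>\<^sup>+l. ennreal ((cmod (m l * w y l))\<^sup>2) \<partial>lborel) < \<infinity>"
          using mult_m(2)[OF w_cont, of y] elim unfolding n2_def by (rule order_le_less_trans)
        have "ennreal (cmod (Q l y)) \<le> ennreal (8 * T * M) * (ennreal decay_mass + (\<integral>\<^sup>+l. ennreal ((cmod (m l * w y l))\<^sup>2) \<partial>lborel))"
          unfolding Q_def by (rule line_conv_square_integrable(2)[OF mult_m(1)[OF w_cont] fin]) simp
        also have "\<dots> \<le> ennreal (8 * T * M) * (ennreal decay_mass + n2 y)"
          unfolding n2_def by (intro mult_left_mono add_left_mono mult_m(2) w_cont) simp
        finally show ?thesis using y by simp
      qed (simp add: Q_out)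
    qed
    then have "(\<integral>\<^sup>+y. ennreal (cmod (Q l y)) \<partial>lebesgue) \<le> (\<integral>\<^sup>+y. ennreal (8 * T * M) * (ennreal decay_mass * indicator {-R..R} y + n2 y) \<partial>lebesgue)"
      by (rule nn_integral_mono_AE)
    also have "\<dots> = ennreal (8 * T * M) * (ennreal decay_mass * ennreal (2 * R) + (\<integral>\<^sup>+y. n2 y \<partial>lebesgue))"
    proof -
      have i: "(\<lambda>y. ennreal decay_mass * indicator {-R..R} y) \<in> borel_measurable lebesgue"
        by (intro borel_measurable_times_ennreal borel_measurable_const borel_measurable_indicator) auto
      have "(\<integral>\<^sup>+y. ennreal (8 * T * M) * (ennreal decay_mass * indicator {-R..R} y + n2 y) \<partial>lebesgue)
          = ennreal (8 * T * M) * (\<integral>\<^sup>+y. ennreal decay_mass * indicator {-R..R} y + n2 y \<partial>lebesgue)"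
        by (rule nn_integral_cmult[OF borel_measurable_add[OF i n2(3)]])
      also have "(\<integral>\<^sup>+y. ennreal decay_mass * indicator {-R..R} y + n2 y \<partial>lebesgue)
          = ennreal decay_mass * ennreal (2 * R) + (\<integral>\<^sup>+y. n2 y \<partial>lebesgue)"
        using R by (subst nn_integral_add[OF i n2(3)]) (simp add: nn_integral_cmult_indicator)
      finally show ?thesis .
    qed
    finally have le: "(\<integral>\<^sup>+y. ennreal (cmod (Q l y)) \<partial>lebesgue) \<le> ennreal (8 * T * M) * (ennreal decay_mass * ennreal (2 * R) + (\<integral>\<^sup>+y. n2 y \<partial>lebesgue))" (is "_ \<le> ?E") .
    have E: "?E < \<infinity>" using n2(2) by (simp add: ennreal_mult_less_top)
    show int: "integrable lebesgue (Q l)" using Q_meas order_le_less_trans[OF le E] by (rule integrableI_bounded)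
    have "ennreal (\<integral>y. cmod (Q l y) \<partial>lebesgue) \<le> ?E"
      using le nn_integral_eq_integral[OF integrable_norm[OF int]] by simp
    also have "?E = ennreal K0" using E by (simp add: K0_def)
    finally show "(\<integral>y. cmod (Q l y) \<partial>lebesgue) \<le> K0" by (simp add: K0_def)
  qed
  have AQ: "AE y in lebesgue. \<forall>l. A_op a \<gamma> v y (Complex l s\<^sub>0) - A_op a \<gamma> u y (Complex l s\<^sub>0) = Q l y"
    using slice_fin[OF fu(3) fu(5)] slice_fin[OF fv(3) fv(5)]
  proof eventually_elim
    case (elim y)
    show ?case
    proof (cases "\<bar>y\<bar> \<le> R")
      case True
      show ?thesis
      proof
        fix l
        have int: "integrable lborel (\<lambda>k. ahat y (Complex l s\<^sub>0 - Complex k s\<^sub>0) * (m k * c k))"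
          if "continuous_on UNIV c" "(\<integral>\<^sup>+l. ennreal ((cmod (c l))\<^sup>2) \<partial>lborel) < \<infinity>" for c
          by (rule line_conv_square_integrable(1)[OF mult_m(1)[OF that(1)] order_le_less_trans[OF mult_m(2)[OF that(1)] that(2)]]) simp
        have "v y (Complex k s\<^sub>0) = vc y k" "u y (Complex k s\<^sub>0) = uc y k" for k using True by (simp_all add: uc_def vc_def)
        then have A: "A_op a \<gamma> v y (Complex l s\<^sub>0) = line_conv s\<^sub>0 (\<lambda>k. m k * vc y k) y (Complex l s\<^sub>0)"
          "A_op a \<gamma> u y (Complex l s\<^sub>0) = line_conv s\<^sub>0 (\<lambda>k. m k * uc y k) y (Complex l s\<^sub>0)"
          by (simp_all add: A_op_eq_line_conv m_def)
        have "(\<integral>k. ahat y (Complex l s\<^sub>0 - Complex k s\<^sub>0) * (m k * w y k) \<partial>lborel)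
            = (\<integral>k. ahat y (Complex l s\<^sub>0 - Complex k s\<^sub>0) * (m k * vc y k) - ahat y (Complex l s\<^sub>0 - Complex k s\<^sub>0) * (m k * uc y k) \<partial>lborel)"
          by (simp only: w_def right_diff_distrib)
        also have "\<dots> = (\<integral>k. ahat y (Complex l s\<^sub>0 - Complex k s\<^sub>0) * (m k * vc y k) \<partial>lborel) - (\<integral>k. ahat y (Complex l s\<^sub>0 - Complex k s\<^sub>0) * (m k * uc y k) \<partial>lborel)"
          by (rule Bochner_Integration.integral_diff[OF int[OF fv(2) elim(2)] int[OF fu(2) elim(1)]])
        finally show "A_op a \<gamma> v y (Complex l s\<^sub>0) - A_op a \<gamma> u y (Complex l s\<^sub>0) = Q l y"
          unfolding A Q_def line_conv_def by (simp only: right_diff_distrib)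
      qed
    qed (simp add: A_op_eq_line_conv line_conv_outside Q_out)
  qed
  have w_Green: "AE x in lebesgue. w x l = - Green (Complex l s\<^sub>0) (Q l) x" for l
  proof (rule compactly_supported_solution_eq_Green[OF R line_in_Cplus w_out w_meas Q_int Q_out])
    fix \<phi> assume \<phi>: "test_function \<phi>"
    then have sm: "smooth \<phi>" by (simp add: test_function_def)
    let ?\<omega> = "Complex l s\<^sub>0"
    have "has_bochner_integral lebesgue
        (\<lambda>x. (v x ?\<omega> * D\<^sub>x (D\<^sub>x \<phi>) x + (A_op a \<gamma> v x ?\<omega> - ?\<omega>\<^sup>2 * v x ?\<omega>) * \<phi> x)
          - (u x ?\<omega> * D\<^sub>x (D\<^sub>x \<phi>) x + (A_op a \<gamma> u x ?\<omega> - ?\<omega>\<^sup>2 * u x ?\<omega>) * \<phi> x)) (0 - 0)"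
      using u(2) v(2) \<phi> line_in_Cplus unfolding P_null_def by (intro has_bochner_integral_diff) blast+
    then have "has_bochner_integral lebesgue
        (\<lambda>x. (v x ?\<omega> * D\<^sub>x (D\<^sub>x \<phi>) x + (A_op a \<gamma> v x ?\<omega> - ?\<omega>\<^sup>2 * v x ?\<omega>) * \<phi> x)
          - (u x ?\<omega> * D\<^sub>x (D\<^sub>x \<phi>) x + (A_op a \<gamma> u x ?\<omega> - ?\<omega>\<^sup>2 * u x ?\<omega>) * \<phi> x)) 0" by simp
    then show "has_bochner_integral lebesgue (\<lambda>x. w x l * Helmholtz_adjoint ?\<omega> \<phi> x + Q l x * \<phi> x) 0"
    proof (rule has_bochner_integral_lebesgue_AE)
      show "AE x in lebesgue. (v x ?\<omega> * D\<^sub>x (D\<^sub>x \<phi>) x + (A_op a \<gamma> v x ?\<omega> - ?\<omega>\<^sup>2 * v x ?\<omega>) * \<phi> x)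
          - (u x ?\<omega> * D\<^sub>x (D\<^sub>x \<phi>) x + (A_op a \<gamma> u x ?\<omega> - ?\<omega>\<^sup>2 * u x ?\<omega>) * \<phi> x)
          = w x l * Helmholtz_adjoint ?\<omega> \<phi> x + Q l x * \<phi> x"
        using AQ
      proof eventually_elim
        case (elim x)
        then have Q: "Q l x = A_op a \<gamma> v x ?\<omega> - A_op a \<gamma> u x ?\<omega>" by simp
        show ?case unfolding Q w_eq D_x_D_x[OF sm] Helmholtz_adjoint_def by (simp add: algebra_simps)
      qed
    qed
  qed
  have step: "AE x in lebesgue. \<forall>l. cmod (w x l) \<le> K / (2 * s\<^sub>0)" if K: "\<And>l. (\<integral>y. cmod (Q l y) \<partial>lebesgue) \<le> K" for K
  proof -
    \<comment> \<open>The exceptional set of \<open>x\<close> depends on \<open>l\<close>.  Countably many \<open>l\<close> suffice by continuity.\<close>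
    have "AE x in lebesgue. \<forall>l\<in>\<rat>. w x l = - Green (Complex l s\<^sub>0) (Q l) x"
      by (subst AE_ball_countable[OF countable_rat]) (blast intro: w_Green)
    then show ?thesis
    proof eventually_elim
      case (elim x)
      show ?case
      proof
        fix l
        show "cmod (w x l) \<le> K / (2 * s\<^sub>0)"
        proof (rule continuous_le_if_rational_le[of "\<lambda>l. cmod (w x l)"])
          show "continuous_on UNIV (\<lambda>l. cmod (w x l))" by (intro continuous_intros w_cont)
          fix q :: real assume "q \<in> \<rat>"
          have K0: "0 \<le> K" by (rule order_trans[OF Bochner_Integration.integral_nonneg K[of q]]) simp
          have "cmod (w x q) \<le> (\<integral>y. cmod (Q q y) \<partial>lebesgue) / (2 * cmod (Complex q s\<^sub>0))"
            using elim \<open>q \<in> \<rat>\<close> Green_bound[OF Q_int line_in_Cplus, of q q x] by simp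
          also have "\<dots> \<le> K / (2 * cmod (Complex q s\<^sub>0))" by (intro divide_right_mono K) simp
          also have "\<dots> \<le> K / (2 * s\<^sub>0)"
          proof (rule divide_left_mono[OF _ K0])
            have "s\<^sub>0 \<le> cmod (Complex q s\<^sub>0)" using abs_Im_le_cmod[of "Complex q s\<^sub>0"] by simp
            then show "2 * s\<^sub>0 \<le> 2 * cmod (Complex q s\<^sub>0)" "0 < 2 * cmod (Complex q s\<^sub>0) * (2 * s\<^sub>0)" using s by (auto simp: zero_less_mult_iff)
          qed
          finally show "cmod (w x q) \<le> K / (2 * s\<^sub>0)" .
        qed
      qed
    qed
  qed
  define N where "N n = K0 / (2 * s\<^sub>0) / 2 ^ n" for n :: nat
  have "AE x in lebesgue. \<forall>l. cmod (w x l) \<le> N n" for n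
  proof (induction n)
    case 0
    show ?case using step[OF Q_bd] by (simp add: N_def)
  next
    case (Suc n)
    have N0: "N n \<ge> 0" using s by (simp add: N_def K0_def)
    have "(\<integral>y. cmod (Q l y) \<partial>lebesgue) \<le> 2 * R * (B * N n)" for l
    proof (rule integrable_bounded_interval(2)[OF Q_meas Q_out _ R])
      show "AE y in lebesgue. cmod (Q l y) \<le> B * N n"
        using Suc
      proof eventually_elim
        case (elim y)
        have "cmod (m k * w y k) \<le> N n" for k
          using mult_mono[OF m(1)[of k] elim[rule_format, of k]] by (simp add: norm_mult)
        from line_conv_uniform_bound[OF mult_m(1)[OF w_cont] this, of s\<^sub>0 y "Complex l s\<^sub>0"]
        show ?case by (simp add: Q_def)
      qed
    qed
    from step[OF this] show ?case
    proof eventually_elim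
      case (elim x)
      have "2 * R * (B * N n) / (2 * s\<^sub>0) = R * B / s\<^sub>0 * N n" by simp
      also have "\<dots> \<le> 1 / 2 * N n" by (intro mult_right_mono contraction_factor N0) simp
      also have "\<dots> = N (Suc n)" by (simp add: N_def)
      finally show ?case using elim order_trans by blast
    qed
  qed
  then have "AE x in lebesgue. \<forall>n l. cmod (w x l) \<le> N n" by (subst AE_all_countable) blast
  then show ?thesis
  proof eventually_elim
    case (elim x)
    have w0: "w x l = 0" for l
    proof -
      have "(\<lambda>n. (K0 / (2 * s\<^sub>0)) * (1 / 2) ^ n) \<longlonglongrightarrow> (K0 / (2 * s\<^sub>0)) * 0"
        by (intro tendsto_mult tendsto_const LIMSEQ_power_zero) simp
      moreover have "N = (\<lambda>n. (K0 / (2 * s\<^sub>0)) * (1 / 2) ^ n)"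
        by (rule ext) (simp only: N_def power_one_over times_divide_eq_right mult_1_right)
      ultimately have "N \<longlonglongrightarrow> 0" by (simp only: mult_zero_right)
      then have "cmod (w x l) \<le> 0" by (rule LIMSEQ_le_const) (use elim in blast)
      then show ?thesis by simp
    qed
    show ?case
    proof
      fix \<omega> assume \<omega>: "\<omega> \<in> Cplus"
      have "v x \<omega> - u x \<omega> = 0"
      proof (rule holomorphic_zero_on_line[OF holomorphic_on_diff[OF fv(1) fu(1)] s _ \<omega>])
        show "v x (Complex l s\<^sub>0) - u x (Complex l s\<^sub>0) = 0" for l using w0[of l] w_eq[of x l] by simp
      qed
      then show "v x \<omega> = u x \<omega>" by simp
    qed
  qed
qed

theorem scattering_solution_unique:
  assumes "scattering_solution R \<gamma> a f r t u" "scattering_solution R \<gamma> a f r t v"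
  shows "AE x in lebesgue. \<forall>\<omega>\<in>Cplus. v x \<omega> = u x \<omega>"
proof (rule scattering_unique)
  fix x :: real and \<omega> assume x: "\<bar>x\<bar> > R" and \<omega>: "\<omega> \<in> Cplus"
  then consider "x < - R" | "x > R" by linarith
  then show "v x \<omega> = u x \<omega>"
    using assms \<omega> unfolding scattering_solution_def by cases metis+
qed (use assms in \<open>auto simp: scattering_solution_def\<close>)

end

section \<open>The scattering theorem\<close>

lemma coefficient_representative:
  assumes a: "Linfty_Cc_coefficient R T a" and "R > 0" "T > 0" "\<gamma> > 0"
  obtains M a' where "coefficient R T \<gamma> M a'" "AE x in lebesgue. a' x = a x"
proof -
  obtain C0 where C0: "AE x in lebesgue. \<forall>t. cmod ((vderiv ^^ 0) (a x) t) \<le> C0"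
    using a unfolding Linfty_Cc_coefficient_def by blast
  obtain C4 where C4: "AE x in lebesgue. \<forall>t. cmod ((vderiv ^^ 4) (a x) t) \<le> C4"
    using a unfolding Linfty_Cc_coefficient_def by blast
  define M where "M = max 0 (max C0 C4)"
  define good where "good x \<longleftrightarrow> smooth (a x) \<and> (\<forall>t. cmod (a x t) \<le> M) \<and> (\<forall>t. cmod ((vderiv ^^ 4) (a x) t) \<le> M) \<and>
    (\<forall>t. (x, t) \<notin> {-R..R} \<times> {-T..T} \<longrightarrow> a x t = 0)" for x
  have "AE x in lebesgue. smooth (a x)" "AE x in lebesgue. \<forall>t. (x, t) \<notin> {-R..R} \<times> {-T..T} \<longrightarrow> a x t = 0"
    using a unfolding Linfty_Cc_coefficient_def by blast+
  with C0 C4 have good: "AE x in lebesgue. good x"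
  proof eventually_elim
    case (elim x)
    have "C0 \<le> M" "C4 \<le> M" by (simp_all add: M_def)
    then have "cmod (a x t) \<le> M" "cmod ((vderiv ^^ 4) (a x) t) \<le> M" for t
      using elim(1)[rule_format, of t] elim(2)[rule_format, of t] by simp_all
    then show ?case using elim(3,4) unfolding good_def by simp
  qed
  define a' where "a' x = (if good x then a x else (\<lambda>t. 0))" for x
  have eq: "AE x in lebesgue. a' x = a x" using good by eventually_elim (simp add: a'_def)
  have z: "(vderiv ^^ k) (\<lambda>t. 0) = (\<lambda>t. 0)" for k
    by (induction k) (auto intro!: vderiv_eqI)
  have "coefficient R T \<gamma> M a'"
  proof
    show "(\<lambda>x. a' x t) \<in> borel_measurable lebesgue" for t
    proof (rule borel_measurable_lebesgue_AE)
      show "(\<lambda>x. a x t) \<in> borel_measurable lebesgue" using a unfolding Linfty_Cc_coefficient_def by blast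
      show "AE x in lebesgue. a x t = a' x t" using eq by eventually_elim simp
    qed
    show "smooth (a' x)" for x by (auto simp: a'_def good_def smooth_const)
    show "a' x t = 0" if "(x, t) \<notin> {-R..R} \<times> {-T..T}" for x t using that by (auto simp: a'_def good_def)
    show "cmod (a' x t) \<le> M" for x t by (auto simp: a'_def good_def M_def)
    show "cmod ((vderiv ^^ 4) (a' x) t) \<le> M" for x t
    proof (cases "good x")
      case False
      then show ?thesis using z[of 4] by (simp add: a'_def M_def)
    qed (simp add: a'_def good_def)
  qed (use assms in \<open>auto simp: M_def\<close>)
  then show thesis using eq by (rule that)
qed

lemma P_null_AE_cong:
  assumes eq: "AE x in lebesgue. a' x = a x" and P: "P_null a \<gamma> u"
  shows "P_null a' \<gamma> u"
  unfolding P_null_def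
proof (intro allI impI ballI)
  fix \<phi> \<omega> assume "test_function \<phi>" "\<omega> \<in> Cplus"
  with P have "has_bochner_integral lebesgue
      (\<lambda>x. u x \<omega> * D\<^sub>x (D\<^sub>x \<phi>) x + (A_op a \<gamma> u x \<omega> - \<omega>\<^sup>2 * u x \<omega>) * \<phi> x) 0"
    unfolding P_null_def by blast
  then show "has_bochner_integral lebesgue
      (\<lambda>x. u x \<omega> * D\<^sub>x (D\<^sub>x \<phi>) x + (A_op a' \<gamma> u x \<omega> - \<omega>\<^sup>2 * u x \<omega>) * \<phi> x) 0"
  proof (rule has_bochner_integral_lebesgue_AE)
    show "AE x in lebesgue. u x \<omega> * D\<^sub>x (D\<^sub>x \<phi>) x + (A_op a \<gamma> u x \<omega> - \<omega>\<^sup>2 * u x \<omega>) * \<phi> x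
        = u x \<omega> * D\<^sub>x (D\<^sub>x \<phi>) x + (A_op a' \<gamma> u x \<omega> - \<omega>\<^sup>2 * u x \<omega>) * \<phi> x"
      using eq by eventually_elim (simp add: A_op_def a_D_def)
  qed
qed

theorem theorem1:
  fixes R T\<^sub>0 \<gamma> :: real
    and a :: "real \<Rightarrow> real \<Rightarrow> complex"
  assumes "R > 0" and "T\<^sub>0 > 0" and "\<gamma> > 0"
    and "Linfty_Cc_coefficient R T\<^sub>0 a"
  shows "\<exists>Tr Rp :: (complex \<Rightarrow> complex) \<Rightarrow> complex \<Rightarrow> complex.
    (\<forall>\<alpha>::real. bounded_H_operator (\<lambda>\<omega>. inverse (\<omega> + \<i>)) \<alpha> (\<lambda>\<omega>. inverse \<omega>) (\<alpha> + 2 * R) Tr) \<and>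
    (\<forall>\<alpha>::real. bounded_H_operator (\<lambda>\<omega>. inverse (\<omega> + \<i>)) \<alpha> (\<lambda>\<omega>. inverse \<omega>) (\<alpha> + 2 * R) Rp) \<and>
    (\<forall>f\<in>mult_H (\<lambda>\<omega>. inverse (\<omega> + \<i>)) (- R).
       \<exists>u. scattering_solution R \<gamma> a f (Rp f) (Tr f) u \<and>
         (\<forall>v. scattering_solution R \<gamma> a f (Rp f) (Tr f) v \<longrightarrow>
            (AE x in lebesgue. \<forall>\<omega>\<in>Cplus. v x \<omega> = u x \<omega>)))"
proof -
  obtain M a' where coeff: "coefficient R T\<^sub>0 \<gamma> M a'" and eq: "AE x in lebesgue. a' x = a x"
    by (rule coefficient_representative[OF assms(4,1,2,3)])
  interpret coefficient R T\<^sub>0 \<gamma> M a' by (rule coeff)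
  have eq': "AE x in lebesgue. a x = a' x" using eq by eventually_elim simp
  have iff: "scattering_solution R \<gamma> a f r t u \<longleftrightarrow> scattering_solution R \<gamma> a' f r t u" for f r t u
    unfolding scattering_solution_def using P_null_AE_cong[OF eq, of \<gamma> u] P_null_AE_cong[OF eq', of \<gamma> u] by blast
  have "\<exists>u. scattering_solution R \<gamma> a f (reflection f) (transmission f) u \<and>
        (\<forall>v. scattering_solution R \<gamma> a f (reflection f) (transmission f) v \<longrightarrow>
          (AE x in lebesgue. \<forall>\<omega>\<in>Cplus. v x \<omega> = u x \<omega>))"
    if "f \<in> mult_H (\<lambda>\<omega>. inverse (\<omega> + \<i>)) (- R)" for f
  proof -
    have "scattering_solution R \<gamma> a' f (reflection f) (transmission f) (sol f)"
      using that by (rule sol_scattering_solution)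
    then show ?thesis unfolding iff using scattering_solution_unique by blast
  qed
  then show ?thesis
    by (intro exI[of _ transmission] exI[of _ reflection] conjI allI transmission_operator reflection_operator ballI)
qed

end
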